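(* Let $a,b\in L^\infty(\Omega)$, let $\alpha_1<p-1$, $\alpha_2<q-1$ and $\beta_1\beta_2=(p-1-\alpha_1)(q-1-\alpha_2)$, and set $\theta:=\sqrt{\beta_1(p-1-\alpha_1)}$, $\zeta:=\sqrt{\beta_2(q-1-\alpha_2)}$, $d:=\operatorname{diam}(\Omega)$. Let $$\mathcal{C}_1=\{(\lambda,\mu)\in(0,\infty)^2:\lambda^{1/\theta}\mu^{1/\zeta}=\Lambda_0\}$$ be the principal curve, i.e. the set of principal eigenvalues, of the system $$(-\Delta_p)^{s_1}u=\lambda a(x)|u|^{\alpha_1}|v|^{\beta_1-1}v \ \text{ in }\Omega,\qquad (-\Delta_q)^{s_2}v=\mu b(x)|v|^{\alpha_2}|u|^{\beta_2-1}u\ \text{ in }\Omega,\qquad u=v=0\ \text{ in }\mathbb{R}^N\setminus\Omega.$$ Then $$\Lambda_0\ \ge\ \frac{1}{C_{s_1,p}^{\frac{p-1}{\theta}}\,C_{s_2,q}^{\frac{q-1}{\zeta}}\,d^{\frac{ps_1}{\theta}+\frac{qs_2}{\zeta}}\,\|a\|_{L^\infty(\Omega)}^{\frac1\theta}\,\|b\|_{L^\infty(\Omega)}^{\frac1\zeta}}.$$ In particular, $\lim_{d\downarrow0}\Lambda_0=+\infty$.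
   Context: Standing assumptions: $\Omega\subset\mathbb{R}^N$ is a bounded domain with $C^2$ boundary; $p,q\in(1,\infty)$; $s_1,s_2\in(0,1)$; $a,b\in L^\infty(\Omega)$ with $\operatorname{ess\,inf}_\Omega a>0$ and $\operatorname{ess\,inf}_\Omega b>0$; $\alpha_i\ge 0$, $\beta_i>0$ are constants ($i=1,2$). For $m\in(1,\infty)$, $s\in(0,1)$, the fractional $m$-Laplacian is $(-\Delta_m)^su(x)=C(N,s,m)\lim_{\varepsilon\searrow0}\int_{\mathbb{R}^N\setminus B_\varepsilon(x)}\frac{|u(x)-u(y)|^{m-2}(u(x)-u(y))}{|x-y|^{N+sm}}\,dy$, with $C(N,s,m)>0$ a fixed normalization constant (omitted, i.e. taken equal to 1). For a bounded open set $D$, $W_0^{s,m}(D)$ is the space of $u\in L^m(D)$, extended by $0$ to $\mathbb{R}^N\setminus D$, with $\int_{\mathbb{R}^N}\int_{\mathbb{R}^N}\frac{|u(x)-u(y)|^m}{|x-y|^{N+sm}}\,dxdy<\infty$. A function $u\in W_0^{s,m}(D)$ is a weak solution of $(-\Delta_m)^su=f$ in $D$, $u=0$ in $\mathbb{R}^N\setminus D$, if $C(N,s,m)\int_{\mathbb{R}^N}\int_{\mathbb{R}^N}\frac{|u(x)-u(y)|^{m-2}(u(x)-u(y))(\varphi(x)-\varphi(y))}{|x-y|^{N+sm}}\,dxdy=\int_D f\varphi\,dx$ for all $\varphi\in W_0^{s,m}(D)$; weak solutions of the system are pairs in $W_0^{s_1,p}(\Omega)\times W_0^{s_2,q}(\Omega)$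 satisfying each equation in this sense. A pair $(\lambda,\mu)\in(0,\infty)^2$ is a principal eigenvalue of the system if the system has a weak solution $(\varphi,\psi)\in W_0^{s_1,p}(\Omega)\times W_0^{s_2,q}(\Omega)$ with $\varphi>0$ and $\psi>0$ in $\Omega$. Under the hypotheses of the claim there is a $\Lambda_0>0$ such that the set of principal eigenvalues is exactly the curve $\mathcal{C}_1$ in the claim; this is the $\Lambda_0$ meant. $C_{s,m}:=\sup\{w(x):x\in B_1\}$, where $B_1$ is the unit ball of $\mathbb{R}^N$ and $w\in W_0^{s,m}(B_1)\cap L^\infty(\mathbb{R}^N)$ is the unique weak solution of $(-\Delta_m)^sw=1$ in $B_1$, $w=0$ in $\mathbb{R}^N\setminus B_1$. *)

theory Defs
  imports "HOL-Analysis.Analysis" "HOL-Probability.Essential_Supremum"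
begin

text \<open>The ambient space is an arbitrary Euclidean space \<open>'a\<close>, with \<open>N = DIM('a)\<close>.\<close>

definition C2_function :: "('a::euclidean_space \<Rightarrow> real) \<Rightarrow> bool" where
  "C2_function \<gamma> \<longleftrightarrow>
     (\<exists>(g :: 'a \<Rightarrow> 'a) (H :: 'a \<Rightarrow> 'a \<Rightarrow>\<^sub>L 'a).
        (\<forall>x. (\<gamma> has_derivative (\<lambda>h. g x \<bullet> h)) (at x)) \<and>
        (\<forall>x. (g has_derivative blinfun_apply (H x)) (at x)) \<and>
        continuous_on UNIV H)"

text \<open>Near every boundary point the set is the strict epigraph of a \<open>C\<^sup>2\<close> function of
  \<open>N - 1\<close> variables in suitable orthonormal coordinates: \<open>e\<close> is the unit vector of the last
  coordinate axis, and \<open>y - (y \<bullet> e) *\<^sub>R e\<close> represents the first \<open>N - 1\<close> coordinates.\<close>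

definition C2_boundary :: "'a::euclidean_space set \<Rightarrow> bool" where
  "C2_boundary S \<longleftrightarrow>
     (\<forall>x \<in> frontier S. \<exists>r > 0. \<exists>e \<gamma>. norm e = 1 \<and> C2_function \<gamma> \<and>
        S \<inter> ball x r = {y \<in> ball x r. y \<bullet> e > \<gamma> (y - (y \<bullet> e) *\<^sub>R e)})"

definition bounded_C2_domain :: "'a::euclidean_space set \<Rightarrow> bool" where
  "bounded_C2_domain S \<longleftrightarrow>
     S \<noteq> {} \<and> open S \<and> connected S \<and> bounded S \<and> C2_boundary S"

definition Linf_on :: "'a::euclidean_space set \<Rightarrow> ('a \<Rightarrow> real) \<Rightarrow> bool" where
  "Linf_on D f \<longleftrightarrow>
     f \<in> borel_measurable (lebesgue_on D) \<and> esssup (lebesgue_on D) (\<lambda>x. ereal \<bar>f x\<bar>) < \<infinity>"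

definition Linf_norm :: "'a::euclidean_space set \<Rightarrow> ('a \<Rightarrow> real) \<Rightarrow> real" where
  "Linf_norm D f = real_of_ereal (esssup (lebesgue_on D) (\<lambda>x. ereal \<bar>f x\<bar>))"

definition essinf_on :: "'a::euclidean_space set \<Rightarrow> ('a \<Rightarrow> real) \<Rightarrow> ereal" where
  "essinf_on D f = - esssup (lebesgue_on D) (\<lambda>x. - ereal (f x))"

definition admissible_coeff :: "'a::euclidean_space set \<Rightarrow> ('a \<Rightarrow> real) \<Rightarrow> bool" where
  "admissible_coeff D f \<longleftrightarrow> Linf_on D f \<and> 0 < essinf_on D f"

text \<open>Elements of the fractional Sobolev space are represented by Lebesgue measurable functions
  on the whole space that vanish outside \<open>D\<close>. On the diagonal \<open>x = y\<close>, a null set, the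
  quotients below have the value \<open>0\<close>.\<close>

definition W0 :: "real \<Rightarrow> real \<Rightarrow> 'a::euclidean_space set \<Rightarrow> ('a \<Rightarrow> real) set" where
  "W0 s m D = {u.
     u \<in> borel_measurable lebesgue \<and> (\<forall>x. x \<notin> D \<longrightarrow> u x = 0) \<and>
     integrable lebesgue (\<lambda>x. \<bar>u x\<bar> powr m) \<and>
     integrable (lebesgue \<Otimes>\<^sub>M lebesgue)
       (\<lambda>(x, y). \<bar>u x - u y\<bar> powr m / norm (x - y) powr (real DIM('a) + s * m))}"

text \<open>The weak form of the fractional \<open>m\<close>-Laplacian, with normalization constant \<open>1\<close>.\<close>

definition frac_form ::
  "real \<Rightarrow> real \<Rightarrow> ('a::euclidean_space \<Rightarrow> real) \<Rightarrow> ('a \<Rightarrow> real) \<Rightarrow> real" where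
  "frac_form s m u \<phi> =
     (\<integral>z. (case z of (x, y) \<Rightarrow>
        \<bar>u x - u y\<bar> powr (m - 2) * (u x - u y) * (\<phi> x - \<phi> y)
          / norm (x - y) powr (real DIM('a) + s * m)) \<partial>(lebesgue \<Otimes>\<^sub>M lebesgue))"

text \<open>The integral on the right-hand side is required to exist for every test function, since
  the Bochner integral of a non-integrable function is \<open>0\<close> by convention.\<close>

definition weak_solution ::
  "real \<Rightarrow> real \<Rightarrow> 'a::euclidean_space set \<Rightarrow> ('a \<Rightarrow> real) \<Rightarrow> ('a \<Rightarrow> real) \<Rightarrow> bool" where
  "weak_solution s m D f u \<longleftrightarrow>
     u \<in> W0 s m D \<and>
     (\<forall>\<phi> \<in> W0 s m D.
        integrable (lebesgue_on D) (\<lambda>x. f x * \<phi> x) \<and>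
        frac_form s m u \<phi> = (\<integral>x. f x * \<phi> x \<partial>(lebesgue_on D)))"

text \<open>\<open>\<bar>t\<bar>\<close> to the power \<open>r \<ge> 0\<close> with \<open>0\<^sup>0 = 1\<close>, whereas \<open>0 powr 0 = 0\<close>.\<close>

definition abs_pow :: "real \<Rightarrow> real \<Rightarrow> real" where
  "abs_pow t r = (if r = 0 then 1 else \<bar>t\<bar> powr r)"

definition system_weak_solution ::
  "real \<Rightarrow> real \<Rightarrow> real \<Rightarrow> real \<Rightarrow> real \<Rightarrow> real \<Rightarrow> real \<Rightarrow> real \<Rightarrow>
   'a::euclidean_space set \<Rightarrow> ('a \<Rightarrow> real) \<Rightarrow> ('a \<Rightarrow> real) \<Rightarrow> real \<Rightarrow> real \<Rightarrow>
   ('a \<Rightarrow> real) \<Rightarrow> ('a \<Rightarrow> real) \<Rightarrow> bool" where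
  "system_weak_solution p q s1 s2 \<alpha>1 \<alpha>2 \<beta>1 \<beta>2 \<Omega> a b lam mu u v \<longleftrightarrow>
     weak_solution s1 p \<Omega>
       (\<lambda>x. lam * a x * abs_pow (u x) \<alpha>1 * (\<bar>v x\<bar> powr (\<beta>1 - 1) * v x)) u \<and>
     weak_solution s2 q \<Omega>
       (\<lambda>x. mu * b x * abs_pow (v x) \<alpha>2 * (\<bar>u x\<bar> powr (\<beta>2 - 1) * u x)) v"

text \<open>Positivity of (classes of) Sobolev functions is understood almost everywhere.\<close>

definition principal_eigenvalues ::
  "real \<Rightarrow> real \<Rightarrow> real \<Rightarrow> real \<Rightarrow> real \<Rightarrow> real \<Rightarrow> real \<Rightarrow> real \<Rightarrow>
   'a::euclidean_space set \<Rightarrow> ('a \<Rightarrow> real) \<Rightarrow> ('a \<Rightarrow> real) \<Rightarrow> (real \<times> real) set" where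
  "principal_eigenvalues p q s1 s2 \<alpha>1 \<alpha>2 \<beta>1 \<beta>2 \<Omega> a b =
     {(lam, mu). 0 < lam \<and> 0 < mu \<and>
        (\<exists>\<phi> \<psi>. system_weak_solution p q s1 s2 \<alpha>1 \<alpha>2 \<beta>1 \<beta>2 \<Omega> a b lam mu \<phi> \<psi> \<and>
           (AE x in lebesgue_on \<Omega>. 0 < \<phi> x) \<and> (AE x in lebesgue_on \<Omega>. 0 < \<psi> x))}"

definition curve :: "real \<Rightarrow> real \<Rightarrow> real \<Rightarrow> (real \<times> real) set" where
  "curve \<theta> \<zeta> \<Lambda> =
     {(lam, mu). 0 < lam \<and> 0 < mu \<and> lam powr (1 / \<theta>) * mu powr (1 / \<zeta>) = \<Lambda>}"

text \<open>The bounded solution of the torsion problem in the unit ball is unique up to null sets, so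
  the essential supremum does not depend on which representative is chosen.\<close>

definition torsion_function :: "real \<Rightarrow> real \<Rightarrow> 'a::euclidean_space \<Rightarrow> real" where
  "torsion_function s m = (SOME w. weak_solution s m (ball 0 1) (\<lambda>x. 1) w \<and> Linf_on UNIV w)"

definition torsion_sup :: "'a::euclidean_space itself \<Rightarrow> real \<Rightarrow> real \<Rightarrow> real" where
  "torsion_sup _ s m =
     real_of_ereal (esssup (lebesgue_on (ball (0::'a) 1)) (\<lambda>x. ereal (torsion_function s m x)))"

end

theory Submission
  imports Defs
begin

text \<open>
  The bound is obtained by comparing the eigenfunctions with the torsion function. Let \<open>(\<phi>, \<psi>)\<close> be a
  positive solution for a point \<open>(\<lambda>, \<mu>)\<close> of the curve, with suprema \<open>M\<close> and \<open>L\<close>. Then \<open>(-\<Delta>\<^sub>p)\<^bsup>s1\<^esup> \<phi>\<close> is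
  at most the constant \<open>c = \<lambda> \<parallel>a\<parallel> M\<^bsup>\<alpha>1\<^esup> L\<^bsup>\<beta>1\<^esup>\<close>. The domain lies in a ball of radius \<open>d\<close>, the diameter,
  and the torsion function of the unit ball, dilated to this ball and multiplied by
  \<open>(c d\<^bsup>p s1\<^esup>)\<^bsup>1/(p-1)\<^esup>\<close>, solves the equation with right-hand side \<open>c\<close>. The comparison principle
  (\<open>torsion_bound\<close>) therefore yields \<open>M\<^bsup>p-1\<^esup> \<le> \<lambda> \<parallel>a\<parallel> M\<^bsup>\<alpha>1\<^esup> L\<^bsup>\<beta>1\<^esup> d\<^bsup>p s1\<^esup> C\<^bsup>p-1\<^esup>\<close>, where \<open>C\<close> is the
  maximum of the torsion function, and a similar estimate holds for \<open>L\<close>. In the product of the first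
  estimate to the power \<open>1 / \<theta>\<close> and the second to the power \<open>1 / \<zeta>\<close> the balance condition on the exponents
  cancels \<open>M\<close> and \<open>L\<close>. What remains is \<open>1 \<le> \<Lambda>0 X\<close> with \<open>X\<close> the denominator of the claimed bound
  (\<open>principal_eigenvalue_bound\<close>). Since \<open>X\<close> contains a positive power of \<open>d\<close>, the limit for small
  diameters follows.

  Two facts make this argument rigorous. First, weak eigenfunctions are bounded (\<open>system_bounded\<close>),
  although the individual exponents may be supercritical. The reason is that, after replacing \<open>\<psi>\<close> by a
  power \<open>\<psi>\<^sup>\<rho>\<close>, each right-hand side is homogeneous of the same degree as its operator, so that any gain
  of integrability can be iterated. The gain comes from an elementary Faber-Krahn inequality
  (\<open>faber_krahn\<close>). It leads to a bound of the measure of \<open>{u > k + h}\<close> by the measure of \<open>{u > k}\<close> and the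
  integral of the right-hand side over the latter set (\<open>superlevel_estimate\<close>). Alternating between the two equations shows that
  all powers are integrable, and De Giorgi's lemma then gives boundedness.

  Second, the torsion function exists (\<open>torsion_exists\<close>). It minimizes a convex energy. The energy is
  submodular with respect to pointwise maxima and minima, and therefore the limes superior of a
  sufficiently fast minimizing sequence is a minimizer.
\<close>

section \<open>Signed powers and the convexity of powers\<close>

text \<open>The nonlinearity \<open>\<bar>t\<bar>\<^bsup>m-2\<^esup> t\<close> of the fractional \<open>m\<close>-Laplacian, which for \<open>m > 1\<close> is the
  derivative of \<open>\<bar>t\<bar>\<^sup>m / m\<close>.\<close>

definition spow :: "real \<Rightarrow> real \<Rightarrow> real" where
  "spow m t = \<bar>t\<bar> powr (m - 2) * t"

lemma spow_minus [simp]: "spow m (- t) = - spow m t"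
  by (simp add: spow_def)

lemma spow_0 [simp]: "spow m 0 = 0"
  by (simp add: spow_def)

lemma spow_nonneg: "0 \<le> t \<Longrightarrow> spow m t = t powr (m - 1)"
  using powr_add[of t "m - 2" 1] by (cases "t = 0") (auto simp: spow_def)

lemma powr_pred_times: "0 \<le> t \<Longrightarrow> t powr (m - 1) * t = t powr m" for t :: real
  using powr_add[of t "m - 1" 1] by (cases "t = 0") auto

lemma abs_spow: "\<bar>spow m t\<bar> = \<bar>t\<bar> powr (m - 1)"
  using spow_nonneg[of "\<bar>t\<bar>" m] by (simp add: spow_def abs_mult)

lemma spow_times_self: "spow m t * t = \<bar>t\<bar> powr m"
proof (cases "t = 0")
  case False
  have "spow m t * t = \<bar>t\<bar> powr (m - 2) * (\<bar>t\<bar> * \<bar>t\<bar>)"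
    by (simp add: spow_def)
  also have "\<dots> = \<bar>t\<bar> powr (m - 2) * \<bar>t\<bar> powr 2"
    by (simp add: power2_eq_square)
  also have "\<dots> = \<bar>t\<bar> powr m"
    unfolding powr_add[symmetric] by simp
  finally show ?thesis .
qed simp

lemma spow_strict_mono:
  assumes "1 < m" "x < y" shows "spow m x < spow m y"
proof -
  have pos: "spow m s < spow m t" if "0 \<le> s" "s < t" for s t
    using that assms by (simp add: spow_nonneg powr_less_mono2)
  consider "0 \<le> x" | "x < 0" "0 \<le> y" | "y < 0" by linarith
  then show ?thesis
  proof cases
    case 1 then show ?thesis using pos assms by blast
  next
    case 2
    have "0 < spow m (- x)" using pos[of 0 "- x"] 2 by simp
    moreover have "0 \<le> spow m y" using 2 by (simp add: spow_nonneg)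
    ultimately show ?thesis by simp
  next
    case 3
    then show ?thesis using pos[of "- y" "- x"] assms by simp
  qed
qed

lemma spow_mono: "1 < m \<Longrightarrow> x \<le> y \<Longrightarrow> spow m x \<le> spow m y"
  using spow_strict_mono[of m x y] by (cases "x = y") auto

lemma isCont_spow:
  assumes "1 < m" shows "isCont (spow m) t"
proof (cases "t = 0")
  case False
  then show ?thesis unfolding spow_def by (intro continuous_intros) auto
next
  case True
  have "((\<lambda>t::real. \<bar>t\<bar>) \<longlongrightarrow> 0) (at 0)"
    using tendsto_rabs[OF tendsto_ident_at[of 0 UNIV]] by simp
  then have "((\<lambda>t::real. \<bar>t\<bar> powr (m - 1)) \<longlongrightarrow> 0) (at 0)"
    using assms by (intro tendsto_zero_powrI[OF _ tendsto_const]) simp_all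
  then have "((\<lambda>t. spow m t) \<longlongrightarrow> 0) (at 0)"
    by (rule Lim_null_comparison[rotated]) (simp add: abs_spow)
  then show ?thesis using True by (simp add: isCont_def)
qed

lemma spow_times_le:
  assumes "1 < m" shows "\<bar>spow m x * y\<bar> \<le> \<bar>x\<bar> powr m + \<bar>y\<bar> powr m"
proof -
  let ?M = "max \<bar>x\<bar> \<bar>y\<bar>"
  have "\<bar>spow m x * y\<bar> \<le> ?M powr (m - 1) * ?M"
    unfolding abs_mult abs_spow using assms by (intro mult_mono powr_mono2) auto
  also have "\<dots> = ?M powr m"
    by (intro powr_pred_times) auto
  also have "\<dots> \<le> \<bar>x\<bar> powr m + \<bar>y\<bar> powr m"
    by (auto simp: max_def)
  finally show ?thesis .
qed

text \<open>A differentiable convex function lies above its tangents. In the form needed here this is Young's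
  inequality for the product of \<open>\<bar>x\<bar>\<^bsup>m-1\<^esup>\<close> and \<open>\<bar>y\<bar>\<close>, whose exponents are \<open>m / (m - 1)\<close> and \<open>m\<close>.\<close>

lemma abs_powr_tangent:
  assumes "1 < m" shows "\<bar>x\<bar> powr m + m * spow m x * (y - x) \<le> \<bar>y\<bar> powr m"
proof -
  \<comment> \<open>the conjugate exponent\<close>
  define m' where "m' = m / (m - 1)"
  have m': "1 < m'" "1 / m' + 1 / m = 1" "(m - 1) * m' = m" using assms
    by (auto simp: m'_def field_simps)
  have "spow m x * y \<le> \<bar>x\<bar> powr (m - 1) * \<bar>y\<bar>"
    by (metis abs_ge_self abs_mult abs_spow)
  also have "\<dots> \<le> (\<bar>x\<bar> powr (m - 1)) powr m' / m' + \<bar>y\<bar> powr m / m"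
    using assms m' by (intro Youngs_inequality) auto
  also have "(\<bar>x\<bar> powr (m - 1)) powr m' = \<bar>x\<bar> powr m"
    by (simp add: powr_powr m')
  finally have "m * (spow m x * y) \<le> m * (\<bar>x\<bar> powr m / m' + \<bar>y\<bar> powr m / m)"
    using assms by simp
  also have "\<dots> = (m - 1) * \<bar>x\<bar> powr m + \<bar>y\<bar> powr m"
    using assms by (simp add: m'_def field_simps)
  finally have "m * (spow m x * y) \<le> (m - 1) * \<bar>x\<bar> powr m + \<bar>y\<bar> powr m" .
  moreover have "m * spow m x * (y - x) = m * (spow m x * y) - m * \<bar>x\<bar> powr m"
    using spow_times_self[of m x] by (simp add: right_diff_distrib mult.assoc)
  ultimately show ?thesis by (simp add: left_diff_distrib)
qed

text \<open>Of two pairs with the same sum, the more spread out one has the larger sum of values of a convex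
  function: adding the tangent inequalities at the inner pair leaves a product of two differences
  with the same sign.\<close>

lemma abs_powr_majorization:
  fixes X :: real
  assumes "1 < m" "X' + Y' = X + Y" "Y \<le> X'" "X' \<le> X"
  shows "\<bar>X'\<bar> powr m + \<bar>Y'\<bar> powr m \<le> \<bar>X\<bar> powr m + \<bar>Y\<bar> powr m"
proof -
  have main: "\<bar>P\<bar> powr m + \<bar>Q\<bar> powr m \<le> \<bar>X\<bar> powr m + \<bar>Y\<bar> powr m"
    if "P + Q = X + Y" "Q \<le> P" "P \<le> X" for P Q
  proof -
    have "0 \<le> m * ((spow m P - spow m Q) * (X - P))"
      using that spow_mono[OF assms(1), of Q P] assms(1) by simp
    moreover have YQ: "Y - Q = - (X - P)" using that by simp
    have "m * spow m Q * (Y - Q) = - (m * spow m Q * (X - P))" unfolding YQ by (rule mult_minus_right)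
    moreover have "m * ((spow m P - spow m Q) * (X - P)) = m * spow m P * (X - P) - m * spow m Q * (X - P)"
      by (simp add: algebra_simps)
    ultimately show ?thesis
      using abs_powr_tangent[OF assms(1), of P X] abs_powr_tangent[OF assms(1), of Q Y] by linarith
  qed
  show ?thesis
    using main[of X' Y'] main[of Y' X'] assms by (cases "Y' \<le> X'") auto
qed

text \<open>This pointwise inequality makes the energy submodular on the lattice of functions. When the two
  pairs are ordered in opposite ways, taking maxima and minima exchanges the partners and yields
  differences that are less spread out.\<close>

lemma abs_powr_max_min_diff:
  fixes a :: real
  assumes "1 < m"
  shows "\<bar>max a b - max a' b'\<bar> powr m + \<bar>min a b - min a' b'\<bar> powr m
    \<le> \<bar>a - a'\<bar> powr m + \<bar>b - b'\<bar> powr m"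
proof -
  consider "a \<le> b" "a' \<le> b'" | "b \<le> a" "b' \<le> a'" | "b \<le> a" "a' \<le> b'" | "a \<le> b" "b' \<le> a'"
    by linarith
  then show ?thesis
  proof cases
    case 3
    then show ?thesis
      using abs_powr_majorization[OF assms, of "a - b'" "b - a'" "a - a'" "b - b'"]
      by (simp add: max_def min_def)
  next
    case 4
    then show ?thesis
      using abs_powr_majorization[OF assms, of "b - a'" "a - b'" "b - b'" "a - a'"]
      by (simp add: max_def min_def)
  qed (auto simp: max_def min_def)
qed

lemma abs_powr_add_le:
  fixes x y :: real
  assumes "0 \<le> m" shows "\<bar>x + y\<bar> powr m \<le> 2 powr m * (\<bar>x\<bar> powr m + \<bar>y\<bar> powr m)"
proof -
  have "\<bar>x + y\<bar> powr m \<le> (2 * max \<bar>x\<bar> \<bar>y\<bar>) powr m"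
    using assms by (intro powr_mono2) auto
  also have "\<dots> = 2 powr m * max \<bar>x\<bar> \<bar>y\<bar> powr m"
    by (simp add: powr_mult)
  also have "\<dots> \<le> 2 powr m * (\<bar>x\<bar> powr m + \<bar>y\<bar> powr m)"
    by (intro mult_left_mono) (auto simp: max_def)
  finally show ?thesis .
qed

text \<open>Testing an equation with a monotone contraction \<open>t\<close> of the solution controls the energy of the
  contraction itself.\<close>

lemma spow_times_contraction:
  assumes "1 < m" "0 \<le> x * t" "\<bar>t\<bar> \<le> \<bar>x\<bar>"
  shows "\<bar>t\<bar> powr m \<le> spow m x * t"
proof -
  have "\<bar>t\<bar> powr m = \<bar>t\<bar> powr (m - 1) * \<bar>t\<bar>"
    by (simp add: powr_pred_times)
  also have "\<dots> \<le> \<bar>x\<bar> powr (m - 1) * \<bar>t\<bar>"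
    using assms by (intro mult_right_mono powr_mono2) auto
  also have "\<dots> = \<bar>spow m x * t\<bar>" by (simp add: abs_mult abs_spow)
  also have "\<dots> = spow m x * t"
    using assms by (simp add: spow_def mult.assoc)
  finally show ?thesis .
qed

section \<open>Fractional Sobolev functions\<close>

lemma sigma_finite_lebesgue: "sigma_finite_measure (lebesgue :: 'a::euclidean_space measure)"
proof
  show "\<exists>A::'a set set. countable A \<and> A \<subseteq> sets lebesgue \<and> \<Union>A = space lebesgue \<and>
      (\<forall>a\<in>A. emeasure lebesgue a \<noteq> \<infinity>)"
  proof (intro exI conjI ballI)
    show "\<Union>(range (\<lambda>n. ball (0::'a) (real n))) = space lebesgue"
      by (auto simp: reals_Archimedean2)
    show "emeasure lebesgue a \<noteq> \<infinity>" if "a \<in> range (\<lambda>n. ball (0::'a) (real n))" for a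
      using that emeasure_bounded_finite[of "ball (0::'a) _"] by (auto simp: less_top)
  qed auto
qed

lemma measurable_ident_lebesgue [measurable]: "(\<lambda>x. x) \<in> borel_measurable lebesgue"
  by (intro measurable_completion) simp

text \<open>Absorbing the singular kernel into a measure on pairs turns the fractional seminorm of \<open>u\<close> into an
  ordinary \<open>L\<^sup>m\<close> norm of the increments \<open>u x - u y\<close>. On the diagonal, a null set, the density is \<open>0\<close>.\<close>

definition gagliardo :: "real \<Rightarrow> real \<Rightarrow> ('a::euclidean_space \<times> 'a) measure" where
  "gagliardo s m = density (lebesgue \<Otimes>\<^sub>M lebesgue)
     (\<lambda>z. ennreal (1 / norm (fst z - snd z) powr (real DIM('a) + s * m)))"

definition incr :: "('a \<Rightarrow> real) \<Rightarrow> 'a \<times> 'a \<Rightarrow> real" where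
  "incr u z = u (fst z) - u (snd z)"

lemma sets_gagliardo [measurable_cong]: "sets (gagliardo s m) = sets (lebesgue \<Otimes>\<^sub>M lebesgue)"
  by (simp add: gagliardo_def)

lemma measurable_incr [measurable]:
  assumes [measurable]: "u \<in> borel_measurable lebesgue"
  shows "incr u \<in> borel_measurable (lebesgue \<Otimes>\<^sub>M lebesgue)"
  unfolding incr_def by measurable

lemma measurable_kernel [measurable]:
  "(\<lambda>z. norm (fst z - snd z :: 'a) powr r) \<in>
     borel_measurable ((lebesgue :: 'a::euclidean_space measure) \<Otimes>\<^sub>M lebesgue)"
proof -
  have [measurable]: "(\<lambda>z. fst z :: 'a) \<in> borel_measurable (lebesgue \<Otimes>\<^sub>M (lebesgue :: 'a measure))"
    "(\<lambda>z. snd z :: 'a) \<in> borel_measurable ((lebesgue :: 'a measure) \<Otimes>\<^sub>M lebesgue)"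
    using measurable_compose[OF measurable_fst measurable_ident_lebesgue]
      measurable_compose[OF measurable_snd measurable_ident_lebesgue] by auto
  show ?thesis by measurable
qed

lemma measurable_spow [measurable]: "spow m \<in> borel_measurable borel"
  unfolding spow_def by measurable

text \<open>Weak solutions are determined up to null sets only; this transfers a modification of a function on
  a null set to its increments.\<close>

lemma AE_gagliardo:
  assumes "AE x in lebesgue. P x"
  shows "AE z in gagliardo s m. P (fst z)" and "AE z in gagliardo s m. P (snd z)"
proof -
  interpret lebesgue_sf: sigma_finite_measure "lebesgue :: 'a measure"
    by (rule sigma_finite_lebesgue)
  obtain N where N: "\<And>x. x \<in> space lebesgue - N \<Longrightarrow> P x" "N \<in> null_sets lebesgue"
    using assms by (rule AE_E3) blast
  have "N \<in> sets lebesgue" "emeasure lebesgue N = 0"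
    using N(2) by (auto simp: null_sets_def)
  then have "emeasure (lebesgue \<Otimes>\<^sub>M lebesgue) (N \<times> (UNIV :: 'a set)) = 0"
    "emeasure (lebesgue \<Otimes>\<^sub>M lebesgue) ((UNIV :: 'a set) \<times> N) = 0"
    using lebesgue_sf.emeasure_pair_measure_Times[of N lebesgue "UNIV :: 'a set"]
      lebesgue_sf.emeasure_pair_measure_Times[of "UNIV :: 'a set" lebesgue N] by simp_all
  then have "N \<times> (UNIV :: 'a set) \<in> null_sets (lebesgue \<Otimes>\<^sub>M lebesgue)" "(UNIV :: 'a set) \<times> N \<in> null_sets (lebesgue \<Otimes>\<^sub>M lebesgue)"
    using N(2) by (auto simp: null_sets_def)
  note null = this
  have N': "x \<in> N" if "\<not> P x" for x using N(1)[of x] that by auto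
  have "AE z in lebesgue \<Otimes>\<^sub>M (lebesgue :: 'a measure). P (fst z)"
    by (rule AE_I'[OF null(1)]) (use N' in auto)
  moreover have "AE z in (lebesgue :: 'a measure) \<Otimes>\<^sub>M lebesgue. P (snd z)"
    by (rule AE_I'[OF null(2)]) (use N' in auto)
  ultimately show "AE z in gagliardo s m. P (fst z)" "AE z in gagliardo s m. P (snd z)"
    unfolding gagliardo_def by (subst AE_density; auto)+
qed

lemma W0_iff:
  fixes u :: "'a::euclidean_space \<Rightarrow> real"
  shows "u \<in> W0 s m D \<longleftrightarrow>
    u \<in> borel_measurable lebesgue \<and> (\<forall>x. x \<notin> D \<longrightarrow> u x = 0) \<and>
    integrable lebesgue (\<lambda>x. \<bar>u x\<bar> powr m) \<and> integrable (gagliardo s m) (\<lambda>z. \<bar>incr u z\<bar> powr m)"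
proof -
  have "integrable (gagliardo s m) (\<lambda>z. \<bar>incr u z\<bar> powr m) \<longleftrightarrow>
      integrable (lebesgue \<Otimes>\<^sub>M lebesgue)
       (\<lambda>(x, y). \<bar>u x - u y\<bar> powr m / norm (x - y) powr (real DIM('a) + s * m))"
    if "u \<in> borel_measurable lebesgue"
    unfolding gagliardo_def using that
    by (subst integrable_real_density) (auto simp: incr_def split_beta' divide_inverse mult.commute)
  then show ?thesis unfolding W0_def by auto
qed

lemma W0D:
  assumes "u \<in> W0 s m D"
  shows "u \<in> borel_measurable lebesgue" "x \<notin> D \<Longrightarrow> u x = 0"
    "integrable lebesgue (\<lambda>x. \<bar>u x\<bar> powr m)" "integrable (gagliardo s m) (\<lambda>z. \<bar>incr u z\<bar> powr m)"
  using assms unfolding W0_iff by auto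

lemma frac_form_gagliardo:
  fixes u \<phi> :: "'a::euclidean_space \<Rightarrow> real"
  assumes [measurable]: "u \<in> borel_measurable lebesgue" "\<phi> \<in> borel_measurable lebesgue"
  shows "frac_form s m u \<phi> = (\<integral>z. spow m (incr u z) * incr \<phi> z \<partial>gagliardo s m)"
  unfolding gagliardo_def frac_form_def
  by (subst integral_real_density)
     (auto simp: incr_def spow_def split_beta' divide_inverse mult.commute mult.left_commute
       intro!: Bochner_Integration.integral_cong)

lemma frac_form_self:
  "u \<in> borel_measurable lebesgue \<Longrightarrow> frac_form s m u u = (\<integral>z. \<bar>incr u z\<bar> powr m \<partial>gagliardo s m)"
  by (simp add: frac_form_gagliardo spow_times_self)

text \<open>All closure properties of the function space (linear combinations, maxima, truncations) follow from
  this criterion. The three domains may differ, so that a function supported in the smaller domain can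
  be built from functions on larger ones.\<close>

lemma W0_dominated:
  assumes m: "0 \<le> m" and C: "0 \<le> C" and u: "u \<in> W0 s m D1" and v: "v \<in> W0 s m D2"
    and [measurable]: "w \<in> borel_measurable lebesgue" and 0: "\<And>x. x \<notin> D \<Longrightarrow> w x = 0"
    and le: "\<And>x. \<bar>w x\<bar> \<le> C * (\<bar>u x\<bar> + \<bar>v x\<bar>)"
    and incr_le: "\<And>x y. \<bar>w x - w y\<bar> \<le> C * (\<bar>u x - u y\<bar> + \<bar>v x - v y\<bar>)"
  shows "w \<in> W0 s m D"
proof -
  note [measurable] = W0D(1)[OF u] W0D(1)[OF v]
  have *: "\<bar>a\<bar> powr m \<le> (C * 2) powr m * (\<bar>b\<bar> powr m + \<bar>c\<bar> powr m)"
    if "\<bar>a\<bar> \<le> C * (\<bar>b\<bar> + \<bar>c\<bar>)" for a b c :: real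
  proof -
    have "\<bar>a\<bar> powr m \<le> (C * (\<bar>b\<bar> + \<bar>c\<bar>)) powr m" using that m by (intro powr_mono2) auto
    also have "\<dots> = C powr m * \<bar>\<bar>b\<bar> + \<bar>c\<bar>\<bar> powr m" using C by (simp add: powr_mult)
    also have "\<dots> \<le> C powr m * (2 powr m * (\<bar>b\<bar> powr m + \<bar>c\<bar> powr m))"
      using abs_powr_add_le[OF m, of "\<bar>b\<bar>" "\<bar>c\<bar>"] by (intro mult_left_mono) auto
    finally show ?thesis using C by (simp add: powr_mult mult.assoc)
  qed
  have "integrable lebesgue (\<lambda>x. \<bar>w x\<bar> powr m)"
  proof (rule Bochner_Integration.integrable_bound)
    show "integrable lebesgue (\<lambda>x. (C * 2) powr m * (\<bar>u x\<bar> powr m + \<bar>v x\<bar> powr m))"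
      using W0D(3)[OF u] W0D(3)[OF v] by simp
    show "AE x in lebesgue. norm (\<bar>w x\<bar> powr m) \<le> norm ((C * 2) powr m * (\<bar>u x\<bar> powr m + \<bar>v x\<bar> powr m))"
      using *[OF le] by (intro AE_I2) (simp add: abs_mult)
  qed measurable
  moreover have "integrable (gagliardo s m) (\<lambda>z. \<bar>incr w z\<bar> powr m)"
  proof (rule Bochner_Integration.integrable_bound)
    show "integrable (gagliardo s m) (\<lambda>z. (C * 2) powr m * (\<bar>incr u z\<bar> powr m + \<bar>incr v z\<bar> powr m))"
      using W0D(4)[OF u] W0D(4)[OF v] by simp
    show "AE z in gagliardo s m. norm (\<bar>incr w z\<bar> powr m)
        \<le> norm ((C * 2) powr m * (\<bar>incr u z\<bar> powr m + \<bar>incr v z\<bar> powr m))"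
      using *[OF incr_le] by (intro AE_I2) (simp add: abs_mult incr_def)
  qed measurable
  ultimately show ?thesis unfolding W0_iff using 0 by simp
qed

lemma W0_contraction:
  assumes "0 \<le> m" "u \<in> W0 s m D" "w \<in> borel_measurable lebesgue"
    "\<And>x. \<bar>w x\<bar> \<le> \<bar>u x\<bar>" "\<And>x y. \<bar>w x - w y\<bar> \<le> \<bar>u x - u y\<bar>"
  shows "w \<in> W0 s m D"
proof (rule W0_dominated[where C = 1, OF _ _ assms(2) assms(2)])
  show "w x = 0" if "x \<notin> D" for x using assms(4)[of x] W0D(2)[OF assms(2) that] by simp
  show "\<bar>w x\<bar> \<le> 1 * (\<bar>u x\<bar> + \<bar>u x\<bar>)" for x using assms(4)[of x] by simp
  show "\<bar>w x - w y\<bar> \<le> 1 * (\<bar>u x - u y\<bar> + \<bar>u x - u y\<bar>)" for x y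
    by (rule order_trans[OF assms(5)]) simp
qed (use assms in auto)

lemma W0_lincomb:
  assumes "0 \<le> m" "u \<in> W0 s m D" "v \<in> W0 s m D"
  shows "(\<lambda>x. a * u x + b * v x) \<in> W0 s m D"
proof (rule W0_dominated[where C = "\<bar>a\<bar> + \<bar>b\<bar>", OF _ _ assms(2,3)])
  note [measurable] = W0D(1)[OF assms(2)] W0D(1)[OF assms(3)]
  show "(\<lambda>x. a * u x + b * v x) \<in> borel_measurable lebesgue" by measurable
  have *: "\<bar>a * x + b * y\<bar> \<le> (\<bar>a\<bar> + \<bar>b\<bar>) * (\<bar>x\<bar> + \<bar>y\<bar>)" for x y
  proof -
    have "\<bar>a * x + b * y\<bar> \<le> \<bar>a\<bar> * \<bar>x\<bar> + \<bar>b\<bar> * \<bar>y\<bar>"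
      using abs_triangle_ineq[of "a * x" "b * y"] by (simp add: abs_mult)
    also have "\<dots> \<le> (\<bar>a\<bar> + \<bar>b\<bar>) * (\<bar>x\<bar> + \<bar>y\<bar>)" by (simp add: algebra_simps)
    finally show ?thesis .
  qed
  show "\<bar>a * u x + b * v x\<bar> \<le> (\<bar>a\<bar> + \<bar>b\<bar>) * (\<bar>u x\<bar> + \<bar>v x\<bar>)" for x by (rule *)
  show "\<bar>a * u x + b * v x - (a * u y + b * v y)\<bar> \<le> (\<bar>a\<bar> + \<bar>b\<bar>) * (\<bar>u x - u y\<bar> + \<bar>v x - v y\<bar>)" for x y
    using *[of "u x - u y" "v x - v y"] by (simp add: algebra_simps)
qed (use assms W0D(2)[OF assms(2)] W0D(2)[OF assms(3)] in auto)

lemma W0_max_min: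
  assumes "0 \<le> m" "u \<in> W0 s m D" "v \<in> W0 s m D"
  shows "(\<lambda>x. max (u x) (v x)) \<in> W0 s m D" "(\<lambda>x. min (u x) (v x)) \<in> W0 s m D"
proof -
  note [measurable] = W0D(1)[OF assms(2)] W0D(1)[OF assms(3)]
  show "(\<lambda>x. max (u x) (v x)) \<in> W0 s m D" 
    by (rule W0_dominated[where C = 1, OF _ _ assms(2,3)])
       (use assms W0D(2)[OF assms(2)] W0D(2)[OF assms(3)] in auto)
  show "(\<lambda>x. min (u x) (v x)) \<in> W0 s m D" 
    by (rule W0_dominated[where C = 1, OF _ _ assms(2,3)])
       (use assms W0D(2)[OF assms(2)] W0D(2)[OF assms(3)] in auto)
qed

lemma integrable_spow_incr:
  assumes "1 < m" "u \<in> W0 s m D1" "v \<in> W0 s m D2"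
  shows "integrable (gagliardo s m) (\<lambda>z. spow m (incr u z) * incr v z)"
proof (rule Bochner_Integration.integrable_bound)
  note [measurable] = W0D(1)[OF assms(2)] W0D(1)[OF assms(3)]
  show "(\<lambda>z. spow m (incr u z) * incr v z) \<in> borel_measurable (gagliardo s m)" by measurable
  show "integrable (gagliardo s m) (\<lambda>z. \<bar>incr u z\<bar> powr m + \<bar>incr v z\<bar> powr m)"
    using W0D(4)[OF assms(2)] W0D(4)[OF assms(3)] by simp
  show "AE z in gagliardo s m. norm (spow m (incr u z) * incr v z)
      \<le> norm (\<bar>incr u z\<bar> powr m + \<bar>incr v z\<bar> powr m)"
    using spow_times_le[OF assms(1)] by (intro AE_I2) (simp add: abs_mult)
qed

lemma W0_AE_cong:
  assumes "u \<in> W0 s m D" "AE x in lebesgue. u x = w x" "w \<in> borel_measurable lebesgue"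
    "\<And>x. x \<notin> D \<Longrightarrow> w x = 0"
  shows "w \<in> W0 s m D"
proof -
  note [measurable] = W0D(1)[OF assms(1)] assms(3)
  have "integrable lebesgue (\<lambda>x. \<bar>w x\<bar> powr m)"
    by (rule integrable_cong_AE_imp[OF W0D(3)[OF assms(1)]]) (use assms(2) in auto)
  moreover have "AE z in gagliardo s m. \<bar>incr u z\<bar> powr m = \<bar>incr w z\<bar> powr m"
    using AE_gagliardo[OF assms(2)] by eventually_elim (simp add: incr_def)
  then have "integrable (gagliardo s m) (\<lambda>z. \<bar>incr w z\<bar> powr m)"
    by (intro integrable_cong_AE_imp[OF W0D(4)[OF assms(1)]]) auto
  ultimately show ?thesis unfolding W0_iff using assms by simp
qed

lemma frac_form_AE_cong:
  assumes "u \<in> borel_measurable lebesgue" "u' \<in> borel_measurable lebesgue"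
    "v \<in> borel_measurable lebesgue" "v' \<in> borel_measurable lebesgue"
    "AE x in lebesgue. u x = u' x" "AE x in lebesgue. v x = v' x"
  shows "frac_form s m u v = frac_form s m u' v'"
proof -
  note [measurable] = assms(1-4)
  have "AE z in gagliardo s m. spow m (incr u z) * incr v z = spow m (incr u' z) * incr v' z"
    using AE_gagliardo[OF assms(5)] AE_gagliardo[OF assms(6)] by eventually_elim (simp add: incr_def)
  then show ?thesis
    unfolding frac_form_gagliardo[OF assms(1,3)] frac_form_gagliardo[OF assms(2,4)]
    by (intro integral_cong_AE) auto
qed

lemma AE_lebesgue_on_iff':
  assumes "D \<in> sets lebesgue"
  shows "(AE x in lebesgue_on D. P x) \<longleftrightarrow> (AE x in lebesgue. x \<in> D \<longrightarrow> P x)"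
  using assms by (subst AE_restrict_space_iff) auto

text \<open>The eigenfunctions and the torsion function are positive almost everywhere only. This allows them to
  be replaced by representatives that are nonnegative everywhere.\<close>

lemma weak_solution_AE_cong:
  assumes ws: "weak_solution s m D f u" and D: "D \<in> sets lebesgue"
    and u': "AE x in lebesgue. u x = u' x" "u' \<in> borel_measurable lebesgue" "\<And>x. x \<notin> D \<Longrightarrow> u' x = 0"
    and f': "AE x in lebesgue_on D. f x = f' x" "f' \<in> borel_measurable (lebesgue_on D)"
  shows "weak_solution s m D f' u'"
  unfolding weak_solution_def
proof (intro conjI ballI)
  have u: "u \<in> W0 s m D" using ws by (simp add: weak_solution_def)
  show "u' \<in> W0 s m D" using W0_AE_cong[OF u u'] .
  fix \<phi> assume \<phi>: "\<phi> \<in> W0 s m D"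
  have [measurable]: "\<phi> \<in> borel_measurable (lebesgue_on D)"
    using W0D(1)[OF \<phi>] by (rule measurable_restrict_space1)
  note [measurable] = f'(2)
  have *: "integrable (lebesgue_on D) (\<lambda>x. f x * \<phi> x)"
    "frac_form s m u \<phi> = (\<integral>x. f x * \<phi> x \<partial>(lebesgue_on D))"
    using ws \<phi> by (auto simp: weak_solution_def)
  have AE: "AE x in lebesgue_on D. f x * \<phi> x = f' x * \<phi> x"
    using f'(1) by eventually_elim simp
  show "integrable (lebesgue_on D) (\<lambda>x. f' x * \<phi> x)"
    by (rule integrable_cong_AE_imp[OF *(1)]) (use AE in auto)
  have "frac_form s m u' \<phi> = frac_form s m u \<phi>"
    by (rule frac_form_AE_cong[symmetric]) (use u' W0D(1)[OF u] W0D(1)[OF \<phi>] in auto)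
  also have "\<dots> = (\<integral>x. f' x * \<phi> x \<partial>(lebesgue_on D))"
    unfolding *(2) using AE borel_measurable_integrable[OF *(1)] by (intro integral_cong_AE) auto
  finally show "frac_form s m u' \<phi> = (\<integral>x. f' x * \<phi> x \<partial>(lebesgue_on D))" .
qed

section \<open>The Faber-Krahn inequality and comparison\<close>

definition faber_krahn_const :: "'a::euclidean_space itself \<Rightarrow> real \<Rightarrow> real \<Rightarrow> real" where
  "faber_krahn_const _ s m =
     (2 / unit_ball_vol (DIM('a))) powr (- (real DIM('a) + s * m) / DIM('a))"

lemma faber_krahn_const_pos: "0 < faber_krahn_const TYPE('a::euclidean_space) s m"
proof -
  have "0 < unit_ball_vol (real DIM('a))" by simp
  then show ?thesis unfolding faber_krahn_const_def by (simp del: unit_ball_vol_pos)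
qed

text \<open>A function with small support \<open>S\<close> has large energy compared with its \<open>L\<^sup>m\<close> norm. Around every point
  \<open>x\<close> the ball of volume \<open>2 \<bar>S\<bar>\<close> contains a set of volume at least \<open>\<bar>S\<bar>\<close> on which the function vanishes,
  so the increments from \<open>x\<close> to these points alone contribute a multiple of
  \<open>\<bar>S\<bar>\<^bsup>- s m / N\<^esup> \<bar>u x\<bar>\<^sup>m\<close>. This inequality is the only source of higher
  integrability below.\<close>

lemma faber_krahn:
  fixes u :: "'a::euclidean_space \<Rightarrow> real"
  assumes s: "0 < s" "0 < m"
    and u: "u \<in> W0 s m D" and S: "S \<in> lmeasurable" and pos: "0 < measure lebesgue S"
    and 0: "\<And>x. x \<notin> S \<Longrightarrow> u x = 0"
  shows "faber_krahn_const TYPE('a) s m * (\<integral>x. \<bar>u x\<bar> powr m \<partial>lebesgue)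
    \<le> measure lebesgue S powr (s * m / DIM('a)) * frac_form s m u u"
proof -
  define N where "N = real DIM('a)"
  define \<omega> where "\<omega> = unit_ball_vol N"
  have N: "0 < N" and \<omega>: "0 < \<omega>" by (auto simp: N_def \<omega>_def)
  define c where "c = faber_krahn_const TYPE('a) s m"
  have c_eq: "c = (2 / \<omega>) powr (- (N + s * m) / N)" by (simp add: c_def faber_krahn_const_def N_def \<omega>_def)
  have "0 < c" using \<omega> by (simp add: c_eq)
  interpret sf: sigma_finite_measure "lebesgue :: 'a measure" by (rule sigma_finite_lebesgue)
  note [measurable] = W0D(1)[OF u]
  have [measurable]: "S \<in> sets lebesgue" using S by auto
  define V where "V = measure lebesgue S"
  \<comment> \<open>The ball of this radius has twice the volume of \<open>S\<close>.\<close>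
  define R where "R = (2 * V / \<omega>) powr (1 / N)"
  have R: "0 < R" using pos \<omega> by (simp add: R_def V_def)
  have RN: "\<omega> * R powr N = 2 * V"
    using pos \<omega> N by (simp add: R_def V_def powr_powr)
  let ?k = "\<lambda>z :: 'a \<times> 'a. norm (fst z - snd z) powr (N + s * m)"
  have inner: "ennreal (c * V powr (- (s * m / N))) * ennreal (\<bar>u x\<bar> powr m)
      \<le> (\<integral>\<^sup>+ y. ennreal (1 / ?k (x, y)) * ennreal (\<bar>incr u (x, y)\<bar> powr m) \<partial>lebesgue)" for x
  proof -
    have "ennreal (c * V powr (- (s * m / N))) = ennreal (R powr (- (N + s * m)) * V)"
    proof -
      have "R powr (- (N + s * m)) = (2 / \<omega> * V) powr (- (N + s * m) / N)"
        by (simp add: R_def powr_powr field_simps)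
      also have "\<dots> = c * V powr (- (N + s * m) / N)"
        using pos \<omega> by (subst powr_mult) (auto simp: c_eq V_def)
      also have "V powr (- (N + s * m) / N) = V powr (- (s * m / N)) * V powr (- 1)"
        using N unfolding powr_add[symmetric] by (simp add: field_simps)
      finally have "R powr (- (N + s * m)) * V = c * V powr (- (s * m / N)) * (V powr (- 1) * V)"
        by simp
      also have "V powr (- 1) * V = 1" using pos by (simp add: powr_minus V_def)
      finally show ?thesis by simp
    qed
    also have "\<dots> \<le> ennreal (R powr (- (N + s * m))) * emeasure lebesgue (ball x R - S)"
    proof -
      have "ennreal V \<le> emeasure lebesgue (ball x R - S)"
      proof -
        have fin: "emeasure lebesgue S = ennreal V"
          unfolding V_def using fmeasurableD2[OF S] by (rule emeasure_eq_ennreal_measure)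
        have "ennreal V + ennreal V = ennreal (2 * V)"
          by (subst ennreal_plus[symmetric]) (auto simp: V_def)
        also have "\<dots> = emeasure lebesgue (ball x R)"
          using R RN by (simp add: emeasure_ball \<omega>_def N_def powr_realpow)
        also have "\<dots> \<le> emeasure lebesgue ((ball x R - S) \<union> S)"
          by (intro emeasure_mono) auto
        also have "\<dots> \<le> emeasure lebesgue S + emeasure lebesgue (ball x R - S)"
          by (subst add.commute, intro emeasure_subadditive) auto
        finally have "ennreal V + ennreal V \<le> ennreal V + emeasure lebesgue (ball x R - S)"
          unfolding fin .
        then show ?thesis
          by (simp only: ennreal_add_left_cancel_le infinity_ennreal_def ennreal_neq_top simp_thms)
      qed
      then show ?thesis by (simp add: ennreal_mult mult_left_mono V_def)
    qed
    finally have "ennreal (c * V powr (- (s * m / N))) * ennreal (\<bar>u x\<bar> powr m)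
        \<le> ennreal (R powr (- (N + s * m))) * emeasure lebesgue (ball x R - S) * ennreal (\<bar>u x\<bar> powr m)"
      by (rule mult_right_mono) simp
    also have "\<dots> = (\<integral>\<^sup>+ y. ennreal (R powr (- (N + s * m)) * \<bar>u x\<bar> powr m) * indicator (ball x R - S) y \<partial>lebesgue)"
      by (subst nn_integral_cmult_indicator) (auto simp: ennreal_mult mult_ac)
    also have "\<dots> \<le> (\<integral>\<^sup>+ y. ennreal (1 / ?k (x, y)) * ennreal (\<bar>incr u (x, y)\<bar> powr m) \<partial>lebesgue)"
    proof (rule nn_integral_mono)
      fix y
      show "ennreal (R powr (- (N + s * m)) * \<bar>u x\<bar> powr m) * indicator (ball x R - S) y
          \<le> ennreal (1 / ?k (x, y)) * ennreal (\<bar>incr u (x, y)\<bar> powr m)"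
      proof (cases "y \<in> ball x R - S \<and> u x \<noteq> 0")
        case True
        then have y: "u y = 0" "y \<noteq> x" "norm (x - y) \<le> R" using 0 by (auto simp: dist_norm)
        have "norm (x - y) powr (N + s * m) \<le> R powr (N + s * m)"
          using y s N by (intro powr_mono2) auto
        then have "R powr (- (N + s * m)) \<le> 1 / norm (x - y) powr (N + s * m)"
          using y R unfolding powr_minus by (auto simp: field_simps)
        then have "R powr (- (N + s * m)) * \<bar>u x\<bar> powr m \<le> 1 / norm (x - y) powr (N + s * m) * \<bar>u x\<bar> powr m"
          by (rule mult_right_mono) simp
        then show ?thesis
          using True y by (simp add: incr_def ennreal_mult[symmetric] ennreal_leI)
      qed (auto simp: indicator_def)
    qed
    finally show ?thesis .
  qed
  have "ennreal (c * V powr (- (s * m / N)) * (\<integral>x. \<bar>u x\<bar> powr m \<partial>lebesgue))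
      = (\<integral>\<^sup>+ x. ennreal (c * V powr (- (s * m / N))) * ennreal (\<bar>u x\<bar> powr m) \<partial>lebesgue)"
    using W0D(3)[OF u] \<open>0 < c\<close>
    by (subst nn_integral_cmult) (auto simp: nn_integral_eq_integral ennreal_mult)
  also have "\<dots> \<le> (\<integral>\<^sup>+ x. \<integral>\<^sup>+ y. ennreal (1 / ?k (x, y)) * ennreal (\<bar>incr u (x, y)\<bar> powr m) \<partial>lebesgue \<partial>lebesgue)"
    by (intro nn_integral_mono inner)
  also have "\<dots> = (\<integral>\<^sup>+ z. ennreal (1 / ?k z) * ennreal (\<bar>incr u z\<bar> powr m) \<partial>(lebesgue \<Otimes>\<^sub>M lebesgue))"
    by (subst sf.nn_integral_fst[symmetric]) auto
  also have "\<dots> = (\<integral>\<^sup>+ z. ennreal (\<bar>incr u z\<bar> powr m) \<partial>gagliardo s m)"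
    unfolding gagliardo_def N_def by (subst nn_integral_density) auto
  also have "\<dots> = ennreal (frac_form s m u u)"
    using W0D(4)[OF u] by (simp add: frac_form_self nn_integral_eq_integral)
  finally have "c * V powr (- (s * m / N)) * (\<integral>x. \<bar>u x\<bar> powr m \<partial>lebesgue) \<le> frac_form s m u u"
    by (subst (asm) ennreal_le_iff) (auto simp: frac_form_self)
  then show ?thesis
    using pos by (simp add: powr_minus V_def N_def c_def field_simps)
qed

text \<open>The core of the comparison principle. Since \<open>spow\<close> is strictly increasing, the integrand of the
  difference of the two forms is nonnegative and vanishes only where \<open>v\<close> has no increment. Hence \<open>v\<close> has
  no energy, and by the Faber-Krahn inequality it is zero.\<close>

lemma AE_le_of_frac_form_le:
  assumes "1 < m" "u \<in> W0 s m D1" "w \<in> W0 s m D2"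
    and v: "v = (\<lambda>x. max 0 (u x - w x))" "v \<in> W0 s m D" "bounded D"
    and s: "0 < s"
    and le: "frac_form s m u v \<le> frac_form s m w v"
  shows "AE x in lebesgue. u x \<le> w x"
proof -
  note [measurable] = W0D(1)[OF assms(2)] W0D(1)[OF assms(3)] W0D(1)[OF v(2)]
  let ?g = "\<lambda>z. (spow m (incr u z) - spow m (incr w z)) * incr v z"
  have int: "integrable (gagliardo s m) (\<lambda>z. spow m (incr u z) * incr v z)"
    "integrable (gagliardo s m) (\<lambda>z. spow m (incr w z) * incr v z)"
    using assms integrable_spow_incr by blast+
  have pointwise: "0 \<le> ?g z" "?g z = 0 \<Longrightarrow> incr v z = 0" for z
  proof -
    have "incr v z > 0 \<Longrightarrow> incr w z < incr u z" "incr v z < 0 \<Longrightarrow> incr u z < incr w z"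
      by (auto simp: v(1) incr_def)
    then have "incr v z > 0 \<Longrightarrow> spow m (incr w z) < spow m (incr u z)"
       "incr v z < 0 \<Longrightarrow> spow m (incr u z) < spow m (incr w z)"
      using spow_strict_mono[OF assms(1)] by auto
    then show "0 \<le> ?g z" "?g z = 0 \<Longrightarrow> incr v z = 0"
      by (cases "incr v z" "0 :: real" rule: linorder_cases; force simp: zero_le_mult_iff)+
  qed
  have "(\<integral>z. ?g z \<partial>gagliardo s m) = frac_form s m u v - frac_form s m w v"
    using int by (simp add: frac_form_gagliardo left_diff_distrib)
  then have "(\<integral>z. ?g z \<partial>gagliardo s m) = 0"
    using le pointwise(1) by (intro antisym Bochner_Integration.integral_nonneg) auto
  moreover have "integrable (gagliardo s m) ?g"
    using int by (simp add: left_diff_distrib)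
  ultimately have "AE z in gagliardo s m. ?g z = 0"
    using integral_nonneg_eq_0_iff_AE[of "gagliardo s m" ?g] pointwise(1) by auto
  then have "AE z in gagliardo s m. \<bar>incr v z\<bar> powr m = 0"
    by eventually_elim (use pointwise(2) in auto)
  then have 0: "frac_form s m v v = 0"
    by (simp add: frac_form_self integral_eq_zero_AE)
  have "(\<integral>x. \<bar>v x\<bar> powr m \<partial>lebesgue) \<le> 0"
  proof -
    note c = faber_krahn_const_pos[where ?'a = 'a, of s m]
    obtain r where r: "0 < r" "D \<subseteq> ball 0 r"
      using bounded_subset_ballD[OF assms(6), of 0] by auto
    have v0: "v x = 0" if "x \<notin> ball 0 r" for x
      using that r(2) W0D(2)[OF v(2)] by blast
    have "0 < measure lebesgue (ball (0::'a) r)"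
      using r(1) content_ball_pos by simp
    then have "faber_krahn_const TYPE('a) s m * (\<integral>x. \<bar>v x\<bar> powr m \<partial>lebesgue) \<le> 0"
      using faber_krahn[OF s _ v(2), of "ball 0 r"] assms(1) 0 v0 by simp
    then show ?thesis using c by (simp add: mult_le_0_iff)
  qed
  then have "(\<integral>x. \<bar>v x\<bar> powr m \<partial>lebesgue) = 0"
    by (simp add: antisym)
  then have "AE x in lebesgue. \<bar>v x\<bar> powr m = 0"
    using integral_nonneg_eq_0_iff_AE[OF W0D(3)[OF v(2)]] by simp
  then show ?thesis
    by eventually_elim (auto simp: v(1) max_def split: if_splits)
qed

section \<open>Level sets and boundedness\<close>

lemma lmeasurable_superlevel:
  fixes u :: "'a::euclidean_space \<Rightarrow> real"
  assumes "u \<in> borel_measurable lebesgue" "\<And>x. x \<notin> D \<Longrightarrow> u x = 0" "bounded D" "0 \<le> k"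
  shows "{x. k < u x} \<in> lmeasurable"
proof (rule bounded_set_imp_lmeasurable)
  show "bounded {x. k < u x}"
    using assms(2,4) by (intro bounded_subset[OF assms(3)]) force
  show "{x. k < u x} \<in> sets lebesgue"
    using assms(1) borel_measurable_iff_greater[of u lebesgue] by simp
qed

lemma ennreal_integral_le_nn_integral:
  fixes f :: "'a \<Rightarrow> real"
  assumes "integrable M f" shows "ennreal (\<integral>x. f x \<partial>M) \<le> (\<integral>\<^sup>+x. ennreal (f x) \<partial>M)"
proof -
  have "(\<integral>x. f x \<partial>M) \<le> enn2real (\<integral>\<^sup>+x. ennreal (f x) \<partial>M)"
    using assms by (simp add: real_lebesgue_integral_def)
  then have "ennreal (\<integral>x. f x \<partial>M) \<le> ennreal (enn2real (\<integral>\<^sup>+x. ennreal (f x) \<partial>M))"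
    by (rule ennreal_leI)
  also have "\<dots> \<le> (\<integral>\<^sup>+x. ennreal (f x) \<partial>M)" by (simp add: ennreal_enn2real_if)
  finally show ?thesis .
qed

text \<open>Test the equation with \<open>min h (max 0 (u - k))\<close>. It is supported in \<open>{u > k}\<close> and has the value
  \<open>h\<close> on \<open>{u > k + h}\<close>, so the Faber-Krahn inequality bounds its energy below; the right-hand side
  contributes at most \<open>h\<close> times its integral over \<open>{u > k}\<close>. All regularity below is derived from this estimate.\<close>

lemma superlevel_estimate:
  fixes u :: "'a::euclidean_space \<Rightarrow> real"
  assumes s: "0 < s" and m: "1 < m"
    and ws: "weak_solution s m D F u" and D: "bounded D" "D \<in> sets lebesgue"
    and Fg: "AE x in lebesgue_on D. F x \<le> g x" and [measurable]: "g \<in> borel_measurable lebesgue"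
    and g: "\<And>x. 0 \<le> g x" and k: "0 \<le> k" and h: "0 < h" and r: "0 \<le> r"
    and r_le: "(\<integral>\<^sup>+x. ennreal (g x) * indicator {x. k < u x} x \<partial>lebesgue) \<le> ennreal r"
  shows "faber_krahn_const TYPE('a) s m * h powr (m - 1) * measure lebesgue {x. k + h < u x}
    \<le> measure lebesgue {x. k < u x} powr (s * m / DIM('a)) * r"
proof -
  define c where "c = faber_krahn_const TYPE('a) s m"
  have c: "0 < c" unfolding c_def by (rule faber_krahn_const_pos)
  have u: "u \<in> W0 s m D" using ws by (simp add: weak_solution_def)
  note [measurable] = W0D(1)[OF u]
  define A where "A k = {x. k < u x}" for k
  have A: "A k' \<in> lmeasurable" if "0 \<le> k'" for k'
    unfolding A_def using W0D(1,2)[OF u] D(1) that by (rule lmeasurable_superlevel)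
  have [measurable]: "A k \<in> sets lebesgue" "A (k + h) \<in> sets lebesgue" using A k h by auto
  have mono: "measure lebesgue (A (k + h)) \<le> measure lebesgue (A k)"
    using h A k by (intro measure_mono_fmeasurable) (auto simp: A_def)
  define \<eta> where "\<eta> x = min h (max 0 (u x - k))" for x
  have \<eta>: "\<eta> \<in> W0 s m D"
  proof (rule W0_contraction[OF _ u])
    show "\<eta> \<in> borel_measurable lebesgue" unfolding \<eta>_def by measurable
  qed (use m h k in \<open>auto simp: \<eta>_def\<close>)
  have "c * h powr (m - 1) * measure lebesgue (A (k + h)) \<le> measure lebesgue (A k) powr (s * m / DIM('a)) * r"
  proof (cases "measure lebesgue (A k) = 0")
    case True
    then have "measure lebesgue (A (k + h)) = 0" using mono measure_nonneg by (intro antisym) auto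
    with True show ?thesis by simp
  next
    case False
    then have pos: "0 < measure lebesgue (A k)" by (simp add: zero_less_measure_iff)
    have "h powr m * measure lebesgue (A (k + h)) = (\<integral>x. h powr m * indicator (A (k + h)) x \<partial>lebesgue)"
      using A[of "k + h"] h k by simp
    also have "\<dots> \<le> (\<integral>x. \<bar>\<eta> x\<bar> powr m \<partial>lebesgue)"
    proof (rule integral_mono)
      show "integrable lebesgue (\<lambda>x. h powr m * indicator (A (k + h)) x)"
        using A[of "k + h"] h k by (auto simp: fmeasurable_def)
    next
      show "h powr m * indicator (A (k + h)) x \<le> \<bar>\<eta> x\<bar> powr m" for x
        using h by (auto simp: A_def \<eta>_def indicator_def)
    qed (rule W0D(3)[OF \<eta>])
    finally have "c * (h powr m * measure lebesgue (A (k + h))) \<le> c * (\<integral>x. \<bar>\<eta> x\<bar> powr m \<partial>lebesgue)"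
      using c by simp
    also have "\<dots> \<le> measure lebesgue (A k) powr (s * m / DIM('a)) * frac_form s m \<eta> \<eta>"
      unfolding c_def using m by (intro faber_krahn[OF s _ \<eta> A[OF k] pos]) (use h in \<open>auto simp: A_def \<eta>_def\<close>)
    also have "frac_form s m \<eta> \<eta> \<le> h * r"
    proof -
      have "frac_form s m \<eta> \<eta> \<le> frac_form s m u \<eta>"
        unfolding frac_form_self[OF W0D(1)[OF \<eta>]] frac_form_gagliardo[OF W0D(1)[OF u] W0D(1)[OF \<eta>]]
      proof (rule integral_mono)
        fix z
        show "\<bar>incr \<eta> z\<bar> powr m \<le> spow m (incr u z) * incr \<eta> z"
        proof (rule spow_times_contraction[OF m])
          show "0 \<le> incr u z * incr \<eta> z" "\<bar>incr \<eta> z\<bar> \<le> \<bar>incr u z\<bar>"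
            using h by (auto simp: incr_def \<eta>_def min_def max_def zero_le_mult_iff)
        qed
      qed (use integrable_spow_incr[OF m u \<eta>] W0D(4)[OF \<eta>] in auto)
      also have "\<dots> = (\<integral>x. F x * \<eta> x \<partial>lebesgue_on D)"
        using ws \<eta> by (simp add: weak_solution_def)
      also have "\<dots> \<le> h * r"
      proof -
        have int: "integrable (lebesgue_on D) (\<lambda>x. F x * \<eta> x)"
          using ws \<eta> by (simp add: weak_solution_def)
        have "ennreal (\<integral>x. F x * \<eta> x \<partial>lebesgue_on D) \<le> (\<integral>\<^sup>+x. ennreal (F x * \<eta> x) \<partial>lebesgue_on D)"
          using int by (rule ennreal_integral_le_nn_integral)
        also have "\<dots> \<le> (\<integral>\<^sup>+x. ennreal h * (ennreal (g x) * indicator (A k) x) \<partial>lebesgue_on D)"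
        proof (rule nn_integral_mono_AE)
          show "AE x in lebesgue_on D. ennreal (F x * \<eta> x) \<le> ennreal h * (ennreal (g x) * indicator (A k) x)"
            using Fg
          proof eventually_elim
            fix x assume "F x \<le> g x"
            then have "F x * \<eta> x \<le> g x * \<eta> x"
              using h by (intro mult_right_mono) (auto simp: \<eta>_def)
            also have "\<dots> \<le> g x * (h * indicator (A k) x)"
              using g[of x] h by (intro mult_left_mono) (auto simp: \<eta>_def A_def indicator_def)
            finally have "F x * \<eta> x \<le> g x * (h * indicator (A k) x)" .
            then show "ennreal (F x * \<eta> x) \<le> ennreal h * (ennreal (g x) * indicator (A k) x)"
              using h by (auto simp: indicator_def ennreal_mult[symmetric] g mult.commute ennreal_leI ennreal_neg split: if_splits)
          qed
        qed
        also have "\<dots> \<le> (\<integral>\<^sup>+x. ennreal h * (ennreal (g x) * indicator (A k) x) \<partial>lebesgue)"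
          using D(2) by (subst nn_integral_restrict_space) (auto intro!: nn_integral_mono simp: indicator_def)
        also have "\<dots> \<le> ennreal h * ennreal r"
          using r_le by (subst nn_integral_cmult) (auto simp: A_def intro: mult_left_mono)
        finally show ?thesis
          using h r by (simp add: ennreal_mult[symmetric] ennreal_le_iff)
      qed
      finally show ?thesis .
    qed
    finally have "c * (h powr m * measure lebesgue (A (k + h))) \<le> measure lebesgue (A k) powr (s * m / DIM('a)) * (h * r)"
      by (simp add: mult_left_mono)
    also have "h powr m = h powr (m - 1) * h" using h powr_pred_times[of h m] by simp
    finally show ?thesis using h by (simp add: field_simps)
  qed
  then show ?thesis by (simp add: A_def c_def)
qed

text \<open>De Giorgi's lemma. Along levels \<open>k0 + d (1 - 2\<^bsup>-j\<^esup>)\<close> the superlinear recursion forces geometric decay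
  of \<open>\<mu>\<close>, provided that the distance \<open>d\<close> is large enough to absorb the constants, so \<open>\<mu>\<close> vanishes at the
  limit \<open>k0 + d\<close>.\<close>

lemma de_giorgi:
  fixes \<mu> :: "real \<Rightarrow> real"
  assumes nonneg: "\<And>k. 0 \<le> \<mu> k" and anti: "\<And>k l. k \<le> l \<Longrightarrow> \<mu> l \<le> \<mu> k"
    and pos: "0 < C" "0 < e" "0 < \<sigma>"
    and rec: "\<And>k h. k0 \<le> k \<Longrightarrow> 0 < h \<Longrightarrow> h powr e * \<mu> (k + h) \<le> C * \<mu> k powr (1 + \<sigma>)"
  shows "\<exists>K. \<mu> K = 0"
proof (cases "\<mu> k0 = 0")
  case False
  then have M: "0 < \<mu> k0" using nonneg[of k0] by simp
  \<comment> \<open>With this rate the surplus \<open>2\<^bsup>- j a \<sigma>\<^esup>\<close> cancels the loss \<open>2\<^bsup>j e\<^esup>\<close> from the shrinking steps.\<close>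
  define a where "a = e / \<sigma>"
  define d where "d = (C * 2 powr (e + a) * \<mu> k0 powr \<sigma>) powr (1 / e)"
  have d: "0 < d" "d powr e = C * 2 powr (e + a) * \<mu> k0 powr \<sigma>"
    using pos M by (auto simp: d_def powr_powr)
  have a: "0 < a" "a * \<sigma> = e" using pos by (auto simp: a_def)
  have step: "\<mu> (k0 + d * (1 - 2 powr (- real j))) \<le> \<mu> k0 * 2 powr (- real j * a)" for j
  proof (induction j)
    case (Suc j)
    let ?k = "k0 + d * (1 - 2 powr (- real j))" and ?h = "d * 2 powr (- real (Suc j))"
    have "2 powr (- real j) = 2 * 2 powr (- real (Suc j))"
      by (simp add: powr_minus powr_realpow del: of_nat_Suc)
    then have kh: "?k + ?h = k0 + d * (1 - 2 powr (- real (Suc j)))"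
      by (simp add: algebra_simps)
    have "2 powr (- real j) \<le> (1::real)" by (simp add: powr_minus_divide powr_realpow)
    then have "k0 \<le> ?k" using d(1) by simp
    then have "?h powr e * \<mu> (?k + ?h) \<le> C * \<mu> ?k powr (1 + \<sigma>)"
      using d(1) by (intro rec) auto
    also have "\<dots> \<le> C * (\<mu> k0 * 2 powr (- real j * a)) powr (1 + \<sigma>)"
      using Suc pos nonneg by (intro mult_left_mono powr_mono2) auto
    also have "\<dots> = C * \<mu> k0 powr \<sigma> * \<mu> k0 * 2 powr (- real j * a - real j * e)"
    proof -
      have "(- real j * a) * (1 + \<sigma>) = - real j * a - real j * e"
        using a(2) by (simp add: algebra_simps)
      then have "(\<mu> k0 * 2 powr (- real j * a)) powr (1 + \<sigma>)
          = \<mu> k0 powr (1 + \<sigma>) * 2 powr (- real j * a - real j * e)"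
        using M by (simp only: powr_mult powr_powr)
      also have "\<mu> k0 powr (1 + \<sigma>) = \<mu> k0 powr \<sigma> * \<mu> k0" using M by (simp add: powr_add)
      finally show ?thesis by simp
    qed
    also have "- real j * a - real j * e = (- real (Suc j) * a) + (- real (Suc j) * e) + (e + a)"
      by (simp add: algebra_simps)
    also have "C * \<mu> k0 powr \<sigma> * \<mu> k0 * 2 powr \<dots>
        = (C * 2 powr (e + a) * \<mu> k0 powr \<sigma>) * 2 powr (- real (Suc j) * e) * (\<mu> k0 * 2 powr (- real (Suc j) * a))"
      unfolding powr_add by simp
    also have "(C * 2 powr (e + a) * \<mu> k0 powr \<sigma>) * 2 powr (- real (Suc j) * e) = ?h powr e"
      using d by (simp add: powr_mult powr_powr)
    finally show ?case unfolding kh using d(1) by (simp del: of_nat_Suc)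
  qed simp
  have "\<mu> (k0 + d) \<le> \<mu> k0 * (2 powr (- a)) ^ j" for j
  proof -
    have "\<mu> (k0 + d) \<le> \<mu> (k0 + d * (1 - 2 powr (- real j)))"
      using d(1) by (intro anti) simp
    also note step[of j]
    also have "2 powr (- real j * a) = (2 powr (- a)) ^ j"
      by (simp add: powr_realpow[symmetric] powr_powr mult.commute)
    finally show ?thesis .
  qed
  moreover have "(\<lambda>j. \<mu> k0 * (2 powr (- a)) ^ j) \<longlonglongrightarrow> \<mu> k0 * 0"
    using a(1) by (intro tendsto_mult tendsto_const LIMSEQ_realpow_zero) (auto simp: powr_minus_divide)
  ultimately have "\<mu> (k0 + d) \<le> 0"
    by (intro LIMSEQ_le_const[of _ "\<mu> k0 * 0", simplified]) auto
  then show ?thesis using nonneg[of "k0 + d"] by (intro exI[of _ "k0 + d"]) simp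
qed blast

text \<open>Stampacchia's criterion: if the integral of the right-hand side over \<open>{u > k}\<close> is bounded by a power of
  \<open>\<bar>{u > k}\<bar>\<close> that is not too far below \<open>1\<close>, then the gain \<open>s m / N\<close> in the estimate for superlevel sets
  makes the exponent exceed \<open>1\<close>.\<close>

lemma weak_solution_bounded_above:
  fixes u :: "'a::euclidean_space \<Rightarrow> real"
  assumes s: "0 < s" and m: "1 < m" and ws: "weak_solution s m D F u" and D: "bounded D" "D \<in> sets lebesgue"
    and Fg: "AE x in lebesgue_on D. F x \<le> g x" and g: "g \<in> borel_measurable lebesgue" "\<And>x. 0 \<le> g x"
    and C: "0 \<le> C" and k0: "0 \<le> k0" and e: "e < s * m / DIM('a)"
    and le: "\<And>k. k0 \<le> k \<Longrightarrow> (\<integral>\<^sup>+x. ennreal (g x) * indicator {x. k < u x} x \<partial>lebesgue)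
        \<le> ennreal (C * measure lebesgue {x. k < u x} powr (1 - e))"
  shows "\<exists>K. AE x in lebesgue. u x \<le> K"
proof -
  have u: "u \<in> W0 s m D" using ws by (simp add: weak_solution_def)
  define \<mu> where "\<mu> k = measure lebesgue {x. max 0 k < u x}" for k
  have A: "{x. max 0 k < u x} \<in> lmeasurable" for k
    by (rule lmeasurable_superlevel[OF W0D(1)[OF u] W0D(2)[OF u] D(1)]) auto
  define c where "c = faber_krahn_const TYPE('a) s m"
  have c: "0 < c" unfolding c_def by (rule faber_krahn_const_pos)
  have "\<exists>K. \<mu> K = 0"
  proof (rule de_giorgi)
    show "0 \<le> \<mu> k" for k by (simp add: \<mu>_def)
    show "\<mu> l \<le> \<mu> k" if "k \<le> l" for k l
      unfolding \<mu>_def using A that by (intro measure_mono_fmeasurable) auto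
    show "0 < (C + 1) / c" "0 < m - 1" "0 < s * m / DIM('a) - e" using C c m e by auto
    fix k h :: real assume kh: "k0 \<le> k" "0 < h"
    then have k: "max 0 k = k" "max 0 (k + h) = k + h" using k0 by auto
    have "c * h powr (m - 1) * \<mu> (k + h) \<le> \<mu> k powr (s * m / DIM('a)) * (C * \<mu> k powr (1 - e))"
      unfolding \<mu>_def k c_def using kh k0 C le by (intro superlevel_estimate[OF s m ws D Fg g]) auto
    also have "\<dots> \<le> (C + 1) * (\<mu> k powr (s * m / DIM('a)) * \<mu> k powr (1 - e))"
      by (simp add: algebra_simps)
    also have "\<dots> = (C + 1) * \<mu> k powr (1 + (s * m / DIM('a) - e))"
      unfolding powr_add[symmetric] by (simp add: algebra_simps)
    finally show "h powr (m - 1) * \<mu> (k + h) \<le> (C + 1) / c * \<mu> k powr (1 + (s * m / DIM('a) - e))"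
      using c by (simp add: field_simps)
  qed
  then obtain K where "\<mu> K = 0" ..
  then have "{x. max 0 K < u x} \<in> null_sets lebesgue"
    using A[of K] unfolding \<mu>_def by (auto simp: null_sets_def fmeasurable_def measure_def enn2real_eq_0_iff less_top)
  then have "AE x in lebesgue. \<not> max 0 K < u x"
    by (rule AE_I') auto
  then show ?thesis by (intro exI[of _ "max 0 K"]) (simp only: not_less)
qed

section \<open>Comparison principle and dilations\<close>

lemma integral_lebesgue_on_vanishing:
  fixes f :: "'a::euclidean_space \<Rightarrow> real"
  assumes "D \<in> sets lebesgue" "\<And>x. x \<notin> D \<Longrightarrow> f x = 0"
  shows "integrable (lebesgue_on D) f \<longleftrightarrow> integrable lebesgue f"
    and "(\<integral>x. f x \<partial>lebesgue_on D) = (\<integral>x. f x \<partial>lebesgue)"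
proof -
  have *: "(\<lambda>x. indicator D x * f x) = f" using assms(2) by (auto simp: indicator_def fun_eq_iff)
  show "integrable (lebesgue_on D) f \<longleftrightarrow> integrable lebesgue f"
    using assms(1) by (subst integrable_restrict_space) (simp_all add: *)
  show "(\<integral>x. f x \<partial>lebesgue_on D) = (\<integral>x. f x \<partial>lebesgue)"
    using assms(1) by (subst integral_restrict_space) (simp_all add: *)
qed

lemma weak_solution_const:
  fixes u :: "'a::euclidean_space \<Rightarrow> real"
  assumes "D \<in> sets lebesgue" "c \<noteq> 0"
  shows "weak_solution s m D (\<lambda>_. c) u \<longleftrightarrow> u \<in> W0 s m D \<and>
    (\<forall>\<phi>\<in>W0 s m D. integrable lebesgue \<phi> \<and> frac_form s m u \<phi> = c * (\<integral>x. \<phi> x \<partial>lebesgue))"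
proof -
  have "integrable (lebesgue_on D) \<phi> \<longleftrightarrow> integrable lebesgue \<phi>"
    "(\<integral>x. \<phi> x \<partial>lebesgue_on D) = (\<integral>x. \<phi> x \<partial>lebesgue)" if "\<phi> \<in> W0 s m D" for \<phi>
    using integral_lebesgue_on_vanishing[OF assms(1), of \<phi>] W0D(2)[OF that] by auto
  then show ?thesis using assms(2)
    unfolding weak_solution_def by (simp cong: conj_cong ball_cong)
qed

text \<open>Test both equations with the positive part of \<open>u - w\<close>. Nonnegativity of \<open>w\<close> everywhere makes this
  function vanish outside the smaller domain \<open>D\<close>, so that it is an admissible test function for \<open>u\<close>.\<close>

lemma weak_solution_comparison:
  fixes u w :: "'a::euclidean_space \<Rightarrow> real"
  assumes s: "0 < s" and m: "1 < m" and u: "weak_solution s m D F u" and w: "weak_solution s m B (\<lambda>_. c) w"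
    and D: "D \<in> sets lebesgue" "D \<subseteq> B" and B: "B \<in> sets lebesgue" "bounded B"
    and F: "AE x in lebesgue_on D. F x \<le> c" and c: "c \<noteq> 0" and pos: "\<And>x. 0 \<le> w x"
  shows "AE x in lebesgue. u x \<le> w x"
proof -
  have uW: "u \<in> W0 s m D" and wW: "w \<in> W0 s m B" using u w by (auto simp: weak_solution_def)
  note [measurable] = W0D(1)[OF uW] W0D(1)[OF wW]
  define v where "v = (\<lambda>x. max 0 (u x - w x))"
  have v: "v \<in> W0 s m D'" if "D \<subseteq> D'" for D'
  proof (rule W0_dominated[where C = 1, OF _ _ uW wW])
    show "v \<in> borel_measurable lebesgue" unfolding v_def by measurable
    show "v x = 0" if "x \<notin> D'" for x
    proof -
      have "u x = 0" using W0D(2)[OF uW, of x] that \<open>D \<subseteq> D'\<close> by auto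
      then show ?thesis using pos[of x] by (simp add: v_def max_def)
    qed
  qed (use m in \<open>auto simp: v_def\<close>)
  have vD: "v \<in> W0 s m D" and vB: "v \<in> W0 s m B" using v D by auto
  have int: "integrable lebesgue v" "frac_form s m w v = c * (\<integral>x. v x \<partial>lebesgue)"
    using w vB unfolding weak_solution_const[OF B(1) c] by auto
  have *: "integrable (lebesgue_on D) (\<lambda>x. c * v x)"
    "(\<integral>x. c * v x \<partial>lebesgue_on D) = c * (\<integral>x. v x \<partial>lebesgue)"
    using integral_lebesgue_on_vanishing[OF D(1), of "\<lambda>x. c * v x"] W0D(2)[OF vD] int(1)
    by auto
  show ?thesis
  proof (rule AE_le_of_frac_form_le[OF m uW wW v_def vB B(2) s])
    have "frac_form s m u v = (\<integral>x. F x * v x \<partial>lebesgue_on D)"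
      "integrable (lebesgue_on D) (\<lambda>x. F x * v x)"
      using u vD by (auto simp: weak_solution_def)
    note this(1)
    also have "(\<integral>x. F x * v x \<partial>lebesgue_on D) \<le> (\<integral>x. c * v x \<partial>lebesgue_on D)"
    proof (rule integral_mono_AE)
      show "AE x in lebesgue_on D. F x * v x \<le> c * v x"
        using F by eventually_elim (auto simp: v_def intro: mult_right_mono)
    qed fact+
    also have "\<dots> = frac_form s m w v" using int * by simp
    finally show "frac_form s m u v \<le> frac_form s m w v" .
  qed
qed

lemma frac_form_zero [simp]: "v \<in> borel_measurable lebesgue \<Longrightarrow> frac_form s m (\<lambda>_. 0) v = 0"
  by (simp add: frac_form_gagliardo incr_def)

lemma zero_in_W0: "(\<lambda>_. 0) \<in> W0 s m D"
  by (simp add: W0_iff incr_def)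

lemma weak_solution_const_nonneg:
  fixes w :: "'a::euclidean_space \<Rightarrow> real"
  assumes s: "0 < s" and m: "1 < m" and w: "weak_solution s m B (\<lambda>_. c) w"
    and B: "B \<in> sets lebesgue" "bounded B" and c: "0 < c"
  shows "AE x in lebesgue. 0 \<le> w x"
proof -
  have wW: "w \<in> W0 s m B" using w by (auto simp: weak_solution_def)
  note [measurable] = W0D(1)[OF wW]
  define v where "v = (\<lambda>x. max 0 (0 - w x))"
  have v: "v \<in> W0 s m B"
    unfolding v_def using m by (intro W0_contraction[OF _ wW]) auto
  have [measurable]: "v \<in> borel_measurable lebesgue" using W0D(1)[OF v] .
  show ?thesis
  proof (rule AE_le_of_frac_form_le[OF m zero_in_W0 wW v_def v B(2) s])
    show "frac_form s m (\<lambda>_. 0) v \<le> frac_form s m w v"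
      using w v c B unfolding weak_solution_const[OF B(1) less_imp_neq[OF c, symmetric]]
      by (auto simp: v_def intro!: mult_nonneg_nonneg Bochner_Integration.integral_nonneg)
  qed
qed

lemma weak_solution_cmult:
  assumes c: "0 \<le> c" and m: "1 < m" and u: "weak_solution s m D f u"
  shows "weak_solution s m D (\<lambda>x. c powr (m - 1) * f x) (\<lambda>x. c * u x)"
  unfolding weak_solution_def
proof (intro conjI ballI)
  have uW: "u \<in> W0 s m D" using u by (auto simp: weak_solution_def)
  show cuW: "(\<lambda>x. c * u x) \<in> W0 s m D"
    using W0_lincomb[OF _ uW uW, of c 0] m by simp
  fix \<phi> assume \<phi>: "\<phi> \<in> W0 s m D"
  have *: "integrable (lebesgue_on D) (\<lambda>x. f x * \<phi> x)"
    "frac_form s m u \<phi> = (\<integral>x. f x * \<phi> x \<partial>(lebesgue_on D))"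
    using u \<phi> by (auto simp: weak_solution_def)
  show "integrable (lebesgue_on D) (\<lambda>x. c powr (m - 1) * f x * \<phi> x)"
    using *(1) by (simp add: mult.assoc)
  have spow: "spow m (c * t) = c powr (m - 1) * spow m t" for t
  proof -
    have "spow m (c * t) = c powr (m - 2) * c * spow m t"
      using c by (simp add: spow_def abs_mult powr_mult)
    also have "c powr (m - 2) * c = c powr (m - 1)"
      using powr_pred_times[OF c, of "m - 1"] by simp
    finally show ?thesis .
  qed
  have "incr (\<lambda>x. c * u x) z = c * incr u z" for z :: "'a \<times> 'a" by (simp add: incr_def algebra_simps)
  then have "frac_form s m (\<lambda>x. c * u x) \<phi> = c powr (m - 1) * frac_form s m u \<phi>"
    using W0D(1)[OF uW] W0D(1)[OF \<phi>] W0D(1)[OF cuW] 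
    by (simp add: frac_form_gagliardo spow mult.assoc)
  then show "frac_form s m (\<lambda>x. c * u x) \<phi> = (\<integral>x. c powr (m - 1) * f x * \<phi> x \<partial>(lebesgue_on D))"
    using *(2) by (simp add: mult.assoc)
qed

text \<open>A scaling rule for nonnegative functions determines the measure, so it carries over to
  integrability and to signed integrals. It is used for Lebesgue measure and for the Gagliardo measure.\<close>

lemma integral_change_of_variables_const:
  fixes g :: "'a \<Rightarrow> real"
  assumes S: "S \<in> M \<rightarrow>\<^sub>M M" and c: "0 < c"
    and nn: "\<And>f. f \<in> borel_measurable M \<Longrightarrow> (\<integral>\<^sup>+x. f x \<partial>M) = ennreal c * (\<integral>\<^sup>+x. f (S x) \<partial>M)"
    and g: "g \<in> borel_measurable M"
  shows "integrable M g \<longleftrightarrow> integrable M (\<lambda>x. g (S x))"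
    and "(\<integral>x. g x \<partial>M) = c * (\<integral>x. g (S x) \<partial>M)"
proof -
  have M: "M = density (distr M M S) (\<lambda>_. ennreal c)"
  proof (rule measure_eqI)
    fix A assume A: "A \<in> sets M"
    have "emeasure M A = (\<integral>\<^sup>+x. indicator A x \<partial>M)" using A by simp
    also have "\<dots> = ennreal c * (\<integral>\<^sup>+x. indicator A (S x) \<partial>M)" using A by (intro nn) auto
    also have "\<dots> = (\<integral>\<^sup>+x. ennreal c * indicator A x \<partial>distr M M S)"
      using A S by (subst nn_integral_distr) (auto simp: nn_integral_cmult)
    also have "\<dots> = emeasure (density (distr M M S) (\<lambda>_. ennreal c)) A"
      using A by (subst emeasure_density) auto
    finally show "emeasure M A = emeasure (density (distr M M S) (\<lambda>_. ennreal c)) A" .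
  qed simp
  have "integrable M g \<longleftrightarrow> integrable (density (distr M M S) (\<lambda>_. ennreal c)) g"
    using M by simp
  also have "\<dots> \<longleftrightarrow> integrable M (\<lambda>x. c * g (S x))"
    using c g S by (subst integrable_real_density) (auto simp: integrable_distr_eq)
  finally show "integrable M g \<longleftrightarrow> integrable M (\<lambda>x. g (S x))" using c by simp
  have "(\<integral>x. g x \<partial>M) = (\<integral>x. g x \<partial>density (distr M M S) (\<lambda>_. ennreal c))"
    using M by simp
  also have "\<dots> = (\<integral>x. c * g (S x) \<partial>M)"
    using c g S by (subst integral_real_density) (auto simp: integral_distr)
  finally show "(\<integral>x. g x \<partial>M) = c * (\<integral>x. g (S x) \<partial>M)" by simp
qed

lemma measurable_dilation:
  "(\<lambda>x. x0 + d *\<^sub>R x) \<in> lebesgue \<rightarrow>\<^sub>M (lebesgue :: 'a::euclidean_space measure)" if "d \<noteq> 0"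
proof -
  have "(\<lambda>x. x0 + d *\<^sub>R x) = (\<lambda>x. x0 + (\<Sum>j\<in>Basis. (d * (x \<bullet> j)) *\<^sub>R j))"
    by (simp add: fun_eq_iff euclidean_representation flip: scaleR_scaleR scaleR_sum_right)
  then show ?thesis using lebesgue_affine_measurable[of "\<lambda>_. d" x0] that by simp
qed

lemma nn_integral_dilation:
  fixes x0 :: "'a::euclidean_space"
  assumes d: "0 < d" and f: "f \<in> borel_measurable lebesgue"
  shows "(\<integral>\<^sup>+x. f x \<partial>lebesgue) = ennreal (d ^ DIM('a)) * (\<integral>\<^sup>+x. f (x0 + d *\<^sub>R x) \<partial>lebesgue)"
proof -
  have T: "(\<lambda>x. x0 + d *\<^sub>R x) = (\<lambda>x. x0 + (\<Sum>j\<in>Basis. (d * (x \<bullet> j)) *\<^sub>R j))"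
    by (simp add: fun_eq_iff euclidean_representation flip: scaleR_scaleR scaleR_sum_right)
  have "lebesgue = density (distr lebesgue lebesgue (\<lambda>x. x0 + d *\<^sub>R x)) (\<lambda>_. ennreal (d ^ DIM('a)))"
    using lebesgue_affine_euclidean[of "\<lambda>_. d" x0] d unfolding T by simp
  then have "(\<integral>\<^sup>+x. f x \<partial>lebesgue) =
     (\<integral>\<^sup>+x. f x \<partial>density (distr lebesgue lebesgue (\<lambda>x. x0 + d *\<^sub>R x)) (\<lambda>_. ennreal (d ^ DIM('a))))"
    by simp
  also have "\<dots> = ennreal (d ^ DIM('a)) * (\<integral>\<^sup>+x. f (x0 + d *\<^sub>R x) \<partial>lebesgue)"
    using f measurable_dilation[of d x0] d
    by (simp add: nn_integral_density nn_integral_distr nn_integral_cmult)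
  finally show ?thesis .
qed

text \<open>Each of the two Lebesgue factors scales with \<open>d\<^sup>N\<close> and the kernel with \<open>d\<^bsup>- (N + s m)\<^esup>\<close>.\<close>

lemma nn_integral_gagliardo_dilation:
  fixes x0 :: "'a::euclidean_space" and d s m :: real
  defines "S \<equiv> \<lambda>z. (x0 + d *\<^sub>R fst z, x0 + d *\<^sub>R snd z)"
  assumes d: "0 < d" and f: "f \<in> borel_measurable (gagliardo s m)"
  shows "(\<integral>\<^sup>+z. f z \<partial>gagliardo s m) =
    ennreal (d powr (DIM('a) - s * m)) * (\<integral>\<^sup>+z. f (S z) \<partial>gagliardo s m)"
    and "S \<in> gagliardo s m \<rightarrow>\<^sub>M gagliardo s m"
proof -
  interpret sf: sigma_finite_measure "lebesgue :: 'a measure" by (rule sigma_finite_lebesgue)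
  let ?N = "real DIM('a)" and ?L = "lebesgue :: 'a measure"
  let ?k = "\<lambda>z :: 'a \<times> 'a. ennreal (1 / norm (fst z - snd z) powr (DIM('a) + s * m))"
  have dil [measurable]: "(\<lambda>x. x0 + d *\<^sub>R x) \<in> ?L \<rightarrow>\<^sub>M ?L"
    using d by (intro measurable_dilation) auto
  have S': "S \<in> (?L \<Otimes>\<^sub>M ?L) \<rightarrow>\<^sub>M (?L \<Otimes>\<^sub>M ?L)"
    unfolding S_def
    by (intro measurable_Pair measurable_compose[OF measurable_fst dil] measurable_compose[OF measurable_snd dil])
  then show "S \<in> gagliardo s m \<rightarrow>\<^sub>M gagliardo s m"
    using measurable_cong_sets[OF sets_gagliardo sets_gagliardo] by blast
  have fm [measurable]: "f \<in> borel_measurable (?L \<Otimes>\<^sub>M ?L)"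
    using f measurable_cong_sets[OF sets_gagliardo refl] by blast
  have fS [measurable]: "(\<lambda>z. f (S z)) \<in> borel_measurable (?L \<Otimes>\<^sub>M ?L)"
    using measurable_compose[OF S' fm] .
  define h where "h z = ?k z * f z" for z
  have h [measurable]: "h \<in> borel_measurable (?L \<Otimes>\<^sub>M ?L)" unfolding h_def by measurable
  have hS: "(\<lambda>z. h (S z)) \<in> borel_measurable (?L \<Otimes>\<^sub>M ?L)"
    using measurable_compose[OF S' h] .
  have kS: "?k (S z) = ennreal (d powr (- (?N + s * m))) * ?k z" for z
  proof -
    have "fst (S z) - snd (S z) = d *\<^sub>R (fst z - snd z)" by (simp add: S_def algebra_simps)
    then show ?thesis using d
      by (simp add: powr_mult powr_minus_divide ennreal_mult[symmetric] del: minus_add_distrib)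
  qed
  have "(\<integral>\<^sup>+z. f z \<partial>gagliardo s m) = (\<integral>\<^sup>+z. h z \<partial>(?L \<Otimes>\<^sub>M ?L))"
    unfolding gagliardo_def h_def by (rule nn_integral_density) auto
  also have "\<dots> = (\<integral>\<^sup>+x. \<integral>\<^sup>+y. h (x, y) \<partial>?L \<partial>?L)"
    by (rule sf.nn_integral_fst[symmetric]) (rule h)
  also have "\<dots> = (\<integral>\<^sup>+x. ennreal (d ^ DIM('a)) * (\<integral>\<^sup>+y. h (x, x0 + d *\<^sub>R y) \<partial>?L) \<partial>?L)"
    by (intro nn_integral_cong nn_integral_dilation[OF d]) measurable
  also have "\<dots> = ennreal (d ^ DIM('a)) * (\<integral>\<^sup>+x. ennreal (d ^ DIM('a)) *
      (\<integral>\<^sup>+y. h (x0 + d *\<^sub>R x, x0 + d *\<^sub>R y) \<partial>?L) \<partial>?L)"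
    by (rule nn_integral_dilation[OF d]) measurable
  also have "\<dots> = ennreal (d ^ DIM('a)) * (ennreal (d ^ DIM('a)) *
      (\<integral>\<^sup>+x. \<integral>\<^sup>+y. h (S (x, y)) \<partial>?L \<partial>?L))"
    using hS by (subst nn_integral_cmult) (auto simp: S_def intro!: sf.borel_measurable_nn_integral)
  also have "(\<integral>\<^sup>+x. \<integral>\<^sup>+y. h (S (x, y)) \<partial>?L \<partial>?L) = (\<integral>\<^sup>+z. h (S z) \<partial>(?L \<Otimes>\<^sub>M ?L))"
    by (rule sf.nn_integral_fst) (rule hS)
  also have "\<dots> = (\<integral>\<^sup>+z. ennreal (d powr (- (?N + s * m))) * (?k z * f (S z)) \<partial>(?L \<Otimes>\<^sub>M ?L))"
    unfolding h_def kS by (simp add: mult.assoc)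
  also have "\<dots> = ennreal (d powr (- (?N + s * m))) * (\<integral>\<^sup>+z. ?k z * f (S z) \<partial>(?L \<Otimes>\<^sub>M ?L))"
    by (rule nn_integral_cmult) measurable
  also have "(\<integral>\<^sup>+z. ?k z * f (S z) \<partial>(?L \<Otimes>\<^sub>M ?L)) = (\<integral>\<^sup>+z. f (S z) \<partial>gagliardo s m)"
    unfolding gagliardo_def by (rule nn_integral_density[symmetric]) auto
  also have "ennreal (d ^ DIM('a)) * (ennreal (d ^ DIM('a)) * (ennreal (d powr (- (?N + s * m))) *
      (\<integral>\<^sup>+z. f (S z) \<partial>gagliardo s m))) = ennreal (d powr (?N - s * m)) * (\<integral>\<^sup>+z. f (S z) \<partial>gagliardo s m)"
  proof -
    have "d ^ DIM('a) * (d ^ DIM('a) * d powr (- (?N + s * m))) = d powr (?N - s * m)"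
      using d unfolding powr_realpow[OF d, symmetric] powr_add[symmetric] by simp
    then show ?thesis
      using d by (simp add: mult.assoc[symmetric] ennreal_mult[symmetric])
  qed
  finally show "(\<integral>\<^sup>+z. f z \<partial>gagliardo s m) =
    ennreal (d powr (DIM('a) - s * m)) * (\<integral>\<^sup>+z. f (S z) \<partial>gagliardo s m)" .
qed

text \<open>The form scales with \<open>d\<^bsup>N - s m\<^esup>\<close> and integrals with \<open>d\<^sup>N\<close>. The resulting factor \<open>d\<^bsup>- s m\<^esup>\<close> is the source of
  the power of the diameter in the final bound.\<close>

lemma weak_solution_dilation:
  fixes w :: "'a::euclidean_space \<Rightarrow> real"
  assumes d: "0 < d" and m: "1 < m" and w: "weak_solution s m (ball 0 1) (\<lambda>_. 1) w"
  shows "weak_solution s m (ball x0 d) (\<lambda>_. d powr (- (s * m))) (\<lambda>x. w ((1 / d) *\<^sub>R (x - x0)))"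
proof -
  define S :: "'a \<Rightarrow> 'a" where "S x = x0 + d *\<^sub>R x" for x
  define T :: "'a \<Rightarrow> 'a" where "T x = (1 / d) *\<^sub>R (x - x0)" for x
  have TS: "T (S x) = x" "S (T x) = x" for x using d by (auto simp: S_def T_def)
  have T_eq: "T x = (- (1 / d)) *\<^sub>R x0 + (1 / d) *\<^sub>R x" for x by (simp add: T_def algebra_simps)
  have S_meas [measurable]: "S \<in> lebesgue \<rightarrow>\<^sub>M lebesgue"
    unfolding S_def using d by (intro measurable_dilation) auto
  have T_meas [measurable]: "T \<in> lebesgue \<rightarrow>\<^sub>M lebesgue"
    unfolding T_eq using d by (intro measurable_dilation) auto
  define SS where "SS z = (S (fst z), S (snd z))" for z
  have incr_S: "incr v (SS z) = incr (\<lambda>x. v (S x)) z" for v z by (simp add: incr_def SS_def)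
  let ?N = "real DIM('a)"
  have SS: "SS \<in> gagliardo s m \<rightarrow>\<^sub>M gagliardo s m"
    using nn_integral_gagliardo_dilation(2)[OF d, of "\<lambda>_. 0" s m x0] by (simp add: SS_def[abs_def] S_def)
  have gag: "integrable (gagliardo s m) g \<longleftrightarrow> integrable (gagliardo s m) (\<lambda>z. g (SS z))"
      "(\<integral>z. g z \<partial>gagliardo s m) = d powr (?N - s * m) * (\<integral>z. g (SS z) \<partial>gagliardo s m)"
    if "g \<in> borel_measurable (gagliardo s m)" for g :: "'a \<times> 'a \<Rightarrow> real"
    using d nn_integral_gagliardo_dilation(1)[OF d, of _ s m x0] that
      integral_change_of_variables_const[OF SS, of "d powr (?N - s * m)" g]
    by (auto simp: SS_def S_def)
  have leb: "integrable lebesgue g \<longleftrightarrow> integrable lebesgue (\<lambda>x. g (S x))"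
      "(\<integral>x. g x \<partial>lebesgue) = d powr ?N * (\<integral>x. g (S x) \<partial>lebesgue)"
    if "g \<in> borel_measurable lebesgue" for g :: "'a \<Rightarrow> real"
    using d nn_integral_dilation[OF d, of _ x0] that
      integral_change_of_variables_const[OF S_meas, of "d powr ?N" g]
    by (auto simp: S_def powr_realpow)
  have W0S: "v \<in> W0 s m (ball x0 d) \<longleftrightarrow> (\<lambda>x. v (S x)) \<in> W0 s m (ball 0 1)"
    if [measurable]: "v \<in> borel_measurable lebesgue" for v
  proof -
    have "(\<lambda>x. v (S x)) \<in> borel_measurable lebesgue" by measurable
    moreover have "(\<forall>x. x \<notin> ball x0 d \<longrightarrow> v x = 0) \<longleftrightarrow> (\<forall>x. x \<notin> ball 0 1 \<longrightarrow> v (S x) = 0)"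
    proof -
      have "S x \<in> ball x0 d \<longleftrightarrow> x \<in> ball 0 1" for x
        using d by (simp add: S_def dist_norm)
      then show ?thesis using TS by metis
    qed
    moreover have "integrable (gagliardo s m) (\<lambda>z. \<bar>incr v z\<bar> powr m) \<longleftrightarrow>
        integrable (gagliardo s m) (\<lambda>z. \<bar>incr (\<lambda>x. v (S x)) z\<bar> powr m)"
      using gag(1)[of "\<lambda>z. \<bar>incr v z\<bar> powr m"] by (simp add: incr_S)
    moreover have "integrable lebesgue (\<lambda>x. \<bar>v x\<bar> powr m) \<longleftrightarrow> integrable lebesgue (\<lambda>x. \<bar>v (S x)\<bar> powr m)"
      using leb(1)[of "\<lambda>x. \<bar>v x\<bar> powr m"] by simp
    ultimately show ?thesis unfolding W0_iff by simp
  qed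
  have ball: "ball (0::'a) 1 \<in> sets lebesgue" "ball x0 d \<in> sets lebesgue" by auto
  have w': "w \<in> W0 s m (ball 0 1)"
    "\<And>\<phi>. \<phi> \<in> W0 s m (ball 0 1) \<Longrightarrow> integrable lebesgue \<phi> \<and> frac_form s m w \<phi> = (\<integral>x. \<phi> x \<partial>lebesgue)"
    using w unfolding weak_solution_const[OF ball(1) one_neq_zero] by auto
  note [measurable] = W0D(1)[OF w'(1)]
  let ?w = "\<lambda>x. w (T x)"
  have w_meas: "?w \<in> borel_measurable lebesgue" by measurable
  have "weak_solution s m (ball x0 d) (\<lambda>_. d powr (- (s * m))) ?w"
    unfolding weak_solution_const[OF ball(2), of "d powr (- (s * m))", simplified, OF d[THEN less_imp_neq, symmetric]]
  proof (intro conjI ballI)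
    show "?w \<in> W0 s m (ball x0 d)" using W0S[OF w_meas] w'(1) by (simp add: TS)
    fix \<phi> assume \<phi>: "\<phi> \<in> W0 s m (ball x0 d)"
    note [measurable] = W0D(1)[OF \<phi>]
    have \<phi>S: "(\<lambda>x. \<phi> (S x)) \<in> W0 s m (ball 0 1)" using W0S[of \<phi>] \<phi> by simp
    show "integrable lebesgue \<phi>" using w'(2)[OF \<phi>S] leb(1)[of \<phi>] by simp
    have "frac_form s m ?w \<phi> = d powr (?N - s * m) *
        (\<integral>z. spow m (incr ?w (SS z)) * incr \<phi> (SS z) \<partial>gagliardo s m)"
      unfolding frac_form_gagliardo[OF w_meas W0D(1)[OF \<phi>]] by (rule gag(2)) measurable
    also have "\<dots> = d powr (?N - s * m) * frac_form s m w (\<lambda>x. \<phi> (S x))"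
      by (simp add: frac_form_gagliardo W0D(1)[OF \<phi>S] incr_S TS)
    also have "\<dots> = d powr (?N - s * m) * (\<integral>x. \<phi> (S x) \<partial>lebesgue)"
      using w'(2)[OF \<phi>S] by simp
    also have "\<dots> = d powr (- (s * m)) * (d powr ?N * (\<integral>x. \<phi> (S x) \<partial>lebesgue))"
      by (simp add: powr_add[symmetric] mult.assoc[symmetric])
    also have "\<dots> = d powr (- (s * m)) * (\<integral>x. \<phi> x \<partial>lebesgue)"
      using leb(2)[of \<phi>] by simp
    finally show "frac_form s m ?w \<phi> = d powr (- (s * m)) * (\<integral>x. \<phi> x \<partial>lebesgue)" .
  qed
  then show ?thesis by (simp add: T_def)
qed

section \<open>Existence of the torsion function\<close>

lemma integrable_W0:
  fixes u :: "'a::euclidean_space \<Rightarrow> real"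
  assumes "1 < m" "u \<in> W0 s m D" "bounded D"
  shows "integrable lebesgue u"
proof -
  obtain r where r: "D \<subseteq> ball 0 r" using bounded_subset_ballD[OF assms(3), of 0] by auto
  show ?thesis
  proof (rule Bochner_Integration.integrable_bound)
    show "integrable lebesgue (\<lambda>x. indicator (ball 0 r) x + \<bar>u x\<bar> powr m)"
    proof (rule Bochner_Integration.integrable_add[OF _ W0D(3)[OF assms(2)]])
      show "integrable lebesgue (indicat_real (ball 0 r :: 'a set))"
        using lmeasurable_ball[of "0 :: 'a" r] by (intro integrable_real_indicator) (auto simp: fmeasurable_def)
    qed
    show "u \<in> borel_measurable lebesgue" using W0D(1)[OF assms(2)] .
    show "AE x in lebesgue. norm (u x) \<le> norm (indicator (ball 0 r) x + \<bar>u x\<bar> powr m)"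
    proof (rule AE_I2)
      fix x
      show "norm (u x) \<le> norm (indicator (ball 0 r) x + \<bar>u x\<bar> powr m)"
      proof (cases "x \<in> ball 0 r")
        case True
        have "\<bar>u x\<bar> \<le> 1 + \<bar>u x\<bar> powr m"
        proof (cases "\<bar>u x\<bar> \<le> 1")
          case False
          then have "\<bar>u x\<bar> powr 1 \<le> \<bar>u x\<bar> powr m" using assms(1) by (intro powr_mono) auto
          then show ?thesis by simp
        qed (use powr_ge_zero[of "\<bar>u x\<bar>" m] in linarith)
        then show ?thesis using True by simp
      next
        case False
        then have "u x = 0" using r W0D(2)[OF assms(2)] by blast
        then show ?thesis by simp
      qed
    qed
  qed
qed

definition torsion_energy :: "real \<Rightarrow> real \<Rightarrow> ('a::euclidean_space \<Rightarrow> real) \<Rightarrow> real" where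
  "torsion_energy s m u = frac_form s m u u / m - (\<integral>x. u x \<partial>lebesgue)"

text \<open>The Euler-Lagrange equation. Convexity bounds the difference quotient of the energy along
  \<open>w + t \<phi>\<close> by the form at \<open>w + t \<phi>\<close>, and this form is continuous in \<open>t\<close>. Applying the resulting
  inequality to \<open>\<phi>\<close> and \<open>- \<phi>\<close> gives the equation.\<close>

lemma torsion_energy_minimizer:
  fixes w :: "'a::euclidean_space \<Rightarrow> real"
  assumes m: "1 < m" and D: "D \<in> sets lebesgue" "bounded D" and w: "w \<in> W0 s m D"
    and min: "\<And>v. v \<in> W0 s m D \<Longrightarrow> torsion_energy s m w \<le> torsion_energy s m v"
  shows "weak_solution s m D (\<lambda>_. 1) w"
proof -
  note [measurable] = W0D(1)[OF w]
  have ineq: "(\<integral>x. \<phi> x \<partial>lebesgue) \<le> frac_form s m w \<phi>" if \<phi>: "\<phi> \<in> W0 s m D" for \<phi>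
  proof -
    note [measurable] = W0D(1)[OF \<phi>]
    have le: "(\<integral>x. \<phi> x \<partial>lebesgue) \<le> frac_form s m (\<lambda>x. w x + t * \<phi> x) \<phi>" if t: "0 < t" for t
    proof -
      let ?v = "\<lambda>x. w x + t * \<phi> x"
      have v: "?v \<in> W0 s m D" using W0_lincomb[OF _ w \<phi>, of 1 t] m by simp
      have incr: "incr ?v z = incr w z + t * incr \<phi> z" for z by (simp add: incr_def algebra_simps)
      have "frac_form s m ?v ?v \<le> (\<integral>z. \<bar>incr w z\<bar> powr m + m * t * (spow m (incr ?v z) * incr \<phi> z) \<partial>gagliardo s m)"
        unfolding frac_form_self[OF W0D(1)[OF v]]
      proof (rule integral_mono)
        show "\<bar>incr ?v z\<bar> powr m \<le> \<bar>incr w z\<bar> powr m + m * t * (spow m (incr ?v z) * incr \<phi> z)" for z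
          using abs_powr_tangent[OF m, of "incr ?v z" "incr w z"] by (simp add: incr mult_ac)
      qed (use W0D(4)[OF v] W0D(4)[OF w] integrable_spow_incr[OF m v \<phi>] in auto)
      also have "\<dots> = frac_form s m w w + m * t * frac_form s m ?v \<phi>"
        using W0D(4)[OF w] integrable_spow_incr[OF m v \<phi>]
        by (simp add: frac_form_self frac_form_gagliardo[OF W0D(1)[OF v] W0D(1)[OF \<phi>]])
      finally have "frac_form s m ?v ?v / m - frac_form s m w w / m \<le> t * frac_form s m ?v \<phi>"
        using m by (simp add: field_simps)
      moreover have "(\<integral>x. ?v x \<partial>lebesgue) = (\<integral>x. w x \<partial>lebesgue) + t * (\<integral>x. \<phi> x \<partial>lebesgue)"
        using integrable_W0[OF m w D(2)] integrable_W0[OF m \<phi> D(2)] by simp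
      ultimately have "t * (\<integral>x. \<phi> x \<partial>lebesgue) \<le> t * frac_form s m ?v \<phi>"
        using min[OF v] unfolding torsion_energy_def by linarith
      then show ?thesis using t by simp
    qed
    have "(\<lambda>n. frac_form s m (\<lambda>x. w x + 1 / (real n + 1) * \<phi> x) \<phi>) \<longlonglongrightarrow> frac_form s m w \<phi>"
    proof -
      have "(\<lambda>n. \<integral>z. spow m (incr (\<lambda>x. w x + 1 / (real n + 1) * \<phi> x) z) * incr \<phi> z \<partial>gagliardo s m)
          \<longlonglongrightarrow> (\<integral>z. spow m (incr w z) * incr \<phi> z \<partial>gagliardo s m)"
      proof (rule integral_dominated_convergence[where w = "\<lambda>z. 2 powr m * (\<bar>incr w z\<bar> powr m + \<bar>incr \<phi> z\<bar> powr m) + \<bar>incr \<phi> z\<bar> powr m"])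
        have incr: "incr (\<lambda>x. w x + t * \<phi> x) z = incr w z + t * incr \<phi> z" for z t
          by (simp add: incr_def algebra_simps)
        show "AE z in gagliardo s m. (\<lambda>n. spow m (incr (\<lambda>x. w x + 1 / (real n + 1) * \<phi> x) z) * incr \<phi> z)
            \<longlonglongrightarrow> spow m (incr w z) * incr \<phi> z"
        proof (intro AE_I2 tendsto_mult tendsto_const)
          fix z
          have "(\<lambda>n. 1 / (real n + 1)) \<longlonglongrightarrow> 0"
            using LIMSEQ_inverse_real_of_nat by (simp add: inverse_eq_divide add.commute)
          then have "(\<lambda>n. incr w z + 1 / (real n + 1) * incr \<phi> z) \<longlonglongrightarrow> incr w z + 0 * incr \<phi> z"
            by (intro tendsto_intros)
          then show "(\<lambda>n. spow m (incr (\<lambda>x. w x + 1 / (real n + 1) * \<phi> x) z)) \<longlonglongrightarrow> spow m (incr w z)"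
            unfolding incr using isCont_tendsto_compose[OF isCont_spow[OF m, of "incr w z"]] by simp
        qed
        show "AE z in gagliardo s m. norm (spow m (incr (\<lambda>x. w x + 1 / (real n + 1) * \<phi> x) z) * incr \<phi> z)
            \<le> 2 powr m * (\<bar>incr w z\<bar> powr m + \<bar>incr \<phi> z\<bar> powr m) + \<bar>incr \<phi> z\<bar> powr m" for n
        proof (rule AE_I2)
          fix z
          let ?t = "1 / (real n + 1)"
          have "\<bar>spow m (incr w z + ?t * incr \<phi> z) * incr \<phi> z\<bar>
              \<le> \<bar>incr w z + ?t * incr \<phi> z\<bar> powr m + \<bar>incr \<phi> z\<bar> powr m"
            by (rule spow_times_le[OF m])
          also have "\<bar>incr w z + ?t * incr \<phi> z\<bar> powr m
              \<le> 2 powr m * (\<bar>incr w z\<bar> powr m + \<bar>?t * incr \<phi> z\<bar> powr m)"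
            using m by (intro abs_powr_add_le) simp
          also have "\<dots> \<le> 2 powr m * (\<bar>incr w z\<bar> powr m + \<bar>incr \<phi> z\<bar> powr m)"
          proof -
            have "\<bar>?t * incr \<phi> z\<bar> \<le> \<bar>incr \<phi> z\<bar>"
              unfolding abs_mult by (intro mult_left_le_one_le) auto
            then show ?thesis using m by (intro mult_left_mono add_left_mono powr_mono2) auto
          qed
          finally show "norm (spow m (incr (\<lambda>x. w x + ?t * \<phi> x) z) * incr \<phi> z)
            \<le> 2 powr m * (\<bar>incr w z\<bar> powr m + \<bar>incr \<phi> z\<bar> powr m) + \<bar>incr \<phi> z\<bar> powr m"
            unfolding incr by simp
        qed
      qed (use W0D(4)[OF w] W0D(4)[OF \<phi>] in \<open>measurable, simp\<close>)
      then show ?thesis by (simp add: frac_form_gagliardo)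
    qed
    then show ?thesis by (rule LIMSEQ_le_const) (intro exI[of _ 0] allI impI le, simp)
  qed
  show ?thesis
    unfolding weak_solution_const[OF D(1) one_neq_zero]
  proof (intro conjI ballI w)
    fix \<phi> assume \<phi>: "\<phi> \<in> W0 s m D"
    then show int: "integrable lebesgue \<phi>" using integrable_W0[OF m _ D(2)] by blast
    have \<phi>': "(\<lambda>x. - \<phi> x) \<in> W0 s m D" using W0_lincomb[OF _ \<phi> \<phi>, of "-1" 0] m by simp
    have "frac_form s m w (\<lambda>x. - \<phi> x) = - frac_form s m w \<phi>"
    proof -
      have "incr (\<lambda>x. - \<phi> x) z = - incr \<phi> z" for z by (simp add: incr_def)
      then show ?thesis using W0D(1)[OF \<phi>] by (simp add: frac_form_gagliardo)
    qed
    then show "frac_form s m w \<phi> = 1 * (\<integral>x. \<phi> x \<partial>lebesgue)"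
      using ineq[OF \<phi>] ineq[OF \<phi>'] by simp
  qed
qed

lemma torsion_energy_coercive:
  fixes D :: "'a::euclidean_space set"
  assumes s: "0 < s" and m: "1 < m" and D: "bounded D"
  obtains K P where "0 \<le> K" "0 \<le> P"
    "\<And>u. u \<in> W0 s m D \<Longrightarrow> (\<integral>x. \<bar>u x\<bar> powr m \<partial>lebesgue) \<le> P * frac_form s m u u"
    "\<And>u. u \<in> W0 s m D \<Longrightarrow> (\<integral>x. \<bar>u x\<bar> \<partial>lebesgue) \<le> K + frac_form s m u u / (2 * m)"
proof -
  obtain r where r: "0 < r" "D \<subseteq> ball 0 r" using bounded_subset_ballD[OF D, of 0] by auto
  define V where "V = measure lebesgue (ball (0::'a) r)"
  have V: "0 < V" using r(1) content_ball_pos by (simp add: V_def)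
  define c where "c = faber_krahn_const TYPE('a) s m"
  have c: "0 < c" unfolding c_def by (rule faber_krahn_const_pos)
  define P where "P = V powr (s * m / DIM('a)) / c"
  have P: "0 < P" using V c by (simp add: P_def)
  \<comment> \<open>Splitting \<open>\<bar>u\<bar>\<close> at the height \<open>t\<close> bounds it by \<open>t + t\<^bsup>1-m\<^esup> \<bar>u\<bar>\<^sup>m\<close>.\<close>
  define t where "t = (2 * m * P) powr (1 / (m - 1))"
  have t: "0 < t" "t powr (m - 1) = 2 * m * P" using P m by (auto simp: t_def powr_powr)
  have E: "0 \<le> frac_form s m u u" if "u \<in> W0 s m D" for u
    by (simp add: frac_form_self[OF W0D(1)[OF that]])
  have poincare: "(\<integral>x. \<bar>u x\<bar> powr m \<partial>lebesgue) \<le> P * frac_form s m u u" if u: "u \<in> W0 s m D" for u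
  proof -
    have "u x = 0" if "x \<notin> ball 0 r" for x using that r(2) W0D(2)[OF u] by blast
    then have "c * (\<integral>x. \<bar>u x\<bar> powr m \<partial>lebesgue) \<le> V powr (s * m / DIM('a)) * frac_form s m u u"
      unfolding c_def V_def using V m by (intro faber_krahn[OF s _ u]) (auto simp: V_def)
    then show ?thesis using c by (simp add: P_def field_simps)
  qed
  have "(\<integral>x. \<bar>u x\<bar> \<partial>lebesgue) \<le> t * V + frac_form s m u u / (2 * m)" if u: "u \<in> W0 s m D" for u
  proof -
    have ind: "integrable lebesgue (indicat_real (ball 0 r :: 'a set))"
      using lmeasurable_ball[of "0 :: 'a" r] by (intro integrable_real_indicator) (auto simp: fmeasurable_def)
    have "(\<integral>x. \<bar>u x\<bar> \<partial>lebesgue) \<le> (\<integral>x. t * indicator (ball 0 r) x + \<bar>u x\<bar> powr m / t powr (m - 1) \<partial>lebesgue)"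
    proof (rule integral_mono)
      show "integrable lebesgue (\<lambda>x. \<bar>u x\<bar>)" using integrable_W0[OF m u D] by simp
      show "integrable lebesgue (\<lambda>x. t * indicator (ball 0 r) x + \<bar>u x\<bar> powr m / t powr (m - 1))"
        using W0D(3)[OF u] ind by simp
      fix x
      have "\<bar>u x\<bar> \<le> t * indicator (ball 0 r) x" if "\<bar>u x\<bar> \<le> t"
      proof (cases "x \<in> ball 0 r")
        case False
        then have "u x = 0" using r(2) W0D(2)[OF u] by blast
        then show ?thesis using t(1) by simp
      qed (use that in simp)
      moreover have "\<bar>u x\<bar> \<le> \<bar>u x\<bar> powr m / t powr (m - 1)" if "t < \<bar>u x\<bar>"
      proof -
        have "\<bar>u x\<bar> * t powr (m - 1) \<le> \<bar>u x\<bar> * \<bar>u x\<bar> powr (m - 1)"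
          using that t(1) m by (intro mult_left_mono powr_mono2) auto
        also have "\<dots> = \<bar>u x\<bar> powr m" using powr_pred_times[of "\<bar>u x\<bar>" m] by (simp add: mult.commute)
        finally show ?thesis using t(1) by (simp add: field_simps)
      qed
      moreover have "0 \<le> t * indicator (ball 0 r) x" "0 \<le> \<bar>u x\<bar> powr m / t powr (m - 1)"
        using t(1) by auto
      ultimately show "\<bar>u x\<bar> \<le> t * indicator (ball 0 r) x + \<bar>u x\<bar> powr m / t powr (m - 1)"
        by linarith
    qed
    also have "\<dots> = t * V + (\<integral>x. \<bar>u x\<bar> powr m \<partial>lebesgue) / t powr (m - 1)"
      using W0D(3)[OF u] ind by (simp add: V_def)
    also have "\<dots> \<le> t * V + P * frac_form s m u u / t powr (m - 1)"
      using poincare[OF u] by (intro add_left_mono divide_right_mono) auto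
    also have "P * frac_form s m u u / t powr (m - 1) = frac_form s m u u / (2 * m)"
      using P m unfolding t(2) by simp
    finally show ?thesis .
  qed
  then show ?thesis using that[of "t * V" P] poincare P t(1) V by auto
qed

lemma nn_integral_powr_fatou:
  fixes h :: "nat \<Rightarrow> 'a \<Rightarrow> real"
  assumes m: "0 < m" and [measurable]: "\<And>n. h n \<in> borel_measurable N"
    and int: "\<And>n. integrable N (\<lambda>x. \<bar>h n x\<bar> powr m)"
    and bnd: "\<And>n. (\<integral>x. \<bar>h n x\<bar> powr m \<partial>N) \<le> M n" and M: "M \<longlonglongrightarrow> M'"
    and conv: "AE x in N. (\<lambda>n. h n x) \<longlonglongrightarrow> k x"
  shows "(\<integral>\<^sup>+x. ennreal (\<bar>k x\<bar> powr m) \<partial>N) \<le> ennreal M'"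
proof -
  have "(\<integral>\<^sup>+x. ennreal (\<bar>k x\<bar> powr m) \<partial>N) = (\<integral>\<^sup>+x. liminf (\<lambda>n. ennreal (\<bar>h n x\<bar> powr m)) \<partial>N)"
  proof (rule nn_integral_cong_AE)
    show "AE x in N. ennreal (\<bar>k x\<bar> powr m) = liminf (\<lambda>n. ennreal (\<bar>h n x\<bar> powr m))"
      using conv
    proof eventually_elim
      fix x assume "(\<lambda>n. h n x) \<longlonglongrightarrow> k x"
      then have "(\<lambda>n. ennreal (\<bar>h n x\<bar> powr m)) \<longlonglongrightarrow> ennreal (\<bar>k x\<bar> powr m)"
        using m by (intro tendsto_ennrealI tendsto_powr2 tendsto_rabs tendsto_const) auto
      then show "ennreal (\<bar>k x\<bar> powr m) = liminf (\<lambda>n. ennreal (\<bar>h n x\<bar> powr m))"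
        by (rule lim_imp_Liminf[OF trivial_limit_sequentially, symmetric])
    qed
  qed
  also have "\<dots> \<le> liminf (\<lambda>n. \<integral>\<^sup>+x. ennreal (\<bar>h n x\<bar> powr m) \<partial>N)"
    by (rule nn_integral_liminf) measurable
  also have "\<dots> \<le> liminf (\<lambda>n. ennreal (M n))"
    using bnd by (intro Liminf_mono always_eventually allI)
      (subst nn_integral_eq_integral[OF int]; simp add: ennreal_leI)
  also have "\<dots> = ennreal (M')"
    by (intro lim_imp_Liminf tendsto_ennrealI M) simp
  finally show ?thesis .
qed

text \<open>Lower semicontinuity of the energy under convergence almost everywhere. Bounded energies also bound
  the \<open>L\<^sup>m\<close> norms by coercivity, hence the limit stays in the space.\<close>

lemma W0_fatou:
  fixes f :: "nat \<Rightarrow> 'a::euclidean_space \<Rightarrow> real"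
  assumes s: "0 < s" and m: "1 < m" and D: "bounded D"
    and f: "\<And>n. f n \<in> W0 s m D" and le: "\<And>n. frac_form s m (f n) (f n) \<le> M n" and M: "M \<longlonglongrightarrow> M'"
    and lim: "AE x in lebesgue. (\<lambda>n. f n x) \<longlonglongrightarrow> g x"
    and g: "g \<in> borel_measurable lebesgue" "\<And>x. x \<notin> D \<Longrightarrow> g x = 0"
  shows "g \<in> W0 s m D" and "frac_form s m g g \<le> M'"
proof -
  note [measurable] = W0D(1)[OF f] g(1)
  obtain K P where P: "0 \<le> P"
    "\<And>u. u \<in> W0 s m D \<Longrightarrow> (\<integral>x. \<bar>u x\<bar> powr m \<partial>lebesgue) \<le> P * frac_form s m u u"
    using torsion_energy_coercive[OF s m D] by metis
  have M0: "0 \<le> M n" for n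
    using order_trans[OF _ le[of n]] by (simp add: frac_form_self[OF W0D(1)[OF f]])
  then have M': "0 \<le> M'" using M by (intro LIMSEQ_le_const) auto
  have bound1: "(\<integral>\<^sup>+x. ennreal (\<bar>g x\<bar> powr m) \<partial>lebesgue) \<le> ennreal (P * M')"
  proof (rule nn_integral_powr_fatou[OF _ W0D(1)[OF f] W0D(3)[OF f] _ _ lim])
    show "(\<lambda>n. P * M n) \<longlonglongrightarrow> P * M'" by (intro tendsto_intros M)
    show "(\<integral>x. \<bar>f n x\<bar> powr m \<partial>lebesgue) \<le> P * M n" for n
      using order_trans[OF P(2)[OF f[of n]] mult_left_mono[OF le P(1)]] .
  qed (use m in simp)
  have bound2: "(\<integral>\<^sup>+z. ennreal (\<bar>incr g z\<bar> powr m) \<partial>gagliardo s m) \<le> ennreal M'"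
  proof (rule nn_integral_powr_fatou[OF _ _ W0D(4)[OF f] _ M])
    show "0 < m" using m by simp
    show "incr (f n) \<in> borel_measurable (gagliardo s m)" for n by measurable
    show "(\<integral>z. \<bar>incr (f n) z\<bar> powr m \<partial>gagliardo s m) \<le> M n" for n
      using le[of n] by (simp add: frac_form_self)
    show "AE z in gagliardo s m. (\<lambda>n. incr (f n) z) \<longlonglongrightarrow> incr g z"
      using AE_gagliardo[OF lim] by eventually_elim (auto simp: incr_def intro: tendsto_diff)
  qed
  show gW: "g \<in> W0 s m D"
    unfolding W0_iff using bound1 bound2 g
    by (auto intro!: integrableI_bounded simp: le_less_trans[OF _ ennreal_less_top])
  have "ennreal (frac_form s m g g) = (\<integral>\<^sup>+z. ennreal (\<bar>incr g z\<bar> powr m) \<partial>gagliardo s m)"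
    using W0D(4)[OF gW] by (simp add: frac_form_self nn_integral_eq_integral)
  also note bound2
  finally show "frac_form s m g g \<le> M'" using M' by simp
qed

text \<open>The maximum of two almost minimizers is again an almost minimizer, because the minimum cannot have
  energy below the infimum.\<close>

lemma torsion_energy_submodular:
  fixes u v :: "'a::euclidean_space \<Rightarrow> real"
  assumes m: "1 < m" and D: "bounded D" and u: "u \<in> W0 s m D" and v: "v \<in> W0 s m D"
  shows "torsion_energy s m (\<lambda>x. max (u x) (v x)) + torsion_energy s m (\<lambda>x. min (u x) (v x))
    \<le> torsion_energy s m u + torsion_energy s m v"
proof -
  let ?a = "\<lambda>x. max (u x) (v x)" and ?b = "\<lambda>x. min (u x) (v x)"
  have a: "?a \<in> W0 s m D" and b: "?b \<in> W0 s m D" using W0_max_min[OF _ u v] m by auto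
  note int = integrable_W0[OF m _ D]
  have "frac_form s m ?a ?a + frac_form s m ?b ?b
      = (\<integral>z. \<bar>incr ?a z\<bar> powr m + \<bar>incr ?b z\<bar> powr m \<partial>gagliardo s m)"
    using W0D(4)[OF a] W0D(4)[OF b] by (simp add: frac_form_self W0D(1)[OF a] W0D(1)[OF b])
  also have "\<dots> \<le> (\<integral>z. \<bar>incr u z\<bar> powr m + \<bar>incr v z\<bar> powr m \<partial>gagliardo s m)"
  proof (rule integral_mono)
    show "\<bar>incr ?a z\<bar> powr m + \<bar>incr ?b z\<bar> powr m \<le> \<bar>incr u z\<bar> powr m + \<bar>incr v z\<bar> powr m" for z
      unfolding incr_def by (rule abs_powr_max_min_diff[OF m])
  qed (use W0D(4)[OF a] W0D(4)[OF b] W0D(4)[OF u] W0D(4)[OF v] in auto)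
  also have "\<dots> = frac_form s m u u + frac_form s m v v"
    using W0D(4)[OF u] W0D(4)[OF v] by (simp add: frac_form_self W0D(1)[OF u] W0D(1)[OF v])
  finally have "(frac_form s m ?a ?a + frac_form s m ?b ?b) / m \<le> (frac_form s m u u + frac_form s m v v) / m"
    using m by (simp add: divide_right_mono)
  moreover have "(\<integral>x. ?a x \<partial>lebesgue) + (\<integral>x. ?b x \<partial>lebesgue) = (\<integral>x. u x \<partial>lebesgue) + (\<integral>x. v x \<partial>lebesgue)"
  proof -
    have "(\<integral>x. ?a x \<partial>lebesgue) + (\<integral>x. ?b x \<partial>lebesgue) = (\<integral>x. ?a x + ?b x \<partial>lebesgue)"
      by (rule Bochner_Integration.integral_add[symmetric]) (use int[OF a] int[OF b] in auto)
    also have "\<dots> = (\<integral>x. u x + v x \<partial>lebesgue)"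
      by (intro Bochner_Integration.integral_cong) (auto simp: max_def min_def)
    also have "\<dots> = (\<integral>x. u x \<partial>lebesgue) + (\<integral>x. v x \<partial>lebesgue)"
      by (rule Bochner_Integration.integral_add) (use int[OF u] int[OF v] in auto)
    finally show ?thesis .
  qed
  ultimately show ?thesis unfolding torsion_energy_def by (simp add: add_divide_distrib)
qed

text \<open>Take nonnegative \<open>u n\<close> whose energy exceeds the infimum \<open>I\<close> by at most \<open>2\<^bsup>-n\<^esup>\<close>. By submodularity the
  maximum of \<open>u k, \<dots>, u (k + l)\<close> exceeds it by at most \<open>2 * 2\<^bsup>-k\<^esup>\<close>, uniformly in \<open>l\<close>. The limit for
  \<open>l \<rightarrow> \<infinity>\<close> is monotone, and so is the subsequent limit for \<open>k \<rightarrow> \<infinity>\<close>. Thus the limes superior of the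
  \<open>u n\<close> is a minimizer.\<close>

lemma torsion_exists:
  fixes D :: "'a::euclidean_space set"
  assumes s: "0 < s" and m: "1 < m" and D: "D \<in> sets lebesgue" "bounded D"
  shows "\<exists>w. weak_solution s m D (\<lambda>_. 1) w"
proof -
  let ?J = "torsion_energy s m :: ('a \<Rightarrow> real) \<Rightarrow> real"
  let ?E = "\<lambda>u :: 'a \<Rightarrow> real. frac_form s m u u"
  obtain K P where K: "0 \<le> K" and K_le:
    "\<And>u. u \<in> W0 s m D \<Longrightarrow> (\<integral>x. \<bar>u x\<bar> \<partial>lebesgue) \<le> K + ?E u / (2 * m)"
    using torsion_energy_coercive[OF s m D(2)] by metis
  have E0: "0 \<le> ?E u" if "u \<in> W0 s m D" for u
    by (simp add: frac_form_self[OF W0D(1)[OF that]])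
  have int: "integrable lebesgue u" if "u \<in> W0 s m D" for u using integrable_W0[OF m that D(2)] .
  have int_le: "(\<integral>x. u x \<partial>lebesgue) \<le> (\<integral>x. \<bar>u x\<bar> \<partial>lebesgue)" if "u \<in> W0 s m D" for u
    using int[OF that] by (intro integral_mono) auto
  have E_le: "?E u \<le> 2 * m * (?J u + K)" if u: "u \<in> W0 s m D" for u
  proof -
    have "?E u / m - (K + ?E u / (2 * m)) \<le> ?J u"
      using K_le[OF u] int_le[OF u] unfolding torsion_energy_def by linarith
    then show ?thesis using m by (simp add: field_simps)
  qed
  define I where "I = Inf (?J ` W0 s m D)"
  have bdd: "bdd_below (?J ` W0 s m D)"
  proof (rule bdd_belowI[of _ "- K"])
    fix y assume "y \<in> ?J ` W0 s m D"
    then obtain u where u: "u \<in> W0 s m D" "y = ?J u" by auto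
    have "0 \<le> 2 * m * (?J u + K)" using E_le[OF u(1)] E0[OF u(1)] by linarith
    then show "- K \<le> y" using m u(2) by (simp add: zero_le_mult_iff)
  qed
  have I_le: "I \<le> ?J u" if "u \<in> W0 s m D" for u
    unfolding I_def using that bdd by (intro cInf_lower) auto
  have "\<exists>v\<in>W0 s m D. (\<forall>x. 0 \<le> v x) \<and> ?J v \<le> I + (1 / 2) ^ n" for n :: nat
  proof -
    have "Inf (?J ` W0 s m D) < I + (1 / 2) ^ n" by (simp add: I_def)
    then obtain v where v: "v \<in> W0 s m D" "?J v < I + (1 / 2) ^ n"
      using cInf_lessD[of "?J ` W0 s m D"] zero_in_W0[of s m D] by blast
    note [measurable] = W0D(1)[OF v(1)]
    have av: "(\<lambda>x. \<bar>v x\<bar>) \<in> W0 s m D"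
      using m by (intro W0_contraction[OF _ v(1)]) auto
    have "?E (\<lambda>x. \<bar>v x\<bar>) \<le> ?E v"
      unfolding frac_form_self[OF W0D(1)[OF v(1)]] frac_form_self[OF W0D(1)[OF av]]
    proof (rule integral_mono)
      show "\<bar>incr (\<lambda>x. \<bar>v x\<bar>) z\<bar> powr m \<le> \<bar>incr v z\<bar> powr m" for z
        using m by (intro powr_mono2) (auto simp: incr_def)
    qed (use W0D(4)[OF v(1)] W0D(4)[OF av] in auto)
    then have "?E (\<lambda>x. \<bar>v x\<bar>) / m \<le> ?E v / m" using m by (simp add: divide_right_mono)
    then have "?J (\<lambda>x. \<bar>v x\<bar>) \<le> ?J v"
      unfolding torsion_energy_def using int_le[OF v(1)] by linarith
    with v(2) av show ?thesis by (intro bexI[of _ "\<lambda>x. \<bar>v x\<bar>"]) auto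
  qed
  then obtain u where u: "\<And>n. u n \<in> W0 s m D" "\<And>n x. 0 \<le> u n x" "\<And>n. ?J (u n) \<le> I + (1 / 2) ^ n"
    by metis
  \<comment> \<open>\<open>g k l\<close> is the maximum of \<open>u k, \<dots>, u (k + l)\<close>.\<close>
  define g where "g k l = rec_nat (u k) (\<lambda>l f x. max (f x) (u (k + Suc l) x)) l" for k l
  have g_0: "g k 0 = u k" and g_Suc: "g k (Suc l) = (\<lambda>x. max (g k l x) (u (k + Suc l) x))" for k l
    by (auto simp: g_def)
  have gW: "g k l \<in> W0 s m D" for k l
    by (induction l) (use m u(1) in \<open>auto simp: g_0 g_Suc intro: W0_max_min\<close>)
  have g_nonneg: "0 \<le> g k l x" for k l x
    by (induction l) (use u(2) in \<open>auto simp: g_0 g_Suc le_max_iff_disj\<close>)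
  have g_mono: "g k l x \<le> g k (Suc l) x" for k l x by (simp add: g_Suc)
  have g_shift: "g (Suc k) l x \<le> g k (Suc l) x" for k l x
    by (induction l) (auto simp: g_0 g_Suc le_max_iff_disj)
  have Jg: "?J (g k l) \<le> I + 2 * (1 / 2) ^ k" for k l
  proof -
    have "?J (g k l) \<le> I + 2 * (1 / 2) ^ k - (1 / 2) ^ (k + l)"
    proof (induction l)
      case 0
      then show ?case using u(3)[of k] by (simp add: g_0)
    next
      case (Suc l)
      have "I \<le> ?J (\<lambda>x. min (g k l x) (u (k + Suc l) x))"
        using W0_max_min(2)[OF _ gW u(1)] m by (intro I_le) auto
      then have "?J (g k (Suc l)) \<le> ?J (g k l) + ?J (u (k + Suc l)) - I"
        using torsion_energy_submodular[OF m D(2) gW[of k l] u(1)[of "k + Suc l"]]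
        unfolding g_Suc by linarith
      also have "\<dots> \<le> I + 2 * (1 / 2) ^ k - (1 / 2) ^ (k + l) + (1 / 2) ^ (k + Suc l)"
        using Suc u(3)[of "k + Suc l"] by linarith
      also have "\<dots> = I + 2 * (1 / 2) ^ k - (1 / 2) ^ (k + Suc l)" by simp
      finally show ?case .
    qed
    then show ?thesis using zero_le_power[of "1 / 2 :: real" "k + l"] by linarith
  qed
  define C where "C = 2 * m * (I + 2 + K)"
  have Eg: "?E (g k l) \<le> C" for k l
  proof -
    have "(1 / 2 :: real) ^ k \<le> 1" by (simp add: power_le_one)
    then have "?J (g k l) \<le> I + 2" using Jg[of k l] by linarith
    then have "2 * m * (?J (g k l) + K) \<le> C" unfolding C_def using m by (intro mult_left_mono) auto
    then show ?thesis using E_le[OF gW] order_trans by blast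
  qed
  \<comment> \<open>The supremum is taken in the extended reals, since it is finite almost everywhere only.\<close>
  define X where "X k x = (SUP l. ennreal (g k l x))" for k x
  have g_meas [measurable]: "g k l \<in> borel_measurable lebesgue" for k l using W0D(1)[OF gW] .
  have X_meas [measurable]: "X k \<in> borel_measurable lebesgue" for k unfolding X_def by measurable
  have incg: "incseq (\<lambda>l. ennreal (g k l x))" for k x
    using g_mono by (intro incseq_SucI ennreal_leI) auto
  have X_fin: "AE x in lebesgue. X k x \<noteq> \<infinity>" for k
  proof (rule nn_integral_PInf_AE)
    have "(\<integral>\<^sup>+x. X k x \<partial>lebesgue) = (SUP l. \<integral>\<^sup>+x. ennreal (g k l x) \<partial>lebesgue)"
      unfolding X_def using g_mono
      by (intro nn_integral_monotone_convergence_SUP) (auto intro!: incseq_SucI le_funI ennreal_leI)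
    also have "\<dots> \<le> ennreal (K + C / (2 * m))"
    proof (rule SUP_least)
      fix l
      have "(\<integral>x. g k l x \<partial>lebesgue) \<le> K + ?E (g k l) / (2 * m)"
        using K_le[OF gW] int_le[OF gW] order_trans by blast
      also have "\<dots> \<le> K + C / (2 * m)" using Eg m by (intro add_left_mono divide_right_mono) auto
      finally show "(\<integral>\<^sup>+x. ennreal (g k l x) \<partial>lebesgue) \<le> ennreal (K + C / (2 * m))"
        using int[OF gW] g_nonneg by (simp add: nn_integral_eq_integral ennreal_leI)
    qed
    finally show "(\<integral>\<^sup>+x. X k x \<partial>lebesgue) \<noteq> \<infinity>" by (auto simp: top_unique)
  qed simp
  have X_dec: "X (Suc k) x \<le> X k x" for k x
    unfolding X_def using g_shift by (intro SUP_mono) (blast intro: ennreal_leI)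
  have X0: "X k x = 0" if "x \<notin> D" for k x
    unfolding X_def using W0D(2)[OF gW that] by simp
  define v where "v k x = enn2real (X k x)" for k x
  have v_lim: "AE x in lebesgue. (\<lambda>l. g k l x) \<longlonglongrightarrow> v k x" for k
    using X_fin[of k]
  proof eventually_elim
    fix x assume "X k x \<noteq> \<infinity>"
    moreover have "(\<lambda>l. ennreal (g k l x)) \<longlonglongrightarrow> X k x" unfolding X_def by (rule LIMSEQ_SUP[OF incg])
    ultimately have "(\<lambda>l. enn2real (ennreal (g k l x))) \<longlonglongrightarrow> enn2real (X k x)"
      by (intro tendsto_enn2real) (simp_all add: less_top)
    then show "(\<lambda>l. g k l x) \<longlonglongrightarrow> v k x" using g_nonneg by (simp add: v_def)
  qed
  have v_meas [measurable]: "v k \<in> borel_measurable lebesgue" for k unfolding v_def by measurable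
  have v0: "v k x = 0" if "x \<notin> D" for k x using X0[OF that] by (simp add: v_def)
  have vW: "v k \<in> W0 s m D" for k
    by (rule W0_fatou(1)[OF s m D(2) gW Eg tendsto_const v_lim v_meas v0])
  have Ev: "?E (v k) \<le> m * (I + 2 * (1 / 2) ^ k + (\<integral>x. v k x \<partial>lebesgue))" for k
  proof (rule W0_fatou(2)[OF s m D(2) gW _ tendsto_const v_lim v_meas v0])
    fix l
    have "AE x in lebesgue. g k l x \<le> v k x"
      using X_fin[of k]
    proof eventually_elim
      fix x assume "X k x \<noteq> \<infinity>"
      moreover have "ennreal (g k l x) \<le> X k x" unfolding X_def by (rule SUP_upper) simp
      ultimately have "enn2real (ennreal (g k l x)) \<le> enn2real (X k x)"
        by (intro enn2real_mono) (auto simp: less_top)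
      then show "g k l x \<le> v k x" using g_nonneg by (simp add: v_def)
    qed
    then have "(\<integral>x. g k l x \<partial>lebesgue) \<le> (\<integral>x. v k x \<partial>lebesgue)"
      using int[OF gW] int[OF vW] by (intro integral_mono_AE)
    then have "?E (g k l) / m \<le> I + 2 * (1 / 2) ^ k + (\<integral>x. v k x \<partial>lebesgue)"
      using Jg[of k l] unfolding torsion_energy_def by linarith
    then show "?E (g k l) \<le> m * (I + 2 * (1 / 2) ^ k + (\<integral>x. v k x \<partial>lebesgue))"
      using m by (simp add: field_simps)
  qed
  \<comment> \<open>the limes superior of the minimizing sequence\<close>
  define w where "w x = enn2real (INF k. X k x)" for x
  have w_meas [measurable]: "w \<in> borel_measurable lebesgue" unfolding w_def by measurable
  have w0: "w x = 0" if "x \<notin> D" for x using X0[OF that] by (simp add: w_def)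
  have X_anti: "decseq (\<lambda>k. X k x)" for x using X_dec by (rule decseq_SucI)
  have w_lim: "AE x in lebesgue. (\<lambda>k. v k x) \<longlonglongrightarrow> w x"
    using X_fin[of 0]
  proof eventually_elim
    fix x assume "X 0 x \<noteq> \<infinity>"
    moreover have "(INF k. X k x) \<le> X 0 x" by (rule INF_lower) simp
    ultimately have fin: "(INF k. X k x) < top" by (auto simp: top_unique less_top)
    have "(\<lambda>k. X k x) \<longlonglongrightarrow> (INF k. X k x)" by (rule LIMSEQ_INF[OF X_anti])
    then show "(\<lambda>k. v k x) \<longlonglongrightarrow> w x"
      unfolding v_def w_def
      by (intro tendsto_enn2real) (simp_all only: ennreal_enn2real[OF fin] enn2real_nonneg)
  qed
  have int_lim: "(\<lambda>k. \<integral>x. v k x \<partial>lebesgue) \<longlonglongrightarrow> (\<integral>x. w x \<partial>lebesgue)"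
  proof (rule integral_dominated_convergence[OF w_meas v_meas int[OF vW[of 0]] w_lim])
    fix k
    show "AE x in lebesgue. norm (v k x) \<le> v 0 x"
      using X_fin[of 0]
    proof eventually_elim
      fix x assume "X 0 x \<noteq> \<infinity>"
      then have "enn2real (X k x) \<le> enn2real (X 0 x)"
        using decseqD[OF X_anti, of 0 k] by (intro enn2real_mono) (auto simp: less_top)
      then show "norm (v k x) \<le> v 0 x" by (simp add: v_def)
    qed
  qed
  have M_lim: "(\<lambda>k. m * (I + 2 * (1 / 2) ^ k + (\<integral>x. v k x \<partial>lebesgue)))
      \<longlonglongrightarrow> m * (I + 2 * 0 + (\<integral>x. w x \<partial>lebesgue))"
    by (intro tendsto_intros int_lim LIMSEQ_power_zero) simp
  have wW: "w \<in> W0 s m D"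
    by (rule W0_fatou(1)[OF s m D(2) vW Ev M_lim w_lim w_meas w0])
  have "?E w \<le> m * (I + 2 * 0 + (\<integral>x. w x \<partial>lebesgue))"
    by (rule W0_fatou(2)[OF s m D(2) vW Ev M_lim w_lim w_meas w0])
  then have "?J w \<le> I" unfolding torsion_energy_def using m by (simp add: field_simps)
  then have "weak_solution s m D (\<lambda>_. 1) w"
    using I_le order_trans by (intro torsion_energy_minimizer[OF m D wW]) blast
  then show ?thesis by blast
qed

section \<open>Integrability and boundedness of solutions of the system\<close>

text \<open>Membership in the weak Lebesgue space with exponent \<open>\<kappa>\<close>. Levels below \<open>1\<close> are irrelevant on a bounded
  domain, and with this restriction the condition becomes stronger as \<open>\<kappa>\<close> grows.\<close>

definition weak_Lp :: "real \<Rightarrow> ('a::euclidean_space \<Rightarrow> real) \<Rightarrow> bool" where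
  "weak_Lp \<kappa> u \<longleftrightarrow> (\<exists>C. \<forall>k\<ge>1. measure lebesgue {x. k < u x} \<le> C * k powr (- \<kappa>))"

lemma weak_LpE:
  assumes "weak_Lp \<kappa> u"
  obtains C where "0 \<le> C" "\<And>k. 1 \<le> k \<Longrightarrow> measure lebesgue {x. k < u x} \<le> C * k powr (- \<kappa>)"
proof -
  obtain C where C: "\<And>k. 1 \<le> k \<Longrightarrow> measure lebesgue {x. k < u x} \<le> C * k powr (- \<kappa>)"
    using assms unfolding weak_Lp_def by blast
  moreover have "0 \<le> C"
    using order_trans[OF measure_nonneg C[of 1]] by simp
  ultimately show ?thesis using that by blast
qed

lemma weak_Lp_mono:
  assumes "weak_Lp \<kappa> u" "\<kappa>' \<le> \<kappa>" shows "weak_Lp \<kappa>' u"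
proof -
  obtain C where C: "0 \<le> C" "\<And>k. 1 \<le> k \<Longrightarrow> measure lebesgue {x. k < u x} \<le> C * k powr (- \<kappa>)"
    using assms(1) by (rule weak_LpE) blast
  have "measure lebesgue {x. k < u x} \<le> C * k powr (- \<kappa>')" if "1 \<le> k" for k
    using C(2)[OF that] by (rule order_trans) (use C(1) that assms(2) in \<open>auto intro!: mult_left_mono powr_mono\<close>)
  then show ?thesis unfolding weak_Lp_def by blast
qed

lemma weak_Lp_max:
  assumes "weak_Lp \<kappa> u" "weak_Lp \<kappa> v"
    and "u \<in> borel_measurable lebesgue" "v \<in> borel_measurable lebesgue"
    and "\<And>x. x \<notin> D \<Longrightarrow> u x = 0" "\<And>x. x \<notin> D \<Longrightarrow> v x = 0" "bounded D"
  shows "weak_Lp \<kappa> (\<lambda>x. max (u x) (v x))"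
proof -
  obtain C where C: "0 \<le> C" "\<And>k. 1 \<le> k \<Longrightarrow> measure lebesgue {x. k < u x} \<le> C * k powr (- \<kappa>)"
    using assms(1) by (rule weak_LpE) blast
  obtain C' where C': "0 \<le> C'" "\<And>k. 1 \<le> k \<Longrightarrow> measure lebesgue {x. k < v x} \<le> C' * k powr (- \<kappa>)"
    using assms(2) by (rule weak_LpE) blast
  have "measure lebesgue {x. k < max (u x) (v x)} \<le> (C + C') * k powr (- \<kappa>)" if k: "1 \<le> k" for k
  proof -
    have *: "{x. k < u x} \<in> lmeasurable" "{x. k < v x} \<in> lmeasurable"
      using assms(3-7) k by (intro lmeasurable_superlevel[where D = D]; simp)+
    have "{x. k < max (u x) (v x)} = {x. k < u x} \<union> {x. k < v x}" by (auto simp: less_max_iff_disj)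
    then have "measure lebesgue {x. k < max (u x) (v x)} \<le> measure lebesgue {x. k < u x} + measure lebesgue {x. k < v x}"
      using * by (simp add: measure_Un_le fmeasurableD)
    also have "\<dots> \<le> C * k powr (- \<kappa>) + C' * k powr (- \<kappa>)" using C C' k by (intro add_mono) auto
    finally show ?thesis by (simp add: algebra_simps)
  qed
  then show ?thesis unfolding weak_Lp_def by blast
qed

lemma weak_Lp_powr:
  assumes "weak_Lp \<kappa> u" "0 < \<rho>" "\<And>x. 0 \<le> u x"
  shows "weak_Lp (\<kappa> / \<rho>) (\<lambda>x. u x powr \<rho>)"
proof -
  obtain C where C: "0 \<le> C" "\<And>k. 1 \<le> k \<Longrightarrow> measure lebesgue {x. k < u x} \<le> C * k powr (- \<kappa>)"
    using assms(1) by (rule weak_LpE) blast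
  have "measure lebesgue {x. k < u x powr \<rho>} \<le> C * k powr (- (\<kappa> / \<rho>))" if k: "1 \<le> k" for k
  proof -
    have "k < y powr \<rho> \<longleftrightarrow> k powr (1 / \<rho>) < y" if y: "0 \<le> y" for y
    proof
      assume "k < y powr \<rho>"
      then have "k powr (1 / \<rho>) < (y powr \<rho>) powr (1 / \<rho>)" using k assms(2) by (intro powr_less_mono2) auto
      then show "k powr (1 / \<rho>) < y" using y assms(2) by (simp add: powr_powr)
    next
      assume "k powr (1 / \<rho>) < y"
      then have "(k powr (1 / \<rho>)) powr \<rho> < y powr \<rho>" using assms(2) by (intro powr_less_mono2) auto
      then show "k < y powr \<rho>" using k assms(2) by (simp add: powr_powr)
    qed
    then have set_eq: "{x. k < u x powr \<rho>} = {x. k powr (1 / \<rho>) < u x}" using assms(3) by blast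
    have "1 \<le> k powr (1 / \<rho>)" using k assms(2) by (intro ge_one_powr_ge_zero) auto
    then have "measure lebesgue {x. k < u x powr \<rho>} \<le> C * (k powr (1 / \<rho>)) powr (- \<kappa>)"
      unfolding set_eq by (rule C(2))
    also have "(k powr (1 / \<rho>)) powr (- \<kappa>) = k powr (- (\<kappa> / \<rho>))" unfolding powr_powr by simp
    finally show ?thesis .
  qed
  then show ?thesis unfolding weak_Lp_def by blast
qed

lemma weak_Lp_Chebyshev:
  fixes u :: "'a::euclidean_space \<Rightarrow> real"
  assumes u: "u \<in> W0 s m D" and D: "bounded D" and m: "0 < m"
  shows "weak_Lp m u"
  unfolding weak_Lp_def
proof (intro exI allI impI)
  fix k :: real assume k: "1 \<le> k"
  have A: "{x. k < u x} \<in> lmeasurable"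
    using W0D(1)[OF u] W0D(2)[OF u] D k by (intro lmeasurable_superlevel[where D = D]) auto
  have "k powr m * measure lebesgue {x. k < u x} = (\<integral>x. k powr m * indicator {x. k < u x} x \<partial>lebesgue)"
    using A by simp
  also have "\<dots> \<le> (\<integral>x. \<bar>u x\<bar> powr m \<partial>lebesgue)"
  proof (rule integral_mono)
    show "integrable lebesgue (\<lambda>x. k powr m * indicator {x. k < u x} x)"
      using A by (auto simp: fmeasurable_def)
    show "k powr m * indicator {x. k < u x} x \<le> \<bar>u x\<bar> powr m" for x
      using k m by (auto simp: indicator_def intro!: powr_mono2)
  qed (rule W0D(3)[OF u])
  finally show "measure lebesgue {x. k < u x} \<le> (\<integral>x. \<bar>u x\<bar> powr m \<partial>lebesgue) * k powr (- m)"
    using k by (simp add: powr_minus field_simps)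
qed

lemma le_suminf_ennreal: "f j \<le> (\<Sum>j. f j)" for f :: "nat \<Rightarrow> ennreal"
  using sum_le_suminf[OF summableI, of "{j}" f] by simp

text \<open>The integral of \<open>G\<^sup>e\<close> over \<open>{2\<^sup>j k < G \<le> 2\<^bsup>j+1\<^esup> k}\<close> is at most a constant times
  \<open>(2\<^sup>j k)\<^bsup>e - \<kappa>\<^esup>\<close>, and these terms form a convergent geometric series because \<open>e < \<kappa>\<close>.\<close>

lemma weak_Lp_tail:
  fixes G :: "'a::euclidean_space \<Rightarrow> real"
  assumes G: "weak_Lp \<kappa> G" "G \<in> borel_measurable lebesgue" "\<And>x. x \<notin> D \<Longrightarrow> G x = 0" "bounded D"
    and e: "0 < e" "e < \<kappa>"
  obtains C where "0 \<le> C"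
    "\<And>k. 1 \<le> k \<Longrightarrow> (\<integral>\<^sup>+x. ennreal (G x powr e) * indicator {x. k < G x} x \<partial>lebesgue)
      \<le> ennreal (C * k powr (e - \<kappa>))"
proof -
  note [measurable] = G(2)
  obtain C where C: "0 \<le> C" "\<And>k. 1 \<le> k \<Longrightarrow> measure lebesgue {x. k < G x} \<le> C * k powr (- \<kappa>)"
    using G(1) by (rule weak_LpE) blast
  define q where "q = 2 powr (e - \<kappa>)"
  have "2 powr (e - \<kappa>) < 2 powr (0 :: real)" using e by (intro powr_less_mono) auto
  then have q: "0 < q" "q < 1" by (auto simp: q_def)
  have "(\<integral>\<^sup>+x. ennreal (G x powr e) * indicator {x. k < G x} x \<partial>lebesgue)
      \<le> ennreal (C * 2 powr e / (1 - q) * k powr (e - \<kappa>))" if k: "1 \<le> k" for k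
  proof -
    let ?A = "\<lambda>j. {x. 2 ^ j * k < G x}"
    have [measurable]: "?A j \<in> sets lebesgue" for j
      using borel_measurable_iff_greater[of G lebesgue] G(2) by simp
    have pow1: "1 \<le> 2 ^ j * k" for j :: nat
    proof -
      have "1 * 1 \<le> 2 ^ j * k" using k by (intro mult_mono) auto
      then show ?thesis by simp
    qed
    \<comment> \<open>Dyadic decomposition of the range of \<open>G\<close> above \<open>k\<close>.\<close>
    have "ennreal (G x powr e) * indicator {x. k < G x} x
        \<le> (\<Sum>j. ennreal ((2 ^ Suc j * k) powr e) * indicator (?A j) x)" for x
    proof (cases "k < G x")
      case True
      define j where "j = (LEAST j. G x \<le> 2 ^ Suc j * k)"
      have "\<exists>j. G x \<le> 2 ^ Suc j * k"
      proof -
        obtain n where "G x / k < 2 ^ n" using real_arch_pow[of 2 "G x / k"] by auto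
        then have "G x \<le> 2 ^ n * k" using k by (simp add: field_simps)
        also have "\<dots> \<le> 2 ^ Suc n * k" using k by (intro mult_right_mono) auto
        finally show ?thesis by blast
      qed
      then have j1: "G x \<le> 2 ^ Suc j * k" unfolding j_def by (rule LeastI_ex)
      have j2: "2 ^ j * k < G x"
      proof (cases j)
        case (Suc i)
        then have "\<not> G x \<le> 2 ^ Suc i * k" using not_less_Least[of i "\<lambda>j. G x \<le> 2 ^ Suc j * k"] j_def by auto
        then show ?thesis using Suc by simp
      qed (use True in simp)
      have "ennreal (G x powr e) * indicator {x. k < G x} x \<le> ennreal ((2 ^ Suc j * k) powr e) * indicator (?A j) x"
        using True j1 j2 e k by (auto simp: indicator_def intro!: ennreal_leI powr_mono2 simp del: power_Suc)
      also have "\<dots> \<le> (\<Sum>j. ennreal ((2 ^ Suc j * k) powr e) * indicator (?A j) x)"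
        by (rule le_suminf_ennreal)
      finally show ?thesis .
    qed simp
    then have "(\<integral>\<^sup>+x. ennreal (G x powr e) * indicator {x. k < G x} x \<partial>lebesgue)
        \<le> (\<integral>\<^sup>+x. (\<Sum>j. ennreal ((2 ^ Suc j * k) powr e) * indicator (?A j) x) \<partial>lebesgue)"
      by (intro nn_integral_mono)
    also have "\<dots> = (\<Sum>j. \<integral>\<^sup>+x. ennreal ((2 ^ Suc j * k) powr e) * indicator (?A j) x \<partial>lebesgue)"
      by (rule nn_integral_suminf) measurable
    also have "\<dots> \<le> (\<Sum>j. ennreal (C * 2 powr e * k powr (e - \<kappa>) * q ^ j))"
    proof (intro suminf_le summableI)
      fix j
      have lm: "?A j \<in> lmeasurable"
        using G(2-4) pow1[of j] by (intro lmeasurable_superlevel[where D = D]) auto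
      have "(\<integral>\<^sup>+x. ennreal ((2 ^ Suc j * k) powr e) * indicator (?A j) x \<partial>lebesgue)
          = ennreal ((2 ^ Suc j * k) powr e) * emeasure lebesgue (?A j)"
        by (rule nn_integral_cmult_indicator) measurable
      also have "\<dots> = ennreal ((2 ^ Suc j * k) powr e * measure lebesgue (?A j))"
        using emeasure_eq_ennreal_measure[OF fmeasurableD2[OF lm]] by (simp add: ennreal_mult)
      also have "\<dots> \<le> ennreal ((2 ^ Suc j * k) powr e * (C * (2 ^ j * k) powr (- \<kappa>)))"
        using C(2)[OF pow1[of j]] by (intro ennreal_leI mult_left_mono) auto
      also have "(2 ^ Suc j * k) powr e * (C * (2 ^ j * k) powr (- \<kappa>)) = C * 2 powr e * k powr (e - \<kappa>) * q ^ j"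
      proof -
        have "(2 ^ Suc j * k) powr e = 2 powr e * (2 powr (real j * e) * k powr e)"
          using k by (simp add: powr_mult powr_powr flip: powr_realpow)
        moreover have "(2 ^ j * k) powr (- \<kappa>) = 2 powr (real j * (- \<kappa>)) * k powr (- \<kappa>)"
          using k by (simp add: powr_mult powr_powr flip: powr_realpow)
        moreover have "q ^ j = 2 powr (real j * e) * 2 powr (real j * (- \<kappa>))"
          unfolding q_def powr_add[symmetric] powr_realpow[OF powr_gt_zero[THEN iffD2], of 2, symmetric]
          by (simp add: powr_powr algebra_simps flip: powr_realpow)
        moreover have "k powr (e - \<kappa>) = k powr e * k powr (- \<kappa>)"
          by (simp flip: powr_add)
        ultimately show ?thesis by simp
      qed
      finally show "(\<integral>\<^sup>+x. ennreal ((2 ^ Suc j * k) powr e) * indicator (?A j) x \<partial>lebesgue)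
          \<le> ennreal (C * 2 powr e * k powr (e - \<kappa>) * q ^ j)" .
    qed
    also have "\<dots> = ennreal (\<Sum>j. C * 2 powr e * k powr (e - \<kappa>) * q ^ j)"
      using C(1) q by (intro suminf_ennreal2 summable_mult summable_geometric) auto
    also have "(\<Sum>j. C * 2 powr e * k powr (e - \<kappa>) * q ^ j) = C * 2 powr e * k powr (e - \<kappa>) * (1 / (1 - q))"
      using q by (subst suminf_mult) (auto simp: suminf_geometric summable_geometric)
    finally show ?thesis by (simp add: field_simps)
  qed
  moreover have "0 \<le> C * 2 powr e / (1 - q)" using C(1) q by simp
  ultimately show ?thesis using that by blast
qed

text \<open>Apply the estimate for superlevel sets with \<open>h = k\<close>. The tail of \<open>G\<^bsup>m-1\<^esup>\<close> already gives the decay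
  \<open>k\<^bsup>-\<kappa>\<^esup>\<close> for \<open>\<bar>{u > 2 k}\<bar>\<close>, and the Faber-Krahn factor \<open>\<bar>{u > k}\<bar>\<^bsup>s m / N\<^esup>\<close> improves the exponent.\<close>

lemma weak_Lp_gain:
  fixes u :: "'a::euclidean_space \<Rightarrow> real"
  assumes s: "0 < s" and m: "1 < m" and ws: "weak_solution s m D F u" and D: "bounded D" "D \<in> sets lebesgue"
    and F: "AE x in lebesgue_on D. F x \<le> A * G x powr (m - 1)" and A: "0 \<le> A"
    and G: "G \<in> borel_measurable lebesgue" "\<And>x. x \<notin> D \<Longrightarrow> G x = 0" "\<And>x. u x \<le> G x"
    and \<kappa>: "weak_Lp \<kappa> G" "m - 1 < \<kappa>"
  shows "weak_Lp (\<kappa> * (1 + s * m / DIM('a))) u"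
proof -
  define \<delta> where "\<delta> = s * m / DIM('a)"
  have \<delta>: "0 < \<delta>" using s m by (simp add: \<delta>_def)
  define \<kappa>' where "\<kappa>' = \<kappa> * (1 + \<delta>)"
  have \<kappa>': "0 < \<kappa>'" using \<delta> \<kappa>(2) m by (simp add: \<kappa>'_def)
  have u: "u \<in> W0 s m D" using ws by (simp add: weak_solution_def)
  note [measurable] = G(1)
  obtain C where C: "0 \<le> C" "\<And>k. 1 \<le> k \<Longrightarrow> (\<integral>\<^sup>+x. ennreal (G x powr (m - 1)) * indicator {x. k < G x} x \<partial>lebesgue)
      \<le> ennreal (C * k powr (m - 1 - \<kappa>))"
    using weak_Lp_tail[OF \<kappa>(1) G(1) G(2) D(1) _ \<kappa>(2)] m by auto
  obtain C' where C': "0 \<le> C'" "\<And>k. 1 \<le> k \<Longrightarrow> measure lebesgue {x. k < G x} \<le> C' * k powr (- \<kappa>)"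
    using \<kappa>(1) by (rule weak_LpE) blast
  define c where "c = faber_krahn_const TYPE('a) s m"
  have c: "0 < c" unfolding c_def by (rule faber_krahn_const_pos)
  have lm: "{x. k < u x} \<in> lmeasurable" "{x. k < G x} \<in> lmeasurable" if "0 \<le> k" for k
    using W0D(1)[OF u] W0D(2)[OF u] G D(1) that by (intro lmeasurable_superlevel[where D = D]; simp)+
  define B where "B = C' powr \<delta> * (A * C) / c"
  have B: "0 \<le> B" using A C(1) c by (simp add: B_def)
  have double: "measure lebesgue {x. 2 * k < u x} \<le> B * k powr (- \<kappa>')" if k: "1 \<le> k" for k
  proof -
    have tail: "(\<integral>\<^sup>+x. ennreal (A * G x powr (m - 1)) * indicator {x. k < u x} x \<partial>lebesgue)
        \<le> ennreal (A * C * k powr (m - 1 - \<kappa>))"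
    proof -
      have "(\<integral>\<^sup>+x. ennreal (A * G x powr (m - 1)) * indicator {x. k < u x} x \<partial>lebesgue)
          \<le> (\<integral>\<^sup>+x. ennreal A * (ennreal (G x powr (m - 1)) * indicator {x. k < G x} x) \<partial>lebesgue)"
        using G(3) A by (intro nn_integral_mono) (auto simp: indicator_def ennreal_mult intro: less_le_trans)
      also have "\<dots> = ennreal A * (\<integral>\<^sup>+x. ennreal (G x powr (m - 1)) * indicator {x. k < G x} x \<partial>lebesgue)"
        by (rule nn_integral_cmult) (use lm(2)[of k] k in measurable)
      also have "\<dots> \<le> ennreal A * ennreal (C * k powr (m - 1 - \<kappa>))"
        using C(2)[OF k] by (intro mult_left_mono) auto
      finally show ?thesis using A C(1) by (simp add: ennreal_mult[symmetric] mult.assoc)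
    qed
    have "c * k powr (m - 1) * measure lebesgue {x. k + k < u x}
        \<le> measure lebesgue {x. k < u x} powr \<delta> * (A * C * k powr (m - 1 - \<kappa>))"
      unfolding c_def \<delta>_def
      by (rule superlevel_estimate[OF s m ws D F _ _ _ _ _ tail]) (use A C(1) k in auto)
    also have "\<dots> \<le> (C' * k powr (- \<kappa>)) powr \<delta> * (A * C * k powr (m - 1 - \<kappa>))"
    proof -
      have "measure lebesgue {x. k < u x} \<le> measure lebesgue {x. k < G x}"
        using lm[of k] k G(3) by (intro measure_mono_fmeasurable) (auto intro: less_le_trans)
      also have "\<dots> \<le> C' * k powr (- \<kappa>)" by (rule C'(2)[OF k])
      finally show ?thesis
        using \<delta> A C(1) by (intro mult_right_mono powr_mono2) auto
    qed
    also have "\<dots> = c * k powr (m - 1) * (B * k powr (- \<kappa>'))"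
    proof -
      have "(C' * k powr (- \<kappa>)) powr \<delta> = C' powr \<delta> * k powr (- \<kappa> * \<delta>)"
        using C'(1) k by (simp add: powr_mult powr_powr)
      moreover have "k powr (- \<kappa> * \<delta>) * k powr (m - 1 - \<kappa>) = k powr (m - 1) * k powr (- \<kappa>')"
        unfolding powr_add[symmetric] by (simp add: \<kappa>'_def algebra_simps)
      ultimately have "(C' * k powr (- \<kappa>)) powr \<delta> * (A * C * k powr (m - 1 - \<kappa>))
          = (C' powr \<delta> * (A * C)) * (k powr (m - 1) * k powr (- \<kappa>'))"
        by (simp add: mult_ac)
      also have "\<dots> = c * k powr (m - 1) * (B * k powr (- \<kappa>'))"
        using c by (simp add: B_def mult_ac)
      finally show ?thesis .
    qed
    finally show ?thesis using c k by (simp add: mult.assoc)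
  qed
  \<comment> \<open>Levels between \<open>1\<close> and \<open>2\<close> are not of the form \<open>2 k\<close> and are covered by enlarging the constant.\<close>
  define M where "M = measure lebesgue {x. 1 < u x}"
  have "measure lebesgue {x. k < u x} \<le> (B + M) * 2 powr \<kappa>' * k powr (- \<kappa>')" if k: "1 \<le> k" for k
  proof (cases "2 \<le> k")
    case True
    have "measure lebesgue {x. k < u x} \<le> B * (k / 2) powr (- \<kappa>')"
      using double[of "k / 2"] True by simp
    also have "(k / 2) powr (- \<kappa>') = 2 powr \<kappa>' * k powr (- \<kappa>')"
      using k by (simp add: powr_divide powr_minus field_simps)
    also have "B * (2 powr \<kappa>' * k powr (- \<kappa>')) \<le> (B + M) * (2 powr \<kappa>' * k powr (- \<kappa>'))"
      by (intro mult_right_mono) (auto simp: M_def)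
    finally show ?thesis by (simp add: mult.assoc)
  next
    case False
    have "measure lebesgue {x. k < u x} \<le> M"
      unfolding M_def using lm[of k] lm[of 1] k by (intro measure_mono_fmeasurable) auto
    also have "M = M * 1" by simp
    also have "\<dots> \<le> (B + M) * (2 powr \<kappa>' * k powr (- \<kappa>'))"
    proof (rule mult_mono)
      have "k powr \<kappa>' \<le> 2 powr \<kappa>'" using False k \<kappa>' by (intro powr_mono2) auto
      then show "1 \<le> 2 powr \<kappa>' * k powr (- \<kappa>')" using k by (simp add: powr_minus field_simps)
    qed (use B in \<open>auto simp: M_def\<close>)
    finally show ?thesis by (simp add: mult.assoc)
  qed
  then show ?thesis unfolding weak_Lp_def \<kappa>'_def[symmetric, unfolded \<delta>_def] by blast
qed

text \<open>The right-hand side involves \<open>u\<close> itself, whose exponent is only known to be \<open>m\<close> at first. Repeated gains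
  raise it until it reaches the exponent \<open>\<kappa>\<close> of the other component \<open>V\<close>, and one last gain exceeds \<open>\<kappa>\<close>.\<close>

lemma weak_Lp_bootstrap:
  fixes u :: "'a::euclidean_space \<Rightarrow> real"
  assumes s: "0 < s" and m: "1 < m" and ws: "weak_solution s m D F u" and D: "bounded D" "D \<in> sets lebesgue"
    and F: "AE x in lebesgue_on D. F x \<le> A * max (u x) (V x) powr (m - 1)" and A: "0 \<le> A"
    and V: "V \<in> borel_measurable lebesgue" "\<And>x. x \<notin> D \<Longrightarrow> V x = 0"
    and \<kappa>: "weak_Lp \<kappa> V" "m - 1 < \<kappa>"
  shows "weak_Lp (\<kappa> * (1 + s * m / DIM('a))) u"
proof -
  have u: "u \<in> W0 s m D" using ws by (simp add: weak_solution_def)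
  note [measurable] = V(1) W0D(1)[OF u]
  define g where "g = 1 + s * m / DIM('a)"
  have g: "1 < g" using s m by (simp add: g_def)
  have gain: "weak_Lp (\<kappa>' * g) u" if "weak_Lp \<kappa>' u" "m - 1 < \<kappa>'" "\<kappa>' \<le> \<kappa>" for \<kappa>'
    unfolding g_def
  proof (rule weak_Lp_gain[OF s m ws D F A])
    show "weak_Lp \<kappa>' (\<lambda>x. max (u x) (V x))"
      using that \<kappa>(1) V W0D(1)[OF u] W0D(2)[OF u] D(1)
      by (intro weak_Lp_max[where D = D] weak_Lp_mono[OF \<kappa>(1)]) auto
  qed (use V(2) W0D(2)[OF u] that in auto)
  define \<kappa>0 where "\<kappa>0 = min m \<kappa>"
  have \<kappa>0: "m - 1 < \<kappa>0" "0 < \<kappa>0" using \<kappa>(2) m by (auto simp: \<kappa>0_def)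
  have step: "weak_Lp (min \<kappa> (\<kappa>0 * g ^ n)) u" for n
  proof (induction n)
    case 0
    have "weak_Lp m u" using weak_Lp_Chebyshev[OF u D(1)] m by simp
    then show ?case by (rule weak_Lp_mono) (simp add: \<kappa>0_def)
  next
    case (Suc n)
    have "1 \<le> g ^ n" using g by (simp add: one_le_power)
    then have "\<kappa>0 * 1 \<le> \<kappa>0 * g ^ n" using \<kappa>0 by (intro mult_left_mono) auto
    then have "m - 1 < \<kappa>0 * g ^ n" using \<kappa>0 by linarith
    then have "m - 1 < min \<kappa> (\<kappa>0 * g ^ n)" using \<kappa>(2) by simp
    then have "weak_Lp (min \<kappa> (\<kappa>0 * g ^ n) * g) u" using Suc by (intro gain) auto
    moreover have "min \<kappa> (\<kappa>0 * g ^ Suc n) \<le> min \<kappa> (\<kappa>0 * g ^ n) * g"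
    proof -
      have "\<kappa> * 1 \<le> \<kappa> * g" using g \<kappa>(2) m by (intro mult_left_mono) auto
      then have "min \<kappa> (\<kappa>0 * g ^ Suc n) \<le> \<kappa> * g" by (simp add: min_le_iff_disj)
      moreover have "min \<kappa> (\<kappa>0 * g ^ Suc n) \<le> \<kappa>0 * g ^ n * g"
        unfolding power_Suc2 mult.assoc by (rule min.cobounded2)
      ultimately show ?thesis by (cases "\<kappa> \<le> \<kappa>0 * g ^ n") (simp_all only: min.absorb1 min.absorb2 linear not_le less_imp_le)
    qed
    ultimately show ?case by (rule weak_Lp_mono)
  qed
  obtain n where "\<kappa> / \<kappa>0 < g ^ n" using real_arch_pow[OF g] by blast
  then have "\<kappa> \<le> \<kappa>0 * g ^ n" using \<kappa>0 by (simp add: field_simps)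
  then have "weak_Lp \<kappa> u" using step[of n] by (simp add: min_def)
  then show ?thesis using gain[of \<kappa>] \<kappa>(2) unfolding g_def by simp
qed

text \<open>When every exponent is available, splitting the integral of \<open>G\<^bsup>m-1\<^esup>\<close> over \<open>{u > k}\<close> at a height that
  depends on the measure of this set verifies Stampacchia's criterion with an exponent \<open>e\<close> as small as
  desired.\<close>

lemma bounded_above_of_weak_Lp:
  fixes u :: "'a::euclidean_space \<Rightarrow> real"
  assumes s: "0 < s" and m: "1 < m" and ws: "weak_solution s m D F u" and D: "bounded D" "D \<in> sets lebesgue"
    and F: "AE x in lebesgue_on D. F x \<le> A * G x powr (m - 1)" and A: "0 \<le> A"
    and G: "G \<in> borel_measurable lebesgue" "\<And>x. x \<notin> D \<Longrightarrow> G x = 0" "\<And>x. 0 \<le> G x"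
    and weak: "\<And>\<kappa>. weak_Lp \<kappa> G"
  shows "\<exists>K. AE x in lebesgue. u x \<le> K"
proof -
  define \<delta> where "\<delta> = s * m / DIM('a)"
  have \<delta>: "0 < \<delta>" using s m by (simp add: \<delta>_def)
  define e where "e = min (\<delta> / 2) (1 / 2)"
  have e: "0 < e" "e < \<delta>" "e < 1" using \<delta> by (auto simp: e_def)
  \<comment> \<open>For this exponent the tail estimate loses exactly the power \<open>e\<close>.\<close>
  define \<kappa> where "\<kappa> = (m - 1) / e"
  have \<kappa>_gt: "m - 1 < \<kappa>" and \<kappa>_e: "(m - 1) / \<kappa> = e" and \<kappa>0: "0 < \<kappa>"
  proof -
    have "(m - 1) * e < (m - 1) * 1" using e m by (intro mult_strict_left_mono) auto
    then show "m - 1 < \<kappa>" using e by (simp add: \<kappa>_def less_divide_eq)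
    show "(m - 1) / \<kappa> = e" "0 < \<kappa>" using e m by (auto simp: \<kappa>_def)
  qed
  have u: "u \<in> W0 s m D" using ws by (simp add: weak_solution_def)
  note [measurable] = G(1) W0D(1)[OF u]
  obtain C where C: "0 \<le> C" "\<And>k. 1 \<le> k \<Longrightarrow> (\<integral>\<^sup>+x. ennreal (G x powr (m - 1)) * indicator {x. k < G x} x \<partial>lebesgue)
      \<le> ennreal (C * k powr (m - 1 - \<kappa>))"
    using weak_Lp_tail[OF weak[of \<kappa>] G(1) G(2) D(1) _ \<kappa>_gt] m by auto
  \<comment> \<open>Dividing by an upper bound of all measures keeps the height \<open>\<tau>\<close> below at least \<open>1\<close>.\<close>
  define L where "L = measure lebesgue {x. 0 < u x} + 1"
  have lm: "{x. k < u x} \<in> lmeasurable" if "0 \<le> k" for k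
    using W0D(1)[OF u] W0D(2)[OF u] D(1) that by (intro lmeasurable_superlevel[where D = D]; simp)
  have L: "0 < L" unfolding L_def using measure_nonneg[of lebesgue "{x. 0 < u x}"] by linarith
  define B where "B = A * (L powr e + C * L powr (e - 1))"
  show ?thesis
  proof (rule weak_solution_bounded_above[OF s m ws D F])
    show "0 \<le> B" using A C(1) by (simp add: B_def)
    show "e < s * m / DIM('a)" using e(2) by (simp add: \<delta>_def)
    fix k :: real assume k: "0 \<le> k"
    let ?S = "{x. k < u x}"
    define V where "V = measure lebesgue ?S"
    have [measurable]: "?S \<in> sets lebesgue" using lm[OF k] by auto
    have emV: "emeasure lebesgue ?S = ennreal V"
      unfolding V_def using fmeasurableD2[OF lm[OF k]] by (rule emeasure_eq_ennreal_measure)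
    show "(\<integral>\<^sup>+x. ennreal (A * G x powr (m - 1)) * indicator ?S x \<partial>lebesgue) \<le> ennreal (B * measure lebesgue ?S powr (1 - e))"
    proof (cases "V = 0")
      case True
      then have "AE x in lebesgue. x \<notin> ?S" using emV by (intro AE_not_in) (auto simp: null_sets_def)
      then have "(\<integral>\<^sup>+x. ennreal (A * G x powr (m - 1)) * indicator ?S x \<partial>lebesgue) = (\<integral>\<^sup>+x. 0 \<partial>(lebesgue :: 'a measure))"
        by (intro nn_integral_cong_AE) (auto elim!: eventually_mono)
      then show ?thesis by simp
    next
      case False
      then have V: "0 < V" by (simp add: V_def zero_less_measure_iff)
      have "V \<le> L"
        unfolding V_def L_def using lm[OF k] lm[of 0] k
        by (intro order_trans[OF measure_mono_fmeasurable[of ?S "{x. 0 < u x}"]]) auto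
      \<comment> \<open>The threshold that balances the two contributions below.\<close>
      define \<tau> where "\<tau> = (L / V) powr (1 / \<kappa>)"
      have \<tau>: "1 \<le> \<tau>" unfolding \<tau>_def using \<open>V \<le> L\<close> V \<kappa>0 by (intro ge_one_powr_ge_zero) auto
      have [measurable]: "{x. \<tau> < G x} \<in> sets lebesgue"
        using borel_measurable_iff_greater[of G lebesgue] G(1) by simp
      have "(\<integral>\<^sup>+x. ennreal (G x powr (m - 1)) * indicator ?S x \<partial>lebesgue)
          \<le> (\<integral>\<^sup>+x. ennreal (\<tau> powr (m - 1)) * indicator ?S x + ennreal (G x powr (m - 1)) * indicator {x. \<tau> < G x} x \<partial>lebesgue)"
      proof (intro nn_integral_mono)
        fix x
        show "ennreal (G x powr (m - 1)) * indicator ?S x \<le> ennreal (\<tau> powr (m - 1)) * indicator ?S x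
          + ennreal (G x powr (m - 1)) * indicator {x. \<tau> < G x} x"
        proof (cases "\<tau> < G x")
          case False
          then have "G x powr (m - 1) \<le> \<tau> powr (m - 1)" using G(3) m by (intro powr_mono2) auto
          then show ?thesis using False by (auto simp: indicator_def intro: ennreal_leI)
        qed (auto simp: indicator_def)
      qed
      also have "\<dots> = ennreal (\<tau> powr (m - 1)) * ennreal V
          + (\<integral>\<^sup>+x. ennreal (G x powr (m - 1)) * indicator {x. \<tau> < G x} x \<partial>lebesgue)"
        by (subst nn_integral_add) (auto simp: nn_integral_cmult_indicator emV)
      also have "\<dots> \<le> ennreal (\<tau> powr (m - 1)) * ennreal V + ennreal (C * \<tau> powr (m - 1 - \<kappa>))"
        by (intro add_left_mono C(2)[OF \<tau>])
      also have "\<dots> = ennreal (\<tau> powr (m - 1) * V + C * \<tau> powr (m - 1 - \<kappa>))"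
        using V C(1) by (simp add: ennreal_mult[symmetric])
      also have "\<tau> powr (m - 1) * V + C * \<tau> powr (m - 1 - \<kappa>) = (L powr e + C * L powr (e - 1)) * V powr (1 - e)"
      proof -
        have "\<tau> powr (m - 1) = (L / V) powr e"
          unfolding \<tau>_def powr_powr using \<kappa>_e by simp
        moreover have "\<tau> powr (m - 1 - \<kappa>) = (L / V) powr (e - 1)"
        proof -
          have "1 / \<kappa> * (m - 1 - \<kappa>) = e - 1" using \<kappa>_e \<kappa>0 by (simp add: field_simps)
          then show ?thesis unfolding \<tau>_def powr_powr by simp
        qed
        moreover have "(L / V) powr e * V = L powr e * V powr (1 - e)"
          using L V by (simp add: powr_divide powr_diff)
        moreover have "(L / V) powr (e - 1) = L powr (e - 1) * V powr (1 - e)"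
          using L V by (simp add: powr_divide powr_diff)
        ultimately show ?thesis by (simp add: algebra_simps)
      qed
      finally have *: "(\<integral>\<^sup>+x. ennreal (G x powr (m - 1)) * indicator ?S x \<partial>lebesgue)
        \<le> ennreal ((L powr e + C * L powr (e - 1)) * V powr (1 - e))" .
      have "(\<integral>\<^sup>+x. ennreal (A * G x powr (m - 1)) * indicator ?S x \<partial>lebesgue)
          = (\<integral>\<^sup>+x. ennreal A * (ennreal (G x powr (m - 1)) * indicator ?S x) \<partial>lebesgue)"
        using A by (simp add: ennreal_mult mult.assoc)
      also have "\<dots> = ennreal A * (\<integral>\<^sup>+x. ennreal (G x powr (m - 1)) * indicator ?S x \<partial>lebesgue)"
        by (rule nn_integral_cmult) measurable
      also have "\<dots> \<le> ennreal A * ennreal ((L powr e + C * L powr (e - 1)) * V powr (1 - e))"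
        using * by (rule mult_left_mono) simp
      also have "\<dots> = ennreal (B * V powr (1 - e))"
        using A C(1) by (simp add: B_def ennreal_mult[symmetric] mult.assoc)
      finally show ?thesis by (simp add: V_def)
    qed
  qed (use A in auto)
qed

text \<open>The equations feed integrability into each other: a gain for \<open>u\<close> is a gain for \<open>u\<^bsup>1/\<rho>\<^esup>\<close> in the equation
  for \<open>v\<close>, and conversely. The induction starts with \<open>v\<close>, which lies in \<open>L\<^sup>q\<close>; the condition
  \<open>\<rho> (p - 1) \<le> q - 1\<close> guarantees that the resulting exponent \<open>q / \<rho>\<close> of \<open>v\<^sup>\<rho>\<close> is large enough to enter
  the first equation.\<close>

lemma system_weak_Lp:
  fixes u v :: "'a::euclidean_space \<Rightarrow> real"
  assumes s: "0 < s1" "0 < s2" and pq: "1 < p" "1 < q" and D: "bounded D" "D \<in> sets lebesgue"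
    and wu: "weak_solution s1 p D F u" and wv: "weak_solution s2 q D H v"
    and F: "AE x in lebesgue_on D. F x \<le> A * max (u x) (v x powr \<rho>) powr (p - 1)" and A: "0 \<le> A"
    and H: "AE x in lebesgue_on D. H x \<le> B * max (v x) (u x powr (1 / \<rho>)) powr (q - 1)" and B: "0 \<le> B"
    and nonneg: "\<And>x. 0 \<le> u x" "\<And>x. 0 \<le> v x"
    and \<rho>: "0 < \<rho>" "\<rho> * (p - 1) \<le> q - 1"
  shows "weak_Lp \<kappa> u" "weak_Lp \<kappa> v"
proof -
  have u: "u \<in> W0 s1 p D" and v: "v \<in> W0 s2 q D" using wu wv by (auto simp: weak_solution_def)
  note [measurable] = W0D(1)[OF u] W0D(1)[OF v]
  define g1 where "g1 = 1 + s1 * p / DIM('a)"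
  define g2 where "g2 = 1 + s2 * q / DIM('a)"
  have g: "1 < g1" "1 < g2" using s pq by (auto simp: g1_def g2_def)
  have step: "weak_Lp (\<kappa> / \<rho> * g1) u" "weak_Lp (\<kappa> * g1 * g2) v" if \<kappa>: "q \<le> \<kappa>" "weak_Lp \<kappa> v" for \<kappa>
  proof -
    have "\<rho> * (p - 1) < \<kappa>" using \<rho> \<kappa>(1) by linarith
    then have "p - 1 < \<kappa> / \<rho>" using \<rho>(1) by (simp add: field_simps)
    then show *: "weak_Lp (\<kappa> / \<rho> * g1) u"
      unfolding g1_def using weak_Lp_powr[OF \<kappa>(2) \<rho>(1) nonneg(2)] W0D(2)[OF v]
      by (intro weak_Lp_bootstrap[OF s(1) pq(1) wu D F A]) auto
    have "weak_Lp (\<kappa> / \<rho> * g1 / (1 / \<rho>)) (\<lambda>x. u x powr (1 / \<rho>))"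
      by (rule weak_Lp_powr[OF * _ nonneg(1)]) (use \<rho> in simp)
    then have **: "weak_Lp (\<kappa> * g1) (\<lambda>x. u x powr (1 / \<rho>))" using \<rho>(1) by simp
    have "\<kappa> * 1 \<le> \<kappa> * g1" using g \<kappa>(1) pq by (intro mult_left_mono) auto
    then have "q - 1 < \<kappa> * g1" using \<kappa>(1) by linarith
    then show "weak_Lp (\<kappa> * g1 * g2) v"
      unfolding g2_def using ** W0D(2)[OF u]
      by (intro weak_Lp_bootstrap[OF s(2) pq(2) wv D H B]) auto
  qed
  have g12: "1 < g1 * g2" using g by (simp add: less_1_mult)
  have v_n: "weak_Lp (q * (g1 * g2) ^ n) v" for n
  proof (induction n)
    case 0
    show ?case using weak_Lp_Chebyshev[OF v D(1)] pq by simp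
  next
    case (Suc n)
    have "q * 1 \<le> q * (g1 * g2) ^ n" using g12 pq by (intro mult_left_mono one_le_power) auto
    then show ?case using step(2)[OF _ Suc] by (simp add: mult_ac)
  qed
  have v_all: "weak_Lp \<kappa> v" for \<kappa>
  proof -
    obtain n where "\<kappa> / q < (g1 * g2) ^ n" using real_arch_pow[OF g12] by blast
    then have "\<kappa> \<le> q * (g1 * g2) ^ n" using pq by (simp add: field_simps)
    then show ?thesis using v_n weak_Lp_mono by blast
  qed
  show "weak_Lp \<kappa> v" by (rule v_all)
  have "weak_Lp (max q (\<bar>\<kappa>\<bar> * \<rho>) / \<rho> * g1) u" by (rule step(1)) (auto intro: v_all)
  moreover have "\<kappa> \<le> max q (\<bar>\<kappa>\<bar> * \<rho>) / \<rho> * g1"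
  proof -
    have "\<bar>\<kappa>\<bar> \<le> max q (\<bar>\<kappa>\<bar> * \<rho>) / \<rho>" using \<rho>(1) by (simp add: pos_le_divide_eq)
    moreover have "0 \<le> \<bar>\<kappa>\<bar>" by simp
    ultimately have "\<bar>\<kappa>\<bar> * 1 \<le> max q (\<bar>\<kappa>\<bar> * \<rho>) / \<rho> * g1" using g by (intro mult_mono) auto
    then show ?thesis by linarith
  qed
  ultimately show "weak_Lp \<kappa> u" by (rule weak_Lp_mono)
qed

text \<open>If \<open>\<rho> (p - 1) > q - 1\<close>, then the same argument applies with the two equations exchanged and \<open>1 / \<rho>\<close> in
  place of \<open>\<rho>\<close>.\<close>

lemma system_bounded:
  fixes u v :: "'a::euclidean_space \<Rightarrow> real"
  assumes s: "0 < s1" "0 < s2" and pq: "1 < p" "1 < q" and D: "bounded D" "D \<in> sets lebesgue"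
    and wu: "weak_solution s1 p D F u" and wv: "weak_solution s2 q D H v"
    and F: "AE x in lebesgue_on D. F x \<le> A * max (u x) (v x powr \<rho>) powr (p - 1)" and A: "0 \<le> A"
    and H: "AE x in lebesgue_on D. H x \<le> B * max (v x) (u x powr (1 / \<rho>)) powr (q - 1)" and B: "0 \<le> B"
    and nonneg: "\<And>x. 0 \<le> u x" "\<And>x. 0 \<le> v x"
    and \<rho>: "0 < \<rho>"
  shows "\<exists>K. AE x in lebesgue. u x \<le> K" "\<exists>K. AE x in lebesgue. v x \<le> K"
proof -
  have u: "u \<in> W0 s1 p D" and v: "v \<in> W0 s2 q D" using wu wv by (auto simp: weak_solution_def)
  note [measurable] = W0D(1)[OF u] W0D(1)[OF v]
  have all: "weak_Lp \<kappa> u" "weak_Lp \<kappa> v" for \<kappa>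
  proof -
    have "weak_Lp \<kappa> u \<and> weak_Lp \<kappa> v"
    proof (cases "\<rho> * (p - 1) \<le> q - 1")
      case True
      then show ?thesis using system_weak_Lp[OF s pq D wu wv F A H B nonneg \<rho>] by blast
    next
      case False
      then have "1 / \<rho> * (q - 1) \<le> p - 1" using \<rho> by (simp add: field_simps)
      moreover have "0 < 1 / \<rho>" using \<rho> by simp
      moreover have "AE x in lebesgue_on D. F x \<le> A * max (u x) (v x powr (1 / (1 / \<rho>))) powr (p - 1)"
        using F by simp
      ultimately show ?thesis
        using system_weak_Lp[OF s(2,1) pq(2,1) D wv wu H B _ A nonneg(2,1)] by blast
    qed
    then show "weak_Lp \<kappa> u" "weak_Lp \<kappa> v" by auto
  qed
  have pow: "weak_Lp \<kappa> (\<lambda>x. w x powr r)" if "\<And>\<kappa>. weak_Lp \<kappa> w" "0 < r" "\<And>x. 0 \<le> w x" for w :: "'a \<Rightarrow> real" and r \<kappa>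
    using weak_Lp_powr[OF that(1)[of "\<kappa> * r"] that(2,3)] that(2) by simp
  show "\<exists>K. AE x in lebesgue. u x \<le> K"
  proof (rule bounded_above_of_weak_Lp[OF s(1) pq(1) wu D F A])
    show "weak_Lp \<kappa> (\<lambda>x. max (u x) (v x powr \<rho>))" for \<kappa>
      using all pow[OF all(2) \<rho> nonneg(2)] W0D(2)[OF u] W0D(2)[OF v] D(1)
      by (intro weak_Lp_max[where D = D]) auto
  qed (use W0D(2)[OF u] W0D(2)[OF v] nonneg in \<open>auto simp: le_max_iff_disj\<close>)
  show "\<exists>K. AE x in lebesgue. v x \<le> K"
  proof (rule bounded_above_of_weak_Lp[OF s(2) pq(2) wv D H B])
    have "0 < 1 / \<rho>" using \<rho> by simp
    then show "weak_Lp \<kappa> (\<lambda>x. max (v x) (u x powr (1 / \<rho>)))" for \<kappa>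
      using all pow[OF all(1) _ nonneg(1)] W0D(2)[OF u] W0D(2)[OF v] D(1)
      by (intro weak_Lp_max[where D = D]) auto
  qed (use W0D(2)[OF u] W0D(2)[OF v] nonneg in \<open>auto simp: le_max_iff_disj\<close>)
qed

section \<open>Bounds by the torsion function of the unit ball\<close>

text \<open>The choice in the definition of the torsion function is meaningful since a bounded solution exists:
  for the constant right-hand side \<open>1\<close> the integral over a superlevel set is just its measure, so
  Stampacchia's criterion applies with \<open>e = 0\<close>.\<close>

lemma torsion_function_props:
  fixes s m :: real
  assumes s: "0 < s" and m: "1 < m"
  defines "w \<equiv> torsion_function s m :: 'a::euclidean_space \<Rightarrow> real"
  shows "weak_solution s m (ball 0 1) (\<lambda>_. 1) w" and "Linf_on UNIV w"
    and "AE x in lebesgue. 0 \<le> w x" and "AE x in lebesgue. w x \<le> torsion_sup TYPE('a) s m"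
    and "0 \<le> torsion_sup TYPE('a) s m"
proof -
  let ?B = "ball (0 :: 'a) 1"
  have B: "?B \<in> sets lebesgue" "bounded ?B" by auto
  have UNIV: "(UNIV :: 'a set) \<in> sets lebesgue" by simp
  obtain w0 :: "'a \<Rightarrow> real" where w0: "weak_solution s m ?B (\<lambda>_. 1) w0"
    using torsion_exists[OF s m B] by blast
  have w0W: "w0 \<in> W0 s m ?B" using w0 by (simp add: weak_solution_def)
  have lm: "{x. k < w0 x} \<in> lmeasurable" if "0 \<le> k" for k
    using W0D(1)[OF w0W] W0D(2)[OF w0W] B(2) that by (intro lmeasurable_superlevel[where D = ?B]; simp)
  have "\<exists>K. AE x in lebesgue. w0 x \<le> K"
  proof (rule weak_solution_bounded_above[OF s m w0 B(2,1), of "\<lambda>_. 1" 1 0 0])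
    show "(\<integral>\<^sup>+x. ennreal 1 * indicator {x. k < w0 x} x \<partial>lebesgue)
      \<le> ennreal (1 * measure lebesgue {x. k < w0 x} powr (1 - 0))" if "0 \<le> k" for k
      using lm[OF that] emeasure_eq_ennreal_measure[OF fmeasurableD2[OF lm[OF that]]] by (simp add: fmeasurableD)
  qed (use s m in auto)
  then obtain K where K: "AE x in lebesgue. w0 x \<le> K" ..
  have nonneg0: "AE x in lebesgue. 0 \<le> w0 x"
    by (rule weak_solution_const_nonneg[OF s m w0 B]) simp
  have "Linf_on UNIV w0"
    unfolding Linf_on_def
  proof
    note [measurable] = W0D(1)[OF w0W]
    show meas: "w0 \<in> borel_measurable (lebesgue_on UNIV)" using W0D(1)[OF w0W] by simp
    have "esssup (lebesgue_on UNIV) (\<lambda>x. ereal \<bar>w0 x\<bar>) \<le> ereal K"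
    proof (rule esssup_I)
      show "(\<lambda>x. ereal \<bar>w0 x\<bar>) \<in> borel_measurable (lebesgue_on UNIV)" using meas by measurable
      have "AE x in lebesgue. \<bar>w0 x\<bar> \<le> K" using K nonneg0 by eventually_elim simp
      then show "AE x in lebesgue_on UNIV. ereal \<bar>w0 x\<bar> \<le> ereal K" by (simp add: AE_lebesgue_on_iff')
    qed
    then show "esssup (lebesgue_on UNIV) (\<lambda>x. ereal \<bar>w0 x\<bar>) < \<infinity>" by (rule le_less_trans) simp
  qed
  with w0 have "weak_solution s m ?B (\<lambda>_. 1) w \<and> Linf_on UNIV w"
    unfolding w_def torsion_function_def
    by (intro someI[where P = "\<lambda>w. weak_solution s m ?B (\<lambda>_. 1) w \<and> Linf_on UNIV w"] conjI)
  then show ws: "weak_solution s m ?B (\<lambda>_. 1) w" and Linf: "Linf_on UNIV w" by auto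
  show nonneg: "AE x in lebesgue. 0 \<le> w x"
    by (rule weak_solution_const_nonneg[OF s m ws B]) simp
  have wW: "w \<in> W0 s m ?B" using ws by (simp add: weak_solution_def)
  have meas: "(\<lambda>x. ereal (w x)) \<in> borel_measurable (lebesgue_on ?B)"
    using measurable_restrict_space1[OF W0D(1)[OF wW], of ?B] by measurable
  have posB: "emeasure (lebesgue_on ?B) (space (lebesgue_on ?B)) \<noteq> 0"
  proof -
    have "unit_ball_vol (real DIM('a)) \<noteq> 0"
      by (intro less_imp_neq[symmetric] unit_ball_vol_pos) simp
    then show ?thesis using emeasure_ball[of 1 "0::'a"] by (simp add: emeasure_restrict_space)
  qed
  define e where "e = esssup (lebesgue_on ?B) (\<lambda>x. ereal (w x))"
  have e_le: "AE x in lebesgue_on ?B. ereal (w x) \<le> e" unfolding e_def by (rule esssup_AE)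
  have "0 \<le> e"
  proof -
    have "esssup (lebesgue_on ?B) (\<lambda>x. 0 :: ereal) \<le> e"
      unfolding e_def
    proof (rule esssup_AE_mono)
      show "AE x in lebesgue_on ?B. (0 :: ereal) \<le> ereal (w x)"
        unfolding AE_lebesgue_on_iff'[OF B(1)] using nonneg by eventually_elim simp
    qed simp
    then show ?thesis using esssup_const[OF posB, of "0 :: ereal"] by simp
  qed
  moreover have "e < \<infinity>"
  proof -
    have "AE x in lebesgue. ereal \<bar>w x\<bar> \<le> esssup (lebesgue_on UNIV) (\<lambda>x. ereal \<bar>w x\<bar>)"
      using esssup_AE[of "\<lambda>x. ereal \<bar>w x\<bar>" "lebesgue_on UNIV"]
      by (simp only: AE_lebesgue_on_iff'[OF UNIV] UNIV_I simp_thms)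
    then have "AE x in lebesgue_on ?B. ereal (w x) \<le> esssup (lebesgue_on UNIV) (\<lambda>x. ereal \<bar>w x\<bar>)"
      unfolding AE_lebesgue_on_iff'[OF B(1)]
      by eventually_elim (metis abs_ge_self ereal_less_eq(3) order_trans)
    then have "e \<le> esssup (lebesgue_on UNIV) (\<lambda>x. ereal \<bar>w x\<bar>)" unfolding e_def using meas by (intro esssup_I)
    then show ?thesis using Linf unfolding Linf_on_def by (auto intro: le_less_trans)
  qed
  ultimately have e_real: "e = ereal (torsion_sup TYPE('a) s m)" "0 \<le> torsion_sup TYPE('a) s m"
    unfolding torsion_sup_def e_def w_def by (auto simp: ereal_real' real_of_ereal_pos)
  show "0 \<le> torsion_sup TYPE('a) s m" by (rule e_real(2))
  have "AE x in lebesgue. x \<in> ?B \<longrightarrow> w x \<le> torsion_sup TYPE('a) s m"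
    using e_le unfolding e_real(1) by (simp add: AE_lebesgue_on_iff')
  then show "AE x in lebesgue. w x \<le> torsion_sup TYPE('a) s m"
    by eventually_elim (metis W0D(2)[OF wW] e_real(2))
qed

text \<open>A multiple of the torsion function, dilated to the ball of radius \<open>d\<close>, solves the equation with
  right-hand side exactly \<open>c\<close>, and so dominates \<open>u\<close>.\<close>

lemma torsion_bound:
  fixes u :: "'a::euclidean_space \<Rightarrow> real"
  assumes s: "0 < s" and m: "1 < m" and u: "weak_solution s m D F u" and D: "D \<in> sets lebesgue"
    and ball: "D \<subseteq> ball x0 d" and d: "0 < d" and F: "AE x in lebesgue_on D. F x \<le> c" and c: "0 < c"
  shows "AE x in lebesgue. u x \<le> (c * d powr (s * m)) powr (1 / (m - 1)) * torsion_sup TYPE('a) s m"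
proof -
  let ?T = "torsion_sup TYPE('a) s m"
  note tor = torsion_function_props[OF s m, where ?'a = 'a]
  define w :: "'a \<Rightarrow> real" where "w x = max 0 (torsion_function s m x)" for x
  have tW: "torsion_function s m \<in> W0 s m (ball (0::'a) 1)" using tor(1) by (simp add: weak_solution_def)
  note [measurable] = W0D(1)[OF tW]
  have w: "weak_solution s m (ball 0 1) (\<lambda>_. 1) w"
  proof (rule weak_solution_AE_cong[OF tor(1)])
    show "AE x in lebesgue. torsion_function s m x = w x"
      using tor(3) by eventually_elim (simp add: w_def)
    show "w \<in> borel_measurable lebesgue" unfolding w_def by measurable
    show "w x = 0" if "x \<notin> ball 0 1" for x using W0D(2)[OF tW that] by (simp add: w_def)
  qed auto
  have w_meas [measurable]: "w \<in> borel_measurable lebesgue" unfolding w_def by measurable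
  have w_le: "AE x in lebesgue. w x \<le> ?T"
    using tor(4) by eventually_elim (use tor(5) in \<open>simp add: w_def\<close>)
  define wd where "wd x = w ((1 / d) *\<^sub>R (x - x0))" for x
  have wd: "weak_solution s m (ball x0 d) (\<lambda>_. d powr (- (s * m))) wd"
    unfolding wd_def by (rule weak_solution_dilation[OF d m w])
  have wdW: "wd \<in> W0 s m (ball x0 d)" using wd by (simp add: weak_solution_def)
  note [measurable] = W0D(1)[OF wdW]
  have wd_le: "AE x in lebesgue. wd x \<le> ?T"
  proof -
    have [measurable]: "{x. ?T < wd x} \<in> sets lebesgue" 
      using borel_measurable_iff_greater[of wd lebesgue] W0D(1)[OF wdW] by simp
    have wd_shift: "wd (x0 + d *\<^sub>R x) = w x" for x using d by (simp add: wd_def)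
    have "emeasure lebesgue {x. ?T < wd x} = (\<integral>\<^sup>+x. indicator {x. ?T < wd x} x \<partial>lebesgue)" by simp
    also have "\<dots> = ennreal (d ^ DIM('a)) * (\<integral>\<^sup>+x. indicator {x. ?T < wd x} (x0 + d *\<^sub>R x) \<partial>lebesgue)"
      by (rule nn_integral_dilation[OF d]) measurable
    also have "(\<integral>\<^sup>+x. indicator {x. ?T < wd x} (x0 + d *\<^sub>R x) \<partial>lebesgue) = (\<integral>\<^sup>+x. 0 \<partial>(lebesgue :: 'a measure))"
      using w_le by (intro nn_integral_cong_AE) (auto simp: wd_shift indicator_def elim!: eventually_mono)
    finally have "{x. ?T < wd x} \<in> null_sets lebesgue" by (auto simp: null_sets_def)
    then have "AE x in lebesgue. \<not> ?T < wd x" by (rule AE_I') auto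
    then show ?thesis by (simp only: not_less)
  qed
  define k where "k = (c * d powr (s * m)) powr (1 / (m - 1))"
  have k: "0 < k" "k powr (m - 1) = c * d powr (s * m)"
    using c d m by (auto simp: k_def powr_powr)
  have "weak_solution s m (ball x0 d) (\<lambda>x. k powr (m - 1) * d powr (- (s * m))) (\<lambda>x. k * wd x)"
    by (rule weak_solution_cmult[OF _ m wd]) (use k in simp)
  moreover have "k powr (m - 1) * d powr (- (s * m)) = c"
    unfolding k(2) using d by (simp add: powr_minus)
  ultimately have kw: "weak_solution s m (ball x0 d) (\<lambda>x. c) (\<lambda>x. k * wd x)" by simp
  have "AE x in lebesgue. u x \<le> k * wd x"
    by (rule weak_solution_comparison[OF s m u kw D ball _ _ F])
       (use c k in \<open>auto simp: wd_def w_def\<close>)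
  then show ?thesis
    using wd_le
  proof eventually_elim
    fix x assume "u x \<le> k * wd x" "wd x \<le> ?T"
    moreover have "k * wd x \<le> k * ?T" using \<open>wd x \<le> ?T\<close> k by simp
    ultimately show "u x \<le> (c * d powr (s * m)) powr (1 / (m - 1)) * ?T" unfolding k_def by linarith
  qed
qed

section \<open>The lower bound for the principal curve\<close>

text \<open>The essential supremum as a real number.\<close>

lemma least_AE_upper_bound:
  fixes u :: "'a::euclidean_space \<Rightarrow> real"
  assumes bound: "AE x in lebesgue. u x \<le> K" and nonneg: "\<And>x. 0 \<le> u x"
  obtains M where "0 \<le> M" "AE x in lebesgue. u x \<le> M" "\<And>c. AE x in lebesgue. u x \<le> c \<Longrightarrow> M \<le> c"
proof -
  let ?S = "{c. AE x in lebesgue. u x \<le> c}"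
  have lower: "0 \<le> c" if "c \<in> ?S" for c
  proof (rule ccontr)
    assume "\<not> 0 \<le> c"
    have "AE x in lebesgue. u x \<le> c" using that by simp
    then have "AE x in (lebesgue :: 'a measure). False"
      by eventually_elim (use nonneg \<open>\<not> 0 \<le> c\<close> in \<open>meson order_trans\<close>)
    then show False by (simp add: eventually_False ae_filter_eq_bot_iff)
  qed
  have bdd: "bdd_below ?S" using lower by (rule bdd_belowI)
  have "AE x in lebesgue. u x \<le> Inf ?S + 1 / (real n + 1)" for n
  proof -
    have "Inf ?S < Inf ?S + 1 / (real n + 1)" by simp
    then obtain c where c: "c \<in> ?S" "c < Inf ?S + 1 / (real n + 1)"
      using cInf_lessD[of ?S] bound by blast
    have "AE x in lebesgue. u x \<le> c" using c(1) by simp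
    then show ?thesis by eventually_elim (use c(2) in linarith)
  qed
  then have "AE x in lebesgue. \<forall>n. u x \<le> Inf ?S + 1 / (real n + 1)" by (simp add: AE_all_countable)
  then have "AE x in lebesgue. u x \<le> Inf ?S"
  proof eventually_elim
    fix x assume *: "\<forall>n. u x \<le> Inf ?S + 1 / (real n + 1)"
    have "(\<lambda>n. 1 / (real n + 1)) \<longlonglongrightarrow> 0"
      using LIMSEQ_inverse_real_of_nat by (simp add: inverse_eq_divide add.commute)
    then have "(\<lambda>n. Inf ?S + 1 / (real n + 1)) \<longlonglongrightarrow> Inf ?S + 0" by (intro tendsto_intros)
    then show "u x \<le> Inf ?S" using * by (intro LIMSEQ_le_const[of _ "Inf ?S"]) auto
  qed
  moreover have "0 \<le> Inf ?S" using lower bound by (intro cInf_greatest) auto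
  moreover have "Inf ?S \<le> c" if "AE x in lebesgue. u x \<le> c" for c using that bdd by (intro cInf_lower) auto
  ultimately show ?thesis using that by blast
qed

text \<open>An open set does not attain its diameter, so it fits into the open ball whose radius is the diameter.\<close>

lemma open_subset_ball_diameter:
  fixes S :: "'a::euclidean_space set"
  assumes S: "open S" "bounded S" and x0: "x0 \<in> S"
  shows "0 < diameter S" and "S \<subseteq> ball x0 (diameter S)"
proof -
  show pos: "0 < diameter S"
  proof -
    obtain r where r: "0 < r" "ball x0 r \<subseteq> S" using S(1) x0 openE by blast
    obtain b :: 'a where b: "b \<in> Basis" using nonempty_Basis by blast
    let ?y = "x0 + (r / 2) *\<^sub>R b"
    have dist: "dist x0 ?y = r / 2" using r(1) b by (simp add: dist_norm)
    then have "?y \<in> S" using r by auto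
    then have "dist x0 ?y \<le> diameter S" using diameter_bounded_bound[OF S(2) x0] by blast
    then show ?thesis using r(1) dist by linarith
  qed
  show "S \<subseteq> ball x0 (diameter S)"
  proof
    fix x assume x: "x \<in> S"
    have "dist x0 x < diameter S"
    proof (cases "x = x0")
      case False
      obtain r where r: "0 < r" "ball x r \<subseteq> S" using S(1) x openE by blast
      \<comment> \<open>Moving \<open>x\<close> slightly away from \<open>x0\<close> stays in \<open>S\<close> and increases the distance.\<close>
      define t where "t = r / (2 * norm (x - x0))"
      have n: "0 < norm (x - x0)" using False by simp
      have t: "0 < t" using r n by (simp add: t_def)
      let ?y = "x + t *\<^sub>R (x - x0)"
      have "dist x ?y = r / 2" using r n by (simp add: dist_norm t_def)
      then have "?y \<in> S" using r by auto
      then have "dist x0 ?y \<le> diameter S" using diameter_bounded_bound[OF S(2) x0] by blast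
      moreover have "dist x0 ?y = (1 + t) * norm (x - x0)"
      proof -
        have "x0 - ?y = - ((1 + t) *\<^sub>R (x - x0))" by (simp add: algebra_simps)
        then show ?thesis using t unfolding dist_norm by (simp only: norm_minus_cancel norm_scaleR abs_of_pos add_pos_pos zero_less_one)
      qed
      moreover have "1 * norm (x - x0) < (1 + t) * norm (x - x0)" using t n by (intro mult_strict_right_mono) auto
      ultimately show ?thesis by (simp add: dist_norm norm_minus_commute)
    qed (use pos in simp)
    then show "x \<in> ball x0 (diameter S)" by simp
  qed
qed

lemma Linf_on_AE:
  assumes "Linf_on D f"
  shows "AE x in lebesgue_on D. \<bar>f x\<bar> \<le> Linf_norm D f"
proof -
  let ?e = "esssup (lebesgue_on D) (\<lambda>x. ereal \<bar>f x\<bar>)"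
  have fin: "?e < \<infinity>" using assms by (simp add: Linf_on_def)
  have "AE x in lebesgue_on D. ereal \<bar>f x\<bar> \<le> ?e" by (rule esssup_AE)
  then show ?thesis
  proof eventually_elim
    fix x assume x: "ereal \<bar>f x\<bar> \<le> ?e"
    then have "?e = ereal (Linf_norm D f)"
      using fin unfolding Linf_norm_def by (cases ?e) auto
    then show "\<bar>f x\<bar> \<le> Linf_norm D f" using x by simp
  qed
qed

lemma admissible_coeff_norm_pos:
  assumes "admissible_coeff D f" "open D" "D \<noteq> {}"
  shows "0 < Linf_norm D f"
proof -
  let ?L = "lebesgue_on D"
  have D: "D \<in> sets lebesgue" using assms(2) by simp
  have pos: "emeasure ?L (space ?L) \<noteq> 0"
    using assms(2,3) D open_not_negligible[of D] by (simp add: emeasure_restrict_space negligible_iff_measure0 negligible_iff_emeasure0)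
  have f: "f \<in> borel_measurable ?L" "0 < essinf_on D f" using assms(1) by (auto simp: admissible_coeff_def Linf_on_def)
  have AE: "AE x in ?L. \<bar>f x\<bar> \<le> Linf_norm D f"
    using assms(1) by (intro Linf_on_AE) (simp add: admissible_coeff_def)
  show ?thesis
  proof (rule ccontr)
    assume "\<not> ?thesis"
    with AE have "AE x in ?L. f x = 0" by (auto elim!: eventually_mono)
    moreover have "(\<lambda>x. ereal (- f x)) \<in> borel_measurable ?L" using f(1) by measurable
    ultimately have "esssup ?L (\<lambda>x. - ereal (f x)) = esssup ?L (\<lambda>x. 0 :: ereal)"
      by (intro esssup_AE_cong) (auto elim!: eventually_mono)
    then show False using f(2) esssup_const[OF pos, of "0 :: ereal"] by (simp add: essinf_on_def)
  qed
qed

text \<open>With \<open>\<rho> = \<beta>1 / (p - 1 - \<alpha>1)\<close> the right-hand side \<open>u\<^bsup>\<alpha>1\<^esup> v\<^bsup>\<beta>1\<^esup>\<close> of the first equation is homogeneous of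
  degree \<open>p - 1\<close> in \<open>u\<close> and \<open>v\<^sup>\<rho>\<close>. By the balance condition the second equation has the same structure
  with \<open>1 / \<rho>\<close>.\<close>

lemma powr_mult_powr_le_max_powr:
  fixes x y :: real
  assumes "0 \<le> x" "0 \<le> y" "0 \<le> \<alpha>" "0 < \<rho>" "0 < P" "\<beta> = \<rho> * P"
  shows "x powr \<alpha> * y powr \<beta> \<le> max x (y powr \<rho>) powr (\<alpha> + P)"
proof -
  have "x powr \<alpha> * y powr \<beta> = x powr \<alpha> * (y powr \<rho>) powr P" using assms by (simp add: powr_powr)
  also have "\<dots> \<le> max x (y powr \<rho>) powr \<alpha> * max x (y powr \<rho>) powr P"
    using assms by (intro mult_mono powr_mono2) (auto simp: le_max_iff_disj)
  also have "\<dots> = max x (y powr \<rho>) powr (\<alpha> + P)" by (simp add: powr_add)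
  finally show ?thesis .
qed

text \<open>Where \<open>u\<close> and \<open>v\<close> are at most \<open>X\<close> and \<open>Y\<close>, the right-hand side is at most the constant
  \<open>c X\<^sup>\<alpha> Y\<^sup>\<beta>\<close>. The torsion bound for \<open>u\<close> with this constant bounds the least \<open>X\<close> in terms of itself, with
  the smaller exponent \<open>\<alpha>\<close> in place of \<open>m - 1\<close>.\<close>

lemma least_bound_le_torsion:
  fixes u v :: "'a::euclidean_space \<Rightarrow> real"
  assumes s: "0 < s" and m: "1 < m" and ws: "weak_solution s m D F u" and D: "D \<in> sets lebesgue"
    and ball: "D \<subseteq> ball x0 d" and d: "0 < d"
    and F: "AE x in lebesgue_on D. F x \<le> c * (u x powr \<alpha> * v x powr \<beta>)"
    and c: "0 < c" and \<alpha>\<beta>: "0 \<le> \<alpha>" "0 \<le> \<beta>"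
    and nonneg: "\<And>x. 0 \<le> u x" "\<And>x. 0 \<le> v x" and pos: "0 < X" "0 < Y"
    and X: "AE x in lebesgue. u x \<le> X" "\<And>K. AE x in lebesgue. u x \<le> K \<Longrightarrow> X \<le> K"
    and Y: "AE x in lebesgue. v x \<le> Y"
  shows "X powr (m - 1 - \<alpha>) \<le> c * Y powr \<beta> * d powr (s * m) * torsion_sup TYPE('a) s m powr (m - 1)"
proof -
  let ?T = "torsion_sup TYPE('a) s m" and ?c = "c * (X powr \<alpha> * Y powr \<beta>)"
  have c': "0 < ?c" using c pos by simp
  have T: "0 \<le> ?T" by (rule torsion_function_props(5)[OF s m])
  have "AE x in lebesgue. x \<in> D \<longrightarrow> F x \<le> c * (u x powr \<alpha> * v x powr \<beta>)"
    using F by (simp add: AE_lebesgue_on_iff'[OF D])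
  then have "AE x in lebesgue. x \<in> D \<longrightarrow> F x \<le> ?c"
    using X(1) Y
  proof eventually_elim
    fix x assume *: "x \<in> D \<longrightarrow> F x \<le> c * (u x powr \<alpha> * v x powr \<beta>)" "u x \<le> X" "v x \<le> Y"
    have "c * (u x powr \<alpha> * v x powr \<beta>) \<le> ?c"
      using * nonneg[of x] c \<alpha>\<beta> by (intro mult_left_mono mult_mono powr_mono2) auto
    with * show "x \<in> D \<longrightarrow> F x \<le> ?c" by linarith
  qed
  then have "AE x in lebesgue_on D. F x \<le> ?c" by (simp add: AE_lebesgue_on_iff'[OF D])
  then have "X \<le> (?c * d powr (s * m)) powr (1 / (m - 1)) * ?T"
    by (intro X(2) torsion_bound[OF s m ws D ball d _ c'])
  then have "X powr (m - 1) \<le> ((?c * d powr (s * m)) powr (1 / (m - 1)) * ?T) powr (m - 1)"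
    using pos m by (intro powr_mono2) auto
  also have "\<dots> = ?c * d powr (s * m) * ?T powr (m - 1)"
    using c pos d T m by (simp add: powr_mult powr_powr)
  finally have "X powr (m - 1) \<le> ?c * d powr (s * m) * ?T powr (m - 1)" .
  moreover have "X powr (m - 1) = X powr \<alpha> * X powr (m - 1 - \<alpha>)" by (simp flip: powr_add)
  ultimately have "X powr \<alpha> * X powr (m - 1 - \<alpha>)
      \<le> X powr \<alpha> * (c * Y powr \<beta> * d powr (s * m) * ?T powr (m - 1))"
    by (simp only: mult_ac)
  then show ?thesis using pos by simp
qed

text \<open>Write \<open>M\<close> and \<open>L\<close> for the essential suprema of the eigenfunctions. The two equations
  estimate \<open>M\<^bsup>p-1-\<alpha>1\<^esup>\<close> by a multiple of \<open>L\<^bsup>\<beta>1\<^esup>\<close> and \<open>L\<^bsup>q-1-\<alpha>2\<^esup>\<close> by a multiple of \<open>M\<^bsup>\<beta>2\<^esup>\<close>.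
  Raised to the powers \<open>1 / \<theta>\<close> and \<open>1 / \<zeta>\<close> and multiplied, these estimates contain \<open>M\<close> and \<open>L\<close> with equal
  exponents on both sides, which leaves an inequality between the constants. It is stated without
  division, so that it also shows that no factor vanishes.\<close>

lemma principal_eigenvalue_bound:
  fixes \<Omega> :: "'a::euclidean_space set"
  assumes pq: "1 < p" "1 < q" and s: "0 < s1" "0 < s2"
    and \<alpha>: "0 \<le> \<alpha>1" "0 \<le> \<alpha>2" "\<alpha>1 < p - 1" "\<alpha>2 < q - 1" and \<beta>: "0 < \<beta>1" "0 < \<beta>2"
    and balance: "\<beta>1 * \<beta>2 = (p - 1 - \<alpha>1) * (q - 1 - \<alpha>2)"
    and \<theta>: "\<theta> = sqrt (\<beta>1 * (p - 1 - \<alpha>1))" and \<zeta>: "\<zeta> = sqrt (\<beta>2 * (q - 1 - \<alpha>2))"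
    and \<Omega>: "open \<Omega>" "bounded \<Omega>" "\<Omega> \<noteq> {}"
    and a: "admissible_coeff \<Omega> a" and b: "admissible_coeff \<Omega> b"
    and ev: "(lam, mu) \<in> principal_eigenvalues p q s1 s2 \<alpha>1 \<alpha>2 \<beta>1 \<beta>2 \<Omega> a b"
  shows "1 \<le> lam powr (1 / \<theta>) * mu powr (1 / \<zeta>) *
    (torsion_sup TYPE('a) s1 p powr ((p - 1) / \<theta>)
     * torsion_sup TYPE('a) s2 q powr ((q - 1) / \<zeta>)
     * diameter \<Omega> powr (p * s1 / \<theta> + q * s2 / \<zeta>)
     * Linf_norm \<Omega> a powr (1 / \<theta>)
     * Linf_norm \<Omega> b powr (1 / \<zeta>))"
proof -
  define P where "P = p - 1 - \<alpha>1"
  define Q where "Q = q - 1 - \<alpha>2"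
  have PQ: "0 < P" "0 < Q" "\<beta>1 * \<beta>2 = P * Q" using \<alpha> balance by (auto simp: P_def Q_def)
  define \<rho> where "\<rho> = \<beta>1 / P"
  have \<rho>: "0 < \<rho>" "\<beta>1 = \<rho> * P" using PQ \<beta> by (auto simp: \<rho>_def)
  have \<rho>': "0 < 1 / \<rho>" "\<beta>2 = 1 / \<rho> * Q" using PQ \<beta> by (auto simp: \<rho>_def field_simps)
  have \<Omega>m: "\<Omega> \<in> sets lebesgue" using \<Omega>(1) by simp
  have lam: "0 < lam" "0 < mu" using ev by (auto simp: principal_eigenvalues_def)
  obtain \<phi> \<psi> where sol: "system_weak_solution p q s1 s2 \<alpha>1 \<alpha>2 \<beta>1 \<beta>2 \<Omega> a b lam mu \<phi> \<psi>"
    and pos: "AE x in lebesgue_on \<Omega>. 0 < \<phi> x" "AE x in lebesgue_on \<Omega>. 0 < \<psi> x"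
    using ev by (auto simp: principal_eigenvalues_def)
  have \<phi>W: "\<phi> \<in> W0 s1 p \<Omega>" and \<psi>W: "\<psi> \<in> W0 s2 q \<Omega>"
    using sol by (auto simp: system_weak_solution_def weak_solution_def)
  define u where "u x = max 0 (\<phi> x)" for x
  define v where "v x = max 0 (\<psi> x)" for x
  have nonneg: "0 \<le> u x" "0 \<le> v x" for x by (auto simp: u_def v_def)
  have zero: "u x = 0" "v x = 0" if "x \<notin> \<Omega>" for x
    using W0D(2)[OF \<phi>W that] W0D(2)[OF \<psi>W that] by (auto simp: u_def v_def)
  note [measurable] = W0D(1)[OF \<phi>W] W0D(1)[OF \<psi>W]
  have uv_meas [measurable]: "u \<in> borel_measurable lebesgue" "v \<in> borel_measurable lebesgue"
    unfolding u_def v_def by measurable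
  have ae_eq: "AE x in lebesgue. \<phi> x = u x" "AE x in lebesgue. \<psi> x = v x"
  proof -
    have *: "AE x in lebesgue. x \<in> \<Omega> \<longrightarrow> 0 < \<phi> x" "AE x in lebesgue. x \<in> \<Omega> \<longrightarrow> 0 < \<psi> x"
      using pos by (simp_all add: AE_lebesgue_on_iff'[OF \<Omega>m])
    show "AE x in lebesgue. \<phi> x = u x"
      using *(1)
    proof eventually_elim
      fix x assume "x \<in> \<Omega> \<longrightarrow> 0 < \<phi> x"
      then show "\<phi> x = u x" using W0D(2)[OF \<phi>W, of x] by (cases "x \<in> \<Omega>") (simp_all add: u_def)
    qed
    show "AE x in lebesgue. \<psi> x = v x"
      using *(2)
    proof eventually_elim
      fix x assume "x \<in> \<Omega> \<longrightarrow> 0 < \<psi> x"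
      then show "\<psi> x = v x" using W0D(2)[OF \<psi>W, of x] by (cases "x \<in> \<Omega>") (simp_all add: v_def)
    qed
  qed
  have ab: "a \<in> borel_measurable (lebesgue_on \<Omega>)" "b \<in> borel_measurable (lebesgue_on \<Omega>)"
    using a b by (auto simp: admissible_coeff_def Linf_on_def)
  have on [measurable]: "u \<in> borel_measurable (lebesgue_on \<Omega>)" "v \<in> borel_measurable (lebesgue_on \<Omega>)"
    using uv_meas by (auto intro: measurable_restrict_space1)
  note [measurable] = ab
  define F where "F x = lam * a x * (u x powr \<alpha>1 * v x powr \<beta>1)" for x
  define H where "H x = mu * b x * (v x powr \<alpha>2 * u x powr \<beta>2)" for x
  have term_eq: "abs_pow x \<alpha> * (\<bar>y\<bar> powr (\<beta> - 1) * y) = max 0 x powr \<alpha> * max 0 y powr \<beta>"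
    if "0 < x" "0 < y" for x y \<alpha> \<beta>
    using that spow_nonneg[of y "\<beta> + 1"] by (simp add: abs_pow_def spow_def)
  have wu: "weak_solution s1 p \<Omega> F u"
  proof (rule weak_solution_AE_cong[OF _ \<Omega>m ae_eq(1) uv_meas(1) zero(1)])
    show "weak_solution s1 p \<Omega> (\<lambda>x. lam * a x * abs_pow (\<phi> x) \<alpha>1 * (\<bar>\<psi> x\<bar> powr (\<beta>1 - 1) * \<psi> x)) \<phi>"
      using sol by (simp add: system_weak_solution_def)
    show "AE x in lebesgue_on \<Omega>. lam * a x * abs_pow (\<phi> x) \<alpha>1 * (\<bar>\<psi> x\<bar> powr (\<beta>1 - 1) * \<psi> x) = F x"
      using pos by eventually_elim (simp only: F_def u_def v_def term_eq mult.assoc)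
    show "F \<in> borel_measurable (lebesgue_on \<Omega>)" unfolding F_def by measurable
  qed
  have wv: "weak_solution s2 q \<Omega> H v"
  proof (rule weak_solution_AE_cong[OF _ \<Omega>m ae_eq(2) uv_meas(2) zero(2)])
    show "weak_solution s2 q \<Omega> (\<lambda>x. mu * b x * abs_pow (\<psi> x) \<alpha>2 * (\<bar>\<phi> x\<bar> powr (\<beta>2 - 1) * \<phi> x)) \<psi>"
      using sol by (simp add: system_weak_solution_def)
    show "AE x in lebesgue_on \<Omega>. mu * b x * abs_pow (\<psi> x) \<alpha>2 * (\<bar>\<phi> x\<bar> powr (\<beta>2 - 1) * \<phi> x) = H x"
      using pos by eventually_elim (simp only: H_def u_def v_def term_eq mult.assoc)
    show "H \<in> borel_measurable (lebesgue_on \<Omega>)" unfolding H_def by measurable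
  qed
  define Na where "Na = Linf_norm \<Omega> a"
  define Nb where "Nb = Linf_norm \<Omega> b"
  have N: "0 < Na" "0 < Nb"
    unfolding Na_def Nb_def using a b \<Omega> by (auto intro: admissible_coeff_norm_pos)
  have a_le: "AE x in lebesgue_on \<Omega>. a x \<le> Na"
    using Linf_on_AE[of \<Omega> a] a N unfolding Na_def[symmetric] by (auto simp: admissible_coeff_def elim!: eventually_mono)
  have b_le: "AE x in lebesgue_on \<Omega>. b x \<le> Nb"
    using Linf_on_AE[of \<Omega> b] b N unfolding Nb_def[symmetric] by (auto simp: admissible_coeff_def elim!: eventually_mono)
  have F_le: "AE x in lebesgue_on \<Omega>. F x \<le> lam * Na * (u x powr \<alpha>1 * v x powr \<beta>1)"
    using a_le by eventually_elim (use lam in \<open>auto simp: F_def intro!: mult_right_mono mult_left_mono\<close>)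
  have H_le: "AE x in lebesgue_on \<Omega>. H x \<le> mu * Nb * (v x powr \<alpha>2 * u x powr \<beta>2)"
    using b_le by eventually_elim (use lam in \<open>auto simp: H_def intro!: mult_right_mono mult_left_mono\<close>)
  have "\<exists>K. AE x in lebesgue. u x \<le> K" "\<exists>K. AE x in lebesgue. v x \<le> K"
  proof -
    have F': "AE x in lebesgue_on \<Omega>. F x \<le> lam * Na * max (u x) (v x powr \<rho>) powr (p - 1)"
      using F_le
    proof eventually_elim
      fix x assume "F x \<le> lam * Na * (u x powr \<alpha>1 * v x powr \<beta>1)"
      also have "\<dots> \<le> lam * Na * max (u x) (v x powr \<rho>) powr (\<alpha>1 + P)"
        using lam N nonneg \<alpha> \<rho> PQ by (intro mult_left_mono powr_mult_powr_le_max_powr) auto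
      finally show "F x \<le> lam * Na * max (u x) (v x powr \<rho>) powr (p - 1)" by (simp add: P_def)
    qed
    have H': "AE x in lebesgue_on \<Omega>. H x \<le> mu * Nb * max (v x) (u x powr (1 / \<rho>)) powr (q - 1)"
      using H_le
    proof eventually_elim
      fix x assume "H x \<le> mu * Nb * (v x powr \<alpha>2 * u x powr \<beta>2)"
      also have "\<dots> \<le> mu * Nb * max (v x) (u x powr (1 / \<rho>)) powr (\<alpha>2 + Q)"
        using lam N nonneg \<alpha> \<rho>' PQ by (intro mult_left_mono powr_mult_powr_le_max_powr) auto
      finally show "H x \<le> mu * Nb * max (v x) (u x powr (1 / \<rho>)) powr (q - 1)" by (simp add: Q_def)
    qed
    show "\<exists>K. AE x in lebesgue. u x \<le> K" "\<exists>K. AE x in lebesgue. v x \<le> K"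
      using system_bounded[OF s pq \<Omega>(2) \<Omega>m wu wv F' _ H' _ nonneg \<rho>(1)] lam N by auto
  qed
  then obtain K1 K2 where K: "AE x in lebesgue. u x \<le> K1" "AE x in lebesgue. v x \<le> K2" by blast
  obtain M where M: "0 \<le> M" "AE x in lebesgue. u x \<le> M" "\<And>c. AE x in lebesgue. u x \<le> c \<Longrightarrow> M \<le> c"
    using least_AE_upper_bound[OF K(1) nonneg(1)] by blast
  obtain L where L: "0 \<le> L" "AE x in lebesgue. v x \<le> L" "\<And>c. AE x in lebesgue. v x \<le> c \<Longrightarrow> L \<le> c"
    using least_AE_upper_bound[OF K(2) nonneg(2)] by blast
  have not_null: "\<not> (AE x in lebesgue. w x \<le> 0)"
    if "AE x in lebesgue_on \<Omega>. 0 < h x" "AE x in lebesgue. h x = w x" for h w :: "'a \<Rightarrow> real"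
  proof
    assume "AE x in lebesgue. w x \<le> 0"
    moreover have "AE x in lebesgue. x \<in> \<Omega> \<longrightarrow> 0 < h x" using that(1) by (simp add: AE_lebesgue_on_iff'[OF \<Omega>m])
    ultimately have "AE x in lebesgue. x \<notin> \<Omega>" using that(2) by eventually_elim auto
    then have "\<Omega> \<in> null_sets lebesgue" using \<Omega>m by (simp add: AE_iff_null_sets)
    then show False using open_not_negligible[OF \<Omega>(1,3)] by (simp add: negligible_iff_null_sets)
  qed
  have sup_pos: "0 < M" "0 < L"
    using M(1,2) L(1,2) not_null[OF pos(1) ae_eq(1)] not_null[OF pos(2) ae_eq(2)] by (auto simp: less_le)
  define d where "d = diameter \<Omega>"
  obtain x0 where "x0 \<in> \<Omega>" using \<Omega>(3) by blast
  then have d: "0 < d" "\<Omega> \<subseteq> ball x0 d"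
    using open_subset_ball_diameter[OF \<Omega>(1,2)] by (auto simp: d_def)
  define C1 where "C1 = torsion_sup TYPE('a) s1 p"
  define C2 where "C2 = torsion_sup TYPE('a) s2 q"
  have C: "0 \<le> C1" "0 \<le> C2"
    unfolding C1_def C2_def using torsion_function_props(5) s pq by blast+
  have M_le: "M powr P \<le> lam * Na * L powr \<beta>1 * d powr (s1 * p) * C1 powr (p - 1)"
    unfolding P_def C1_def
    by (rule least_bound_le_torsion[OF s(1) pq(1) wu \<Omega>m d(2,1) F_le _ _ _ nonneg sup_pos M(2,3) L(2)])
       (use lam N \<alpha> \<beta> in auto)
  have L_le: "L powr Q \<le> mu * Nb * M powr \<beta>2 * d powr (s2 * q) * C2 powr (q - 1)"
    unfolding Q_def C2_def
    by (rule least_bound_le_torsion[OF s(2) pq(2) wv \<Omega>m d(2,1) H_le _ _ _ nonneg(2,1) sup_pos(2,1) L(2,3) M(2)])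
       (use lam N \<alpha> \<beta> in auto)
  have \<theta>\<zeta>: "0 < \<theta>" "0 < \<zeta>" using PQ \<beta> by (auto simp: \<theta> \<zeta> P_def Q_def)
  have sq: "\<theta> * \<theta> = \<beta>1 * P" "\<zeta> * \<zeta> = \<beta>2 * Q" using PQ \<beta> by (auto simp: \<theta> \<zeta> P_def Q_def)
  have exponents: "P / \<theta> = \<beta>2 / \<zeta>" "Q / \<zeta> = \<beta>1 / \<theta>"
  proof -
    have "(\<theta> * \<zeta>)\<^sup>2 = (P * Q)\<^sup>2"
      using sq PQ(3) by (simp add: power2_eq_square mult_ac)
    then have tz: "\<theta> * \<zeta> = P * Q" using \<theta>\<zeta> PQ by (simp add: power2_eq_iff_nonneg)
    have "P * \<zeta> * \<theta> = \<beta>2 * \<theta> * \<theta>" using sq(1) tz PQ(3) by (simp add: mult_ac)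
    then have "P * \<zeta> = \<beta>2 * \<theta>" using \<theta>\<zeta> by simp
    then show "P / \<theta> = \<beta>2 / \<zeta>" using \<theta>\<zeta> by (simp add: frac_eq_eq)
    have "Q * \<theta> * \<zeta> = \<beta>1 * \<zeta> * \<zeta>" using sq(2) tz PQ(3) by (simp add: mult_ac)
    then have "Q * \<theta> = \<beta>1 * \<zeta>" using \<theta>\<zeta> by simp
    then show "Q / \<zeta> = \<beta>1 / \<theta>" using \<theta>\<zeta> by (simp add: frac_eq_eq)
  qed
  have "M powr (P / \<theta>) = (M powr P) powr (1 / \<theta>)" by (simp add: powr_powr)
  also have "\<dots> \<le> (lam * Na * L powr \<beta>1 * d powr (s1 * p) * C1 powr (p - 1)) powr (1 / \<theta>)"
    using M_le \<theta>\<zeta> by (intro powr_mono2) auto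
  also have "\<dots> = lam powr (1 / \<theta>) * Na powr (1 / \<theta>) * L powr (\<beta>1 / \<theta>) * d powr (s1 * p / \<theta>) * C1 powr ((p - 1) / \<theta>)"
    using lam N sup_pos d C by (simp add: powr_mult powr_powr)
  finally have 1: "M powr (P / \<theta>) \<le> lam powr (1 / \<theta>) * Na powr (1 / \<theta>) * L powr (\<beta>1 / \<theta>) * d powr (s1 * p / \<theta>) * C1 powr ((p - 1) / \<theta>)" .
  have "L powr (Q / \<zeta>) = (L powr Q) powr (1 / \<zeta>)" by (simp add: powr_powr)
  also have "\<dots> \<le> (mu * Nb * M powr \<beta>2 * d powr (s2 * q) * C2 powr (q - 1)) powr (1 / \<zeta>)"
    using L_le \<theta>\<zeta> by (intro powr_mono2) auto
  also have "\<dots> = mu powr (1 / \<zeta>) * Nb powr (1 / \<zeta>) * M powr (\<beta>2 / \<zeta>) * d powr (s2 * q / \<zeta>) * C2 powr ((q - 1) / \<zeta>)"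
    using lam N sup_pos d C by (simp add: powr_mult powr_powr)
  finally have 2: "L powr (Q / \<zeta>) \<le> mu powr (1 / \<zeta>) * Nb powr (1 / \<zeta>) * M powr (\<beta>2 / \<zeta>) * d powr (s2 * q / \<zeta>) * C2 powr ((q - 1) / \<zeta>)" .
  \<comment> \<open>By the equality of the exponents this positive factor occurs on both sides and cancels.\<close>
  define W where "W = M powr (P / \<theta>) * L powr (Q / \<zeta>)"
  have W: "0 < W" using sup_pos by (simp add: W_def)
  have "W * 1 \<le> (lam powr (1 / \<theta>) * Na powr (1 / \<theta>) * L powr (\<beta>1 / \<theta>) * d powr (s1 * p / \<theta>) * C1 powr ((p - 1) / \<theta>))
    * (mu powr (1 / \<zeta>) * Nb powr (1 / \<zeta>) * M powr (\<beta>2 / \<zeta>) * d powr (s2 * q / \<zeta>) * C2 powr ((q - 1) / \<zeta>))"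
    unfolding W_def mult_1_right using 1 2 by (intro mult_mono) auto
  also have "\<dots> = W * (lam powr (1 / \<theta>) * mu powr (1 / \<zeta>) * (C1 powr ((p - 1) / \<theta>) * C2 powr ((q - 1) / \<zeta>)
      * (d powr (s1 * p / \<theta>) * d powr (s2 * q / \<zeta>)) * Na powr (1 / \<theta>) * Nb powr (1 / \<zeta>)))"
    unfolding W_def exponents by (simp only: mult_ac)
  also have "d powr (s1 * p / \<theta>) * d powr (s2 * q / \<zeta>) = d powr (p * s1 / \<theta> + q * s2 / \<zeta>)"
    by (simp add: powr_add mult.commute)
  finally show ?thesis
    using W unfolding C1_def C2_def d_def Na_def Nb_def by (simp only: mult_le_cancel_left_pos)
qed

theorem theorem4:
  fixes p q s1 s2 \<alpha>1 \<alpha>2 \<beta>1 \<beta>2 \<theta> \<zeta> :: real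
  assumes "1 < p" "1 < q" "0 < s1" "s1 < 1" "0 < s2" "s2 < 1"
    and "0 \<le> \<alpha>1" "0 \<le> \<alpha>2" "0 < \<beta>1" "0 < \<beta>2"
    and "\<alpha>1 < p - 1" "\<alpha>2 < q - 1"
    and "\<beta>1 * \<beta>2 = (p - 1 - \<alpha>1) * (q - 1 - \<alpha>2)"
    and "\<theta> = sqrt (\<beta>1 * (p - 1 - \<alpha>1))"
    and "\<zeta> = sqrt (\<beta>2 * (q - 1 - \<alpha>2))"
  shows
    "(\<forall>(\<Omega> :: 'a::euclidean_space set) a b \<Lambda>0.
        bounded_C2_domain \<Omega> \<and> admissible_coeff \<Omega> a \<and> admissible_coeff \<Omega> b \<and> 0 < \<Lambda>0 \<and>
        principal_eigenvalues p q s1 s2 \<alpha>1 \<alpha>2 \<beta>1 \<beta>2 \<Omega> a b = curve \<theta> \<zeta> \<Lambda>0 \<longrightarrow>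
        \<Lambda>0 \<ge> 1 / (torsion_sup TYPE('a) s1 p powr ((p - 1) / \<theta>)
                  * torsion_sup TYPE('a) s2 q powr ((q - 1) / \<zeta>)
                  * diameter \<Omega> powr (p * s1 / \<theta> + q * s2 / \<zeta>)
                  * Linf_norm \<Omega> a powr (1 / \<theta>)
                  * Linf_norm \<Omega> b powr (1 / \<zeta>))) \<and>
     (\<forall>K :: real.
        filterlim (\<lambda>(\<Omega>, a, b, \<Lambda>0). \<Lambda>0) at_top
          (inf (filtercomap (\<lambda>(\<Omega>, a, b, \<Lambda>0). diameter \<Omega>) (at_right 0))
               (principal {(\<Omega> :: 'a set, a, b, \<Lambda>0).
                  bounded_C2_domain \<Omega> \<and> admissible_coeff \<Omega> a \<and> admissible_coeff \<Omega> b \<and>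
                  Linf_norm \<Omega> a \<le> K \<and> Linf_norm \<Omega> b \<le> K \<and> 0 < \<Lambda>0 \<and>
                  principal_eigenvalues p q s1 s2 \<alpha>1 \<alpha>2 \<beta>1 \<beta>2 \<Omega> a b = curve \<theta> \<zeta> \<Lambda>0})))"
proof -
  let ?e = "p * s1 / \<theta> + q * s2 / \<zeta>"
  define C where "C = torsion_sup TYPE('a) s1 p powr ((p - 1) / \<theta>) * torsion_sup TYPE('a) s2 q powr ((q - 1) / \<zeta>)"
  have \<theta>\<zeta>: "0 < \<theta>" "0 < \<zeta>" using assms by auto
  have bound: "1 \<le> \<Lambda>0 * (C * diameter \<Omega> powr ?e * Linf_norm \<Omega> a powr (1 / \<theta>) * Linf_norm \<Omega> b powr (1 / \<zeta>))"
    if \<Omega>: "bounded_C2_domain \<Omega>" and a: "admissible_coeff \<Omega> a" and b: "admissible_coeff \<Omega> b" and pos: "0 < \<Lambda>0"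
      and eq: "principal_eigenvalues p q s1 s2 \<alpha>1 \<alpha>2 \<beta>1 \<beta>2 \<Omega> a b = curve \<theta> \<zeta> \<Lambda>0"
    for \<Omega> :: "'a set" and a b \<Lambda>0
  proof -
    \<comment> \<open>Any point of the curve serves; this one has first coordinate \<open>1\<close>.\<close>
    have \<Lambda>0: "1 powr (1 / \<theta>) * (\<Lambda>0 powr \<zeta>) powr (1 / \<zeta>) = \<Lambda>0"
      using pos \<theta>\<zeta> by (simp add: powr_powr)
    then have "(1, \<Lambda>0 powr \<zeta>) \<in> principal_eigenvalues p q s1 s2 \<alpha>1 \<alpha>2 \<beta>1 \<beta>2 \<Omega> a b"
      unfolding eq curve_def using pos by simp
    moreover have "open \<Omega>" "bounded \<Omega>" "\<Omega> \<noteq> {}" using \<Omega> by (auto simp: bounded_C2_domain_def)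
    ultimately show ?thesis
      using principal_eigenvalue_bound[OF assms(1,2,3,5,7,8,11,12,9,10,13,14,15) _ _ _ a b, of 1 "\<Lambda>0 powr \<zeta>"]
      unfolding \<Lambda>0 C_def by blast
  qed
  show ?thesis
  proof (intro conjI allI impI)
    fix \<Omega> :: "'a set" and a b \<Lambda>0
    assume *: "bounded_C2_domain \<Omega> \<and> admissible_coeff \<Omega> a \<and> admissible_coeff \<Omega> b \<and> 0 < \<Lambda>0 \<and>
        principal_eigenvalues p q s1 s2 \<alpha>1 \<alpha>2 \<beta>1 \<beta>2 \<Omega> a b = curve \<theta> \<zeta> \<Lambda>0"
    let ?X = "C * diameter \<Omega> powr ?e * Linf_norm \<Omega> a powr (1 / \<theta>) * Linf_norm \<Omega> b powr (1 / \<zeta>)"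
    have 1: "1 \<le> \<Lambda>0 * ?X" using * by (intro bound) auto
    have "0 < ?X"
    proof (rule ccontr)
      assume "\<not> 0 < ?X"
      then have "?X \<le> 0" by (simp only: not_less)
      with * have "\<Lambda>0 * ?X \<le> 0" using mult_nonneg_nonpos[of \<Lambda>0 ?X] by linarith
      then show False using 1 by linarith
    qed
    then have "1 / ?X \<le> \<Lambda>0" using 1 by (simp add: divide_le_eq)
    then show "\<Lambda>0 \<ge> 1 / (torsion_sup TYPE('a) s1 p powr ((p - 1) / \<theta>)
                  * torsion_sup TYPE('a) s2 q powr ((q - 1) / \<zeta>)
                  * diameter \<Omega> powr (p * s1 / \<theta> + q * s2 / \<zeta>)
                  * Linf_norm \<Omega> a powr (1 / \<theta>)
                  * Linf_norm \<Omega> b powr (1 / \<zeta>))" by (simp only: C_def)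
  next
    fix K :: real
    let ?S = "{(\<Omega> :: 'a set, a, b, \<Lambda>0).
                  bounded_C2_domain \<Omega> \<and> admissible_coeff \<Omega> a \<and> admissible_coeff \<Omega> b \<and>
                  Linf_norm \<Omega> a \<le> K \<and> Linf_norm \<Omega> b \<le> K \<and> 0 < \<Lambda>0 \<and>
                  principal_eigenvalues p q s1 s2 \<alpha>1 \<alpha>2 \<beta>1 \<beta>2 \<Omega> a b = curve \<theta> \<zeta> \<Lambda>0}"
    define B where "B = C * K powr (1 / \<theta>) * K powr (1 / \<zeta>)"
    have C: "0 \<le> C" by (simp add: C_def)
    have B: "0 \<le> B" using C by (simp add: B_def)
    have main: "1 \<le> \<Lambda>0 * (B * diameter \<Omega> powr ?e)" if "(\<Omega>, a, b, \<Lambda>0) \<in> ?S" for \<Omega> a b \<Lambda>0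
    proof -
      have *: "bounded_C2_domain \<Omega>" "admissible_coeff \<Omega> a" "admissible_coeff \<Omega> b" "0 < \<Lambda>0"
        "Linf_norm \<Omega> a \<le> K" "Linf_norm \<Omega> b \<le> K"
        "principal_eigenvalues p q s1 s2 \<alpha>1 \<alpha>2 \<beta>1 \<beta>2 \<Omega> a b = curve \<theta> \<zeta> \<Lambda>0"
        using that by auto
      have N: "0 < Linf_norm \<Omega> a" "0 < Linf_norm \<Omega> b"
        using *(1-3) by (auto simp: bounded_C2_domain_def intro: admissible_coeff_norm_pos)
      have "1 \<le> \<Lambda>0 * (C * diameter \<Omega> powr ?e * Linf_norm \<Omega> a powr (1 / \<theta>) * Linf_norm \<Omega> b powr (1 / \<zeta>))"
        using * by (intro bound)
      also have "\<dots> \<le> \<Lambda>0 * (C * diameter \<Omega> powr ?e * K powr (1 / \<theta>) * K powr (1 / \<zeta>))"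
        using * N C \<theta>\<zeta> by (intro mult_left_mono mult_mono powr_mono2) auto
      also have "C * diameter \<Omega> powr ?e * K powr (1 / \<theta>) * K powr (1 / \<zeta>) = B * diameter \<Omega> powr ?e"
        by (simp add: B_def mult_ac)
      finally show ?thesis .
    qed
    show "filterlim (\<lambda>(\<Omega>, a, b, \<Lambda>0). \<Lambda>0) at_top
          (inf (filtercomap (\<lambda>(\<Omega>, a, b, \<Lambda>0). diameter \<Omega>) (at_right 0)) (principal ?S))"
      unfolding filterlim_at_top eventually_inf_principal
    proof
      fix Z :: real
      have "((\<lambda>d. Z * B * d powr ?e) \<longlongrightarrow> Z * B * 0) (at_right 0)"
      proof (intro tendsto_mult tendsto_const tendsto_zero_powrI)
        show "\<forall>\<^sub>F d :: real in at_right 0. 0 \<le> d" by (auto simp: eventually_at_filter)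
        show "0 < ?e" using assms(1-6) \<theta>\<zeta> by (simp add: add_pos_pos)
      qed (rule tendsto_ident_at tendsto_const)+
      then have ev: "\<forall>\<^sub>F d in at_right 0. Z * B * d powr ?e < 1"
        by (rule order_tendstoD) simp
      show "\<forall>\<^sub>F x in filtercomap (\<lambda>(\<Omega>, a, b, \<Lambda>0). diameter \<Omega>) (at_right 0).
          x \<in> ?S \<longrightarrow> Z \<le> (case x of (\<Omega>, a, b, \<Lambda>0) \<Rightarrow> \<Lambda>0)"
        unfolding eventually_filtercomap
      proof (intro exI conjI allI impI)
        show "\<forall>\<^sub>F d in at_right 0. Z * B * d powr ?e < 1" by (rule ev)
        fix x assume small: "Z * B * (case x of (\<Omega>, a, b, \<Lambda>0) \<Rightarrow> diameter \<Omega>) powr ?e < 1" and x: "x \<in> ?S"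
        obtain \<Omega> a b \<Lambda>0 where x_eq: "x = (\<Omega>, a, b, \<Lambda>0)" by (cases x) auto
        have "Z \<le> \<Lambda>0"
        proof (rule ccontr)
          assume "\<not> Z \<le> \<Lambda>0"
          then have "\<Lambda>0 * (B * diameter \<Omega> powr ?e) \<le> Z * (B * diameter \<Omega> powr ?e)"
            using B by (intro mult_right_mono) auto
          then show False using main[of \<Omega> a b \<Lambda>0] x small unfolding x_eq by (simp add: mult.assoc)
        qed
        then show "Z \<le> (case x of (\<Omega>, a, b, \<Lambda>0) \<Rightarrow> \<Lambda>0)" by (simp add: x_eq)
      qed
    qed
  qed
qed

end
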